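(* Let $E=\mathbb R^d$. Let $P$ and $P_n$, $n=1,2,\dots$, be probability measures on $(X,\mathcal B)$ corresponding to the determinantal random point fields defined by Hermitian kernels (operators) $K$ and $K_n$, respectively. Suppose that $K_n$ converges to $K$ in the weak operator topology on $L^2(E)$ and that $$\mathrm{Tr}(\chi_BK_n\chi_B)\underset{n\to\infty}{\longrightarrow}\mathrm{Tr}(\chi_BK\chi_B)$$ for every bounded Borel set $B\subset E$. Then the probability measures $P_n$ converge to $P$ weakly on the cylinder sets.
   Context: Random point fields. $X$ is the space of finite or countable configurations $\xi=(x_i)$ of particles in $E$ (coinciding particles allowed) that are locally finite: $\#_C(\xi)=\#\{i: x_i\in C\}<\infty$ for every compact $C\subset E$. $\mathcal B$ is the $\sigma$-algebra on $X$ generated by the cylinder sets $\{\xi\in X:\#_B(\xi)=n\}$, $B\subset E$ bounded Borel, $n\ge 0$. A random point field is a triplet $(X,\mathcal B,P)$ with $P$ a probability measure. Correlation functions. A locally integrable $\rho_k:E^k\to[0,\infty)$ is the $k$-point correlation function of $(X,\mathcal B,P)$ if for all disjoint bounded Borel $A_1,\dots,A_m\subset E$ and non-negative integers $k_i$ with $\sum k_i=k$, $\mathbb E\prod_{i=1}^m\frac{(\#_{A_i})!}{(\#_{A_i}-k_i)!}=\int_{A_1^{k_1}\times\dots\times A_m^{k_m}}\rho_k\,dx_1\cdots dx_k$, where $\frac{N!}{(N-k)!}=N(N-1)\cdots(N-k+1)$. Determinantal fields. $K$ is a bounded non-negative self-adjoint operator on $L^2(E)$ which is locally trace class: $\chi_BK\chi_B$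 is trace class for every bounded Borel $B$ ($\chi_B$ = multiplication by the indicator of $B$). Its integral kernel is chosen so that for every bounded measurable $B$ the function $y\mapsto K(\cdot,\cdot+y)\chi_B(\cdot+y)$ is continuous with values in $L^1(B)$, and $\mathrm{Tr}(\chi_BK\chi_B)=\int_BK(x,x)\,dx$. The determinantal random point field defined by $K$ is the one with $n$-point correlation functions $\rho_n(x_1,\dots,x_n)=\det(K(x_i,x_j))_{1\le i,j\le n}$, $n\ge1$; the same applies to each $K_n$. Weak convergence on the cylinder sets means: for every finite family of bounded Borel sets $B_1,\dots,B_m\subset E$, the joint distribution of $(\#_{B_1},\dots,\#_{B_m})$ under $P_n$ converges (weakly) to its joint distribution under $P$. *)

theory Defs
  imports "HOL-Probability.Probability" "Jordan_Normal_Form.Determinant"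
begin

section \<open>Configurations and random point fields\<close>

text \<open>
  A configuration is encoded by its multiplicity function: \<open>\<xi> x\<close> is the number of particles
  located at \<open>x\<close>.  Local finiteness makes the set of occupied points countable.
\<close>

definition configurations :: "('a::euclidean_space \<Rightarrow> nat) set" where
  "configurations = {\<xi>. \<forall>C. compact C \<longrightarrow> finite {x \<in> C. \<xi> x \<noteq> 0}}"

definition particles_in :: "'a::euclidean_space set \<Rightarrow> ('a \<Rightarrow> nat) \<Rightarrow> nat" where
  "particles_in B \<xi> = (\<Sum>x \<in> {x \<in> B. \<xi> x \<noteq> 0}. \<xi> x)"

definition bounded_borel :: "'a::euclidean_space set \<Rightarrow> bool" where
  "bounded_borel B \<longleftrightarrow> bounded B \<and> B \<in> sets borel"

definition config_algebra :: "('a::euclidean_space \<Rightarrow> nat) measure" where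
  "config_algebra = sigma configurations
     {{\<xi> \<in> configurations. particles_in B \<xi> = n} | B n. bounded_borel B}"

definition random_point_field :: "('a::euclidean_space \<Rightarrow> nat) measure \<Rightarrow> bool" where
  "random_point_field P \<longleftrightarrow> prob_space P \<and> sets P = sets config_algebra"

text \<open>\<open>N (N - 1) \<dots> (N - k + 1)\<close>; for \<open>N < k\<close> the factor with \<open>j = N\<close> vanishes,
  so truncated subtraction does no harm.\<close>

definition falling_fact :: "nat \<Rightarrow> nat \<Rightarrow> nat" where
  "falling_fact N k = (\<Prod>j<k. N - j)"

text \<open>\<open>E\<^sup>k\<close> with Lebesgue measure; points are functions on the index set \<open>{..<k}\<close>.\<close>

abbreviation lborel_pow :: "nat \<Rightarrow> (nat \<Rightarrow> 'a::euclidean_space) measure" where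
  "lborel_pow k \<equiv> PiM {..<k} (\<lambda>_. lborel)"

text \<open>The product of the powers \<open>A i ^ \<kappa> i\<close> over \<open>i < m\<close>: the list \<open>Fs\<close> of its factors
  contains \<open>A i\<close> repeated \<open>\<kappa> i\<close> times.\<close>

definition power_box :: "nat \<Rightarrow> (nat \<Rightarrow> 'a set) \<Rightarrow> (nat \<Rightarrow> nat) \<Rightarrow> (nat \<Rightarrow> 'a) set" where
  "power_box m A \<kappa> =
     (let Fs = concat (map (\<lambda>i. replicate (\<kappa> i) (A i)) [0..<m])
      in PiE {..<length Fs} (\<lambda>j. Fs ! j))"

definition correlation_function ::
  "('a::euclidean_space \<Rightarrow> nat) measure \<Rightarrow> nat \<Rightarrow> ((nat \<Rightarrow> 'a) \<Rightarrow> real) \<Rightarrow> bool" where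
  "correlation_function P k \<rho> \<longleftrightarrow>
     \<rho> \<in> borel_measurable (lborel_pow k) \<and>
     (\<forall>x \<in> space (lborel_pow k). 0 \<le> \<rho> x) \<and>
     (\<forall>C. compact C \<longrightarrow> set_integrable (lborel_pow k) (PiE {..<k} (\<lambda>_. C)) \<rho>) \<and>
     (\<forall>m A \<kappa>. (\<forall>i<m. bounded_borel (A i)) \<longrightarrow> disjoint_family_on A {..<m} \<longrightarrow>
        (\<Sum>i<m. \<kappa> i) = k \<longrightarrow>
        (\<integral>\<^sup>+ \<xi>. of_nat (\<Prod>i<m. falling_fact (particles_in (A i) \<xi>) (\<kappa> i)) \<partial>P) =
        (\<integral>\<^sup>+ x \<in> power_box m A \<kappa>. ennreal (\<rho> x) \<partial>lborel_pow k))"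

section \<open>Operators on \<open>L\<^sup>2(E)\<close>\<close>

text \<open>
  Elements of \<open>L\<^sup>2(E)\<close> are represented by Borel measurable square-integrable functions, and
  operators by maps between such representatives; identities hold almost everywhere.
\<close>

definition L2 :: "('a::euclidean_space \<Rightarrow> complex) set" where
  "L2 = {f \<in> borel_measurable lborel. integrable lborel (\<lambda>x. (cmod (f x))\<^sup>2)}"

definition L2_inner :: "('a::euclidean_space \<Rightarrow> complex) \<Rightarrow> ('a \<Rightarrow> complex) \<Rightarrow> complex" where
  "L2_inner f g = (LINT x|lborel. f x * cnj (g x))"

definition L2_norm :: "('a::euclidean_space \<Rightarrow> complex) \<Rightarrow> real" where
  "L2_norm f = sqrt (LINT x|lborel. (cmod (f x))\<^sup>2)"

type_synonym 'a operator = "('a \<Rightarrow> complex) \<Rightarrow> 'a \<Rightarrow> complex"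

text \<open>Linearity and boundedness together imply that \<open>T\<close> respects equality almost everywhere.\<close>

definition bounded_operator :: "'a::euclidean_space operator \<Rightarrow> bool" where
  "bounded_operator T \<longleftrightarrow>
     (\<forall>f \<in> L2. T f \<in> L2) \<and>
     (\<forall>f \<in> L2. \<forall>g \<in> L2. AE x in lborel. T (\<lambda>y. f y + g y) x = T f x + T g x) \<and>
     (\<forall>c. \<forall>f \<in> L2. AE x in lborel. T (\<lambda>y. c * f y) x = c * T f x) \<and>
     (\<exists>C. \<forall>f \<in> L2. L2_norm (T f) \<le> C * L2_norm f)"

definition self_adjoint :: "'a::euclidean_space operator \<Rightarrow> bool" where
  "self_adjoint T \<longleftrightarrow> (\<forall>f \<in> L2. \<forall>g \<in> L2. L2_inner (T f) g = L2_inner f (T g))"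

text \<open>To be used for self-adjoint \<open>T\<close>, where \<open>\<langle>T f, f\<rangle>\<close> is real.\<close>

definition nonneg_operator :: "'a::euclidean_space operator \<Rightarrow> bool" where
  "nonneg_operator T \<longleftrightarrow> (\<forall>f \<in> L2. 0 \<le> Re (L2_inner (T f) f))"

definition weak_operator_lim ::
  "(nat \<Rightarrow> 'a::euclidean_space operator) \<Rightarrow> 'a operator \<Rightarrow> bool" where
  "weak_operator_lim Tn T \<longleftrightarrow>
     (\<forall>f \<in> L2. \<forall>g \<in> L2. (\<lambda>n. L2_inner (Tn n f) g) \<longlonglongrightarrow> L2_inner (T f) g)"

text \<open>Since \<open>E\<close> has positive dimension, \<open>L\<^sup>2(E)\<close> is separable and infinite-dimensional, so every
  orthonormal basis is a sequence.\<close>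

definition orthonormal_basis :: "(nat \<Rightarrow> 'a::euclidean_space \<Rightarrow> complex) \<Rightarrow> bool" where
  "orthonormal_basis e \<longleftrightarrow>
     (\<forall>i. e i \<in> L2) \<and>
     (\<forall>i j. L2_inner (e i) (e j) = (if i = j then 1 else 0)) \<and>
     (\<forall>f \<in> L2. (\<forall>i. L2_inner f (e i) = 0) \<longrightarrow> (AE x in lborel. f x = 0))"

text \<open>The trace is the value of \<open>\<Sum>\<^sub>n \<langle>T e\<^sub>n, e\<^sub>n\<rangle>\<close>, common to all orthonormal bases.\<close>

definition has_op_trace :: "'a::euclidean_space operator \<Rightarrow> complex \<Rightarrow> bool" where
  "has_op_trace T t \<longleftrightarrow>
     (\<forall>e. orthonormal_basis e \<longrightarrow> (\<lambda>n. L2_inner (T (e n)) (e n)) sums t)"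

definition op_trace :: "'a::euclidean_space operator \<Rightarrow> complex" where
  "op_trace T = (THE t. has_op_trace T t)"

text \<open>\<open>S = |T|\<close>, i.e. \<open>S\<close> is the non-negative square root of \<open>T\<^sup>* T\<close>; the equation
  \<open>S\<^sup>2 = T\<^sup>* T\<close> is expressed by means of inner products.\<close>

definition is_abs_operator :: "'a::euclidean_space operator \<Rightarrow> 'a operator \<Rightarrow> bool" where
  "is_abs_operator S T \<longleftrightarrow>
     bounded_operator S \<and> self_adjoint S \<and> nonneg_operator S \<and>
     (\<forall>f \<in> L2. \<forall>g \<in> L2. L2_inner (S f) (S g) = L2_inner (T f) (T g))"

definition trace_class :: "'a::euclidean_space operator \<Rightarrow> bool" where
  "trace_class T \<longleftrightarrow> bounded_operator T \<and> (\<exists>S t. is_abs_operator S T \<and> has_op_trace S t)"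

definition mult_indicator :: "'a set \<Rightarrow> 'a operator" where
  "mult_indicator B f = (\<lambda>x. indicator B x * f x)"

definition compress :: "'a set \<Rightarrow> 'a operator \<Rightarrow> 'a operator" where
  "compress B T = mult_indicator B \<circ> T \<circ> mult_indicator B"

section \<open>Determinantal random point fields\<close>

text \<open>For a locally trace class operator the kernel is obtained locally, so the integral
  representation is only required after restricting both variables to bounded sets.\<close>

definition integral_kernel ::
  "'a::euclidean_space operator \<Rightarrow> ('a \<Rightarrow> 'a \<Rightarrow> complex) \<Rightarrow> bool" where
  "integral_kernel T k \<longleftrightarrow>
     case_prod k \<in> borel_measurable (lborel \<Otimes>\<^sub>M lborel) \<and>
     (\<forall>B. bounded_borel B \<longrightarrow> (\<forall>f \<in> L2. AE x in lborel. x \<in> B \<longrightarrow>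
        set_integrable lborel B (\<lambda>y. k x y * f y) \<and>
        T (mult_indicator B f) x = (LINT y:B|lborel. k x y * f y)))"

text \<open>The function \<open>y \<mapsto> k(\<cdot>, \<cdot> + y) \<chi>\<^sub>B(\<cdot> + y)\<close> takes values in \<open>L\<^sup>1(B)\<close> and is continuous.\<close>

definition L1_continuous_kernel ::
  "'a::euclidean_space set \<Rightarrow> ('a \<Rightarrow> 'a \<Rightarrow> complex) \<Rightarrow> bool" where
  "L1_continuous_kernel B k \<longleftrightarrow>
     (let F = (\<lambda>y x. k x (x + y) * indicator B (x + y)) in
       (\<forall>y. set_integrable lborel B (F y)) \<and>
       (\<forall>y. ((\<lambda>z. LINT x:B|lborel. cmod (F z x - F y x)) \<longlongrightarrow> 0) (at y)))"

definition determinantal_kernel ::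
  "'a::euclidean_space operator \<Rightarrow> ('a \<Rightarrow> 'a \<Rightarrow> complex) \<Rightarrow> bool" where
  "determinantal_kernel K k \<longleftrightarrow>
     bounded_operator K \<and> self_adjoint K \<and> nonneg_operator K \<and>
     (\<forall>B. bounded_borel B \<longrightarrow> trace_class (compress B K)) \<and>
     integral_kernel K k \<and>
     (\<forall>B. bounded_borel B \<longrightarrow> L1_continuous_kernel B k \<and>
        has_op_trace (compress B K) (LINT x:B|lborel. k x x))"

text \<open>Correlation functions are only determined almost everywhere, and so is the determinant
  of a kernel; accordingly the two are identified almost everywhere.\<close>

definition determinantal_field ::
  "('a::euclidean_space \<Rightarrow> nat) measure \<Rightarrow> 'a operator \<Rightarrow> ('a \<Rightarrow> 'a \<Rightarrow> complex) \<Rightarrow> bool" where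
  "determinantal_field P K k \<longleftrightarrow>
     random_point_field P \<and> determinantal_kernel K k \<and>
     (\<forall>n\<ge>1. \<exists>\<rho>. correlation_function P n \<rho> \<and>
        (AE x in lborel_pow n.
           complex_of_real (\<rho> x) = Determinant.det (mat n n (\<lambda>(i, j). k (x i) (x j)))))"

section \<open>Weak convergence on the cylinder sets\<close>

definition weakly_converges :: "(nat \<Rightarrow> 'b::topological_space measure) \<Rightarrow> 'b measure \<Rightarrow> bool" where
  "weakly_converges Mn M \<longleftrightarrow>
     (\<forall>f :: 'b \<Rightarrow> real. continuous_on UNIV f \<longrightarrow> bounded (range f) \<longrightarrow>
        (\<lambda>n. LINT x|Mn n. f x) \<longlonglongrightarrow> (LINT x|M. f x))"

text \<open>\<open>\<real>\<^sup>m\<close> is embedded into \<open>\<real>\<^sup>\<nat>\<close> (product topology) as the closed subspace of sequences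
  vanishing from index \<open>m\<close> on; it is a retract, so weak convergence of measures
  concentrated on it has the same meaning in either space.\<close>

definition joint_distribution ::
  "('a::euclidean_space \<Rightarrow> nat) measure \<Rightarrow> nat \<Rightarrow> (nat \<Rightarrow> 'a set) \<Rightarrow> (nat \<Rightarrow> real) measure" where
  "joint_distribution P m B =
     distr P borel (\<lambda>\<xi> i. if i < m then real (particles_in (B i) \<xi>) else 0)"

definition weakly_converges_on_cylinders ::
  "(nat \<Rightarrow> ('a::euclidean_space \<Rightarrow> nat) measure) \<Rightarrow> ('a \<Rightarrow> nat) measure \<Rightarrow> bool" where
  "weakly_converges_on_cylinders Pn P \<longleftrightarrow>
     (\<forall>m B. (\<forall>i<m. bounded_borel (B i)) \<longrightarrow>
        weakly_converges (\<lambda>n. joint_distribution (Pn n) m B) (joint_distribution P m B))"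

end

(*
  On a cube C cut into dyadic cells, let k_N be the average of the kernel k over products of two
  cells; k_N(x, y) is the form <K phi_y, phi_x> of normalised cell indicators, hence positive
  semidefinite. Cauchy-Schwarz for this form gives
    |k_M - k_N|^2 (x, y) <= 2 (D(y) k_M(x, x) + k_N(y, y) D(x)),
  where D integrates to t_M - t_N and t_N is the integral of k_N(x, x). By the L^1 continuity of
  the kernel t_N tends to the trace t, and k_N tends to k along a subsequence almost everywhere, so
  Fatou's lemma bounds the Hilbert-Schmidt distance of k and k_N by 2 (t - t_N) (t + t_N). Since weak
  convergence of the operators controls the finitely many values of k_N, and the traces converge,
  the kernels of K_n converge to that of K in the Hilbert-Schmidt norm on C.

  Expanding det (k(x_i, x_j)) over permutations, each cycle of length at least two is continuous
  in this norm, while fixed points contribute traces; so all mixed factorial moments converge.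
  Hadamard's inequality for k_N bounds the m-th factorial moment of the number of particles in C
  by t^m. Hence a bounded function of the counts of disjoint sets is uniformly approximated in mean
  by a polynomial in them (Newton interpolation), and arbitrary sets are unions of disjoint atoms.
*)
theory Submission
  imports Defs
begin

text \<open>Weak convergence tests the kernels only against fixed functions, whereas fixed points of
  a permutation involve the values \<open>k x x\<close>, which sit on a null set of
  \<open>E x E\<close>. The trace hypothesis supplies this part. With positivity it also upgrades
  weak convergence: the trace lost by averaging bounds the Hilbert-Schmidt error, so nothing can
  escape to fine scales. Averages replace spectral theory, as only the form of the operator and its
  kernel enter; the L^1 continuity of the kernel is the link between averages and the diagonal.
  Positivity of the operator does not by itself make the matrices \<open>k (x i) (x j)\<close>
  positive semidefinite at individual points. Those of the averages are, being Gram matrices, and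
  estimates pass to \<open>k\<close> in the limit. Convergent moments give convergent laws only
  under a growth condition. Here the m-th binomial moment is at most \<open>t ^ m / m!\<close>, as
  for a Poisson law, so the expectation of \<open>6 ^ S\<close> is finite: \<open>3 ^ S\<close>
  dominates the interpolating polynomials, and the remaining \<open>2 ^ S\<close> pays for
  truncating them at \<open>L\<close>, with an error of order \<open>2 ^ -L\<close> for all n at
  once.\<close>

no_notation Matrix.scalar_prod (infix "\<bullet>" 70)

section \<open>Dyadic cells\<close>

text \<open>The half-open dyadic cube of side \<open>1 / 2 ^ N\<close> containing \<open>x\<close>,
  as an equivalence class instead of a member of an indexed family: membership is symmetric, which
  the Fubini arguments use, and averages become functions on the whole space.\<close>

definition dcell :: "nat \<Rightarrow> 'a::euclidean_space \<Rightarrow> 'a set" where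
  "dcell N x = {y. \<forall>b\<in>Basis. \<lfloor>2 ^ N * (y \<bullet> b)\<rfloor> = \<lfloor>2 ^ N * (x \<bullet> b)\<rfloor>}"

text \<open>Half-open with integer faces, so that it is a union of cells of every level.\<close>

definition dcube :: "nat \<Rightarrow> 'a::euclidean_space set" where
  "dcube R = {x. \<forall>b\<in>Basis. - real R \<le> x \<bullet> b \<and> x \<bullet> b < real R}"

text \<open>The volume of a cell depends on the space only; the type argument supplies the
  dimension.\<close>

definition cvol :: "'a::euclidean_space itself \<Rightarrow> nat \<Rightarrow> real" where
  "cvol _ N = (1 / 2 ^ N) ^ DIM('a)"

text \<open>Conditional expectation on the sigma-algebra of level-\<open>N\<close> cells. Domain and
  range are general, since it is applied on \<open>E\<close> and on \<open>E x E\<close>, to real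
  and to complex functions.\<close>

definition cell_avg :: "nat \<Rightarrow> ('a::euclidean_space \<Rightarrow> 'b::{banach,second_countable_topology}) \<Rightarrow> 'a \<Rightarrow> 'b" where
  "cell_avg N h x = (1 / cvol TYPE('a) N) *\<^sub>R (LINT y|lborel. indicator (dcell N x) y *\<^sub>R h y)"

lemma cvol_pos: "cvol TYPE('a::euclidean_space) N > 0"
  by (simp add: cvol_def)

lemma dcell_refl [simp]: "x \<in> dcell N x"
  by (simp add: dcell_def)

lemma dcell_sym: "y \<in> dcell N x \<longleftrightarrow> x \<in> dcell N y"
  by (auto simp: dcell_def)

lemma dcell_eq: "y \<in> dcell N x \<Longrightarrow> dcell N y = dcell N x"
  by (auto simp: dcell_def)

lemma sets_dcell [measurable]: "dcell N x \<in> sets borel"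
proof -
  have "dcell N x = (\<Inter>b\<in>Basis. {y\<in>space borel. \<lfloor>2 ^ N * (y \<bullet> b)\<rfloor> = \<lfloor>2 ^ N * (x \<bullet> b)\<rfloor>})"
    by (auto simp: dcell_def)
  also have "\<dots> \<in> sets borel"
    by (rule sets.finite_INT) auto
  finally show ?thesis .
qed

lemma pred_dcell [measurable (raw)]:
  assumes [measurable]: "f \<in> M \<rightarrow>\<^sub>M borel" "g \<in> M \<rightarrow>\<^sub>M (borel :: 'a::euclidean_space measure)"
  shows "Measurable.pred M (\<lambda>z. g z \<in> dcell N (f z))"
  unfolding dcell_def mem_Collect_eq by measurable

lemma sets_dcube [measurable]: "dcube R \<in> sets borel"
proof -
  have "dcube R = {x\<in>space borel. \<forall>b\<in>Basis. - real R \<le> x \<bullet> b \<and> x \<bullet> b < real R}"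
    by (auto simp: dcube_def)
  also have "\<dots> \<in> sets borel"
    by measurable
  finally show ?thesis .
qed

lemma dcell_coord: "y \<in> dcell N x \<Longrightarrow> b \<in> Basis \<Longrightarrow> \<bar>(y - x) \<bullet> b\<bar> < 1 / 2 ^ N"
proof -
  assume "y \<in> dcell N x" and b: "b \<in> Basis"
  then have "\<lfloor>2 ^ N * (y \<bullet> b)\<rfloor> = \<lfloor>2 ^ N * (x \<bullet> b)\<rfloor>" by (auto simp: dcell_def)
  then have "\<bar>2 ^ N * (y \<bullet> b) - 2 ^ N * (x \<bullet> b)\<bar> < 1" by linarith
  then have "2 ^ N * \<bar>(y - x) \<bullet> b\<bar> < 1"
    by (simp add: inner_diff_left abs_mult flip: right_diff_distrib)
  then show ?thesis by (simp add: field_simps)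
qed

lemma dcell_dist:
  fixes x y :: "'a::euclidean_space"
  assumes "y \<in> dcell N x" shows "norm (y - x) \<le> DIM('a) / 2 ^ N"
proof -
  have "norm (y - x) \<le> (\<Sum>b\<in>Basis. \<bar>(y - x) \<bullet> b\<bar>)" by (rule norm_le_l1)
  also have "\<dots> \<le> (\<Sum>b\<in>(Basis::'a set). 1 / 2 ^ N)"
    by (rule sum_mono) (use dcell_coord[OF assms] in force)
  finally show ?thesis by simp
qed

lemma cell_diameter_tendsto_0: "(\<lambda>N. c / 2 ^ N) \<longlonglongrightarrow> (0::real)"
  using tendsto_mult_left[OF LIMSEQ_power_zero[of "1/2 :: real"], of c] by (simp add: power_divide)

text \<open>The coarse index is the integer quotient of the fine one by \<open>2 ^ (M - N)\<close>,
  hence determined by it.\<close>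

lemma floor_scale_cong:
  fixes s t :: real assumes "\<lfloor>2 ^ M * s\<rfloor> = \<lfloor>2 ^ M * t\<rfloor>" "N \<le> M"
  shows "\<lfloor>2 ^ N * s\<rfloor> = \<lfloor>2 ^ N * t\<rfloor>"
proof -
  have *: "\<lfloor>2 ^ N * s\<rfloor> = \<lfloor>2 ^ M * s\<rfloor> div 2 ^ (M - N)" for s :: real
  proof -
    have "(2::real) ^ N * s = (2 ^ M * s) / real (2 ^ (M - N))"
    proof -
      have "(2::real) ^ M = 2 ^ (M - N) * 2 ^ N"
        using \<open>N \<le> M\<close> by (metis le_add_diff_inverse2 power_add)
      then show ?thesis by (simp only:) simp
    qed
    then show ?thesis
      using floor_divide_real_eq_div[of "2 ^ (M - N)" "2 ^ M * s"] by simp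
  qed
  show ?thesis using assms by (simp add: *)
qed

lemma dcell_antimono: "N \<le> M \<Longrightarrow> dcell M x \<subseteq> dcell N x"
  unfolding dcell_def using floor_scale_cong by blast

text \<open>Every cell lies in a level-0 cell, on which the integer parts of the coordinates are
  constant; as the faces of the cube are integral, integer parts decide membership.\<close>

lemma dcell_subset_dcube:
  assumes "x \<in> dcube R" shows "dcell N x \<subseteq> dcube R"
proof
  fix y assume "y \<in> dcell N x"
  then have "y \<in> dcell 0 x" using dcell_antimono by blast
  then have *: "\<lfloor>y \<bullet> b\<rfloor> = \<lfloor>x \<bullet> b\<rfloor>" if "b \<in> Basis" for b
    using that by (auto simp: dcell_def)
  show "y \<in> dcube R" unfolding dcube_def
  proof safe
    fix b :: 'a assume b: "b \<in> Basis"
    have "- real R \<le> x \<bullet> b" "x \<bullet> b < real R" using assms b by (auto simp: dcube_def)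
    then have "- int R \<le> \<lfloor>x \<bullet> b\<rfloor>" "\<lfloor>x \<bullet> b\<rfloor> < int R" by linarith+
    then have "- int R \<le> \<lfloor>y \<bullet> b\<rfloor>" "\<lfloor>y \<bullet> b\<rfloor> < int R" using *[OF b] by simp_all
    then show "- real R \<le> y \<bullet> b" "y \<bullet> b < real R" by linarith+
  qed
qed

lemma dcell_dcube_iff: "y \<in> dcell N x \<Longrightarrow> y \<in> dcube R \<longleftrightarrow> x \<in> dcube R"
  using dcell_subset_dcube[of x R N] dcell_subset_dcube[of y R N] dcell_sym[of y N x] by blast

text \<open>A half-open box lies between the open and the closed box with the same corners, and
  these have equal volume.\<close>

lemma emeasure_dcell:
  fixes x :: "'a::euclidean_space"
  shows "emeasure lborel (dcell N x) = ennreal (cvol TYPE('a) N)"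
proof -
  define l :: 'a where "l = (\<Sum>b\<in>Basis. (\<lfloor>2 ^ N * (x \<bullet> b)\<rfloor> / 2 ^ N) *\<^sub>R b)"
  define u :: 'a where "u = (\<Sum>b\<in>Basis. ((\<lfloor>2 ^ N * (x \<bullet> b)\<rfloor> + 1) / 2 ^ N) *\<^sub>R b)"
  have l: "l \<bullet> b = \<lfloor>2 ^ N * (x \<bullet> b)\<rfloor> / 2 ^ N" if "b \<in> Basis" for b
    using that by (simp add: l_def)
  have u: "u \<bullet> b = (\<lfloor>2 ^ N * (x \<bullet> b)\<rfloor> + 1) / 2 ^ N" if "b \<in> Basis" for b
    using that by (simp add: u_def)
  have ul: "(u - l) \<bullet> b = 1 / 2 ^ N" if "b \<in> Basis" for b
    using l[OF that] u[OF that] by (simp add: inner_diff_left flip: diff_divide_distrib)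
  have lu: "l \<bullet> b \<le> u \<bullet> b" if "b \<in> Basis" for b
    using ul[OF that] by (simp add: inner_diff_left) (smt (verit) zero_le_divide_1_iff zero_le_power)
  have "\<lfloor>2 ^ N * (y \<bullet> b)\<rfloor> = \<lfloor>2 ^ N * (x \<bullet> b)\<rfloor> \<longleftrightarrow> l \<bullet> b \<le> y \<bullet> b \<and> y \<bullet> b < u \<bullet> b"
    if "b \<in> Basis" for y b
    unfolding floor_eq_iff l[OF that] u[OF that] by (auto simp: field_simps)
  then have eq: "dcell N x = {y. \<forall>b\<in>Basis. l \<bullet> b \<le> y \<bullet> b \<and> y \<bullet> b < u \<bullet> b}"
    by (auto simp: dcell_def)
  have 1: "box l u \<subseteq> dcell N x" and 2: "dcell N x \<subseteq> cbox l u"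
    unfolding eq by (auto simp: mem_box less_imp_le)
  have "emeasure lborel (box l u) \<le> emeasure lborel (dcell N x)"
    by (rule emeasure_mono[OF 1]) simp
  moreover have "emeasure lborel (dcell N x) \<le> emeasure lborel (cbox l u)"
    by (rule emeasure_mono[OF 2]) simp
  moreover have "(\<Prod>b\<in>Basis. (u - l) \<bullet> b) = cvol TYPE('a) N"
    by (simp add: ul cvol_def)
  with lu have "emeasure lborel (box l u) = ennreal (cvol TYPE('a) N)"
     "emeasure lborel (cbox l u) = ennreal (cvol TYPE('a) N)"
    unfolding emeasure_lborel_box_eq emeasure_lborel_cbox_eq by simp_all
  ultimately show ?thesis by (metis antisym)
qed

lemma measure_dcell:
  fixes x :: "'a::euclidean_space"
  shows "measure lborel (dcell N x) = cvol TYPE('a) N"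
  using emeasure_dcell[of N x] cvol_pos[where ?'a='a, of N] by (simp add: measure_def)

lemma bounded_dcube: "bounded (dcube R :: 'a::euclidean_space set)"
proof (rule boundedI)
  fix x :: 'a assume x: "x \<in> dcube R"
  have "norm x \<le> (\<Sum>b\<in>Basis. \<bar>x \<bullet> b\<bar>)" by (rule norm_le_l1)
  also have "\<dots> \<le> (\<Sum>b\<in>(Basis::'a set). real R)"
    by (rule sum_mono) (use x in \<open>force simp: dcube_def\<close>)
  finally show "norm x \<le> (\<Sum>b\<in>(Basis::'a set). real R)" .
qed

lemma bounded_borel_dcube: "bounded_borel (dcube R)"
  by (simp add: bounded_borel_def bounded_dcube)

lemma bounded_borel_finite: "bounded_borel B \<Longrightarrow> emeasure lborel B < \<infinity>"
  using emeasure_bounded_finite[of B] by (simp add: bounded_borel_def)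

lemma emeasure_dcube_finite: "emeasure lborel (dcube R) < \<infinity>"
  using bounded_borel_dcube bounded_borel_finite by blast

lemma bounded_subset_dcube:
  fixes B :: "'a::euclidean_space set"
  assumes "bounded B" shows "\<exists>R. B \<subseteq> dcube R"
proof -
  obtain r where r: "\<And>x. x \<in> B \<Longrightarrow> norm x \<le> r" using assms by (auto simp: bounded_iff)
  obtain R :: nat where R: "r < R" using reals_Archimedean2 by blast
  have "B \<subseteq> dcube R"
  proof (clarsimp simp: dcube_def)
    fix x b :: 'a assume "x \<in> B" "b \<in> Basis"
    then have "\<bar>x \<bullet> b\<bar> < R" using r[of x] R Basis_le_norm[of b x] by linarith
    then show "- real R \<le> x \<bullet> b \<and> x \<bullet> b < R" by linarith
  qed
  then show ?thesis by blast
qed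

text \<open>Cells of \<open>E x E\<close> are products of cells of the same level, so the averages
  of a kernel over products of cells are instances of \<open>cell_avg\<close> on the product
  space.\<close>

lemma dcell_Pair: "dcell N (x, y) = dcell N x \<times> dcell N y"
  by (force simp: dcell_def Basis_prod_def)

lemma dcube_Pair: "dcube R = dcube R \<times> dcube R"
  by (force simp: dcube_def Basis_prod_def)

lemma cvol_prod: "cvol TYPE('a::euclidean_space \<times> 'a) N = (cvol TYPE('a) N)\<^sup>2"
  by (simp add: cvol_def power_add power2_eq_square)

text \<open>Restricted to \<open>Basis\<close>, so that indices live in a \<open>PiE\<close> space,
  where countability and finiteness of sets of cells are read off.\<close>

definition dindex :: "nat \<Rightarrow> 'a::euclidean_space \<Rightarrow> 'a \<Rightarrow> int" where
  "dindex N x = restrict (\<lambda>b. \<lfloor>2 ^ N * (x \<bullet> b)\<rfloor>) Basis"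

lemma dcell_dindex: "dcell N x = (\<lambda>z. dcell N (inv_into UNIV (dindex N) z)) (dindex N x)"
proof -
  let ?y = "inv_into UNIV (dindex N) (dindex N x)"
  have eq: "dindex N ?y = dindex N x" by (rule f_inv_into_f) simp
  have "\<lfloor>2 ^ N * (?y \<bullet> b)\<rfloor> = \<lfloor>2 ^ N * (x \<bullet> b)\<rfloor>" if "b \<in> Basis" for b
    using fun_cong[OF eq, of b] that unfolding dindex_def by (simp only: restrict_apply' if_True)
  then show ?thesis by (simp add: dcell_def)
qed

lemma countable_dcells: "countable (range (dcell N :: 'a::euclidean_space \<Rightarrow> _))"
proof -
  have "range (dindex N :: 'a \<Rightarrow> _) \<subseteq> PiE Basis (\<lambda>_. UNIV)" by (auto simp: dindex_def)
  moreover have "countable (PiE (Basis::'a set) (\<lambda>_. UNIV :: int set))"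
    by (intro countable_PiE) auto
  ultimately have "countable (range (dindex N :: 'a \<Rightarrow> _))" by (rule countable_subset)
  moreover have "range (dcell N :: 'a \<Rightarrow> _) = (\<lambda>z. dcell N (inv_into UNIV (dindex N) z)) ` range (dindex N)"
    unfolding image_image by (rule image_cong[OF refl dcell_dindex])
  ultimately show ?thesis by simp
qed

lemma finite_dcells_dcube: "finite (dcell N ` (dcube R :: 'a::euclidean_space set))"
proof -
  have "dindex N ` (dcube R :: 'a set) \<subseteq> PiE Basis (\<lambda>_. {- (2 ^ N * int R)..2 ^ N * int R})"
  proof (rule image_subsetI, rule PiE_I)
    fix x b :: 'a assume x: "x \<in> dcube R" and b: "b \<in> Basis"
    have "- real R \<le> x \<bullet> b" "x \<bullet> b \<le> real R" using x b by (auto simp: dcube_def less_imp_le)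
    then have "2 ^ N * (- real R) \<le> 2 ^ N * (x \<bullet> b)" "2 ^ N * (x \<bullet> b) \<le> 2 ^ N * real R"
      using mult_left_mono[of "- real R" "x \<bullet> b" "2 ^ N"] mult_left_mono[of "x \<bullet> b" "real R" "2 ^ N"]
      by simp_all
    then have "real_of_int (- (2 ^ N * int R)) \<le> 2 ^ N * (x \<bullet> b)" "2 ^ N * (x \<bullet> b) \<le> real_of_int (2 ^ N * int R)"
      by simp_all
    then have "- (2 ^ N * int R) \<le> \<lfloor>2 ^ N * (x \<bullet> b)\<rfloor>" "\<lfloor>2 ^ N * (x \<bullet> b)\<rfloor> \<le> 2 ^ N * int R"
      by (simp_all only: le_floor_iff, metis floor_mono floor_of_int)
    then show "dindex N x b \<in> {- (2 ^ N * int R)..2 ^ N * int R}" using b by (simp add: dindex_def)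
  qed (simp add: dindex_def)
  moreover have "finite (PiE (Basis::'a set) (\<lambda>_. {- (2 ^ N * int R)..2 ^ N * int R}))"
    by (intro finite_PiE) auto
  ultimately have "finite (dindex N ` (dcube R :: 'a set))" by (rule finite_subset)
  moreover have "dcell N ` (dcube R :: 'a set) = (\<lambda>z. dcell N (inv_into UNIV (dindex N) z)) ` dindex N ` dcube R"
    unfolding image_image by (rule image_cong[OF refl dcell_dindex])
  ultimately show ?thesis by simp
qed

lemma null_squeeze:
  fixes f g :: "nat \<Rightarrow> real"
  assumes "\<And>n. 0 \<le> f n" "\<And>n. f n \<le> g n" "g \<longlonglongrightarrow> 0"
  shows "f \<longlonglongrightarrow> 0"
  by (rule tendsto_sandwich[OF _ _ tendsto_const assms(3)]) (simp_all add: assms)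

section \<open>Averaging over cells\<close>

lemma cell_tonelli:
  fixes u :: "'a::euclidean_space \<Rightarrow> ennreal"
  assumes [measurable]: "u \<in> borel_measurable borel"
  shows "(\<integral>\<^sup>+x. (\<integral>\<^sup>+y. indicator (dcell N x) y * u y \<partial>lborel) \<partial>lborel)
    = ennreal (cvol TYPE('a) N) * (\<integral>\<^sup>+y. u y \<partial>lborel)"
proof -
  have "(\<integral>\<^sup>+x. (\<integral>\<^sup>+y. indicator (dcell N x) y * u y \<partial>lborel) \<partial>lborel)
     = (\<integral>\<^sup>+y. (\<integral>\<^sup>+x. indicator (dcell N x) y * u y \<partial>lborel) \<partial>lborel)"
    by (rule lborel_pair.Fubini') measurable
  also have "\<dots> = (\<integral>\<^sup>+y. ennreal (cvol TYPE('a) N) * u y \<partial>lborel)"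
  proof (rule nn_integral_cong)
    \<comment> \<open>By symmetry of cell membership the integral over \<open>x\<close> is the
      volume of the cell of \<open>y\<close>, which is the same for every \<open>y\<close>.\<close>
    fix y
    have "(\<integral>\<^sup>+x. indicator (dcell N x) y * u y \<partial>lborel) = (\<integral>\<^sup>+x. u y * indicator (dcell N y) x \<partial>lborel)"
      by (rule nn_integral_cong) (auto simp: indicator_def dcell_sym)
    also have "\<dots> = u y * emeasure lborel (dcell N y)"
      by (rule nn_integral_cmult_indicator) simp
    finally show "(\<integral>\<^sup>+x. indicator (dcell N x) y * u y \<partial>lborel) = ennreal (cvol TYPE('a) N) * u y"
      by (simp add: emeasure_dcell mult.commute)
  qed
  also have "\<dots> = ennreal (cvol TYPE('a) N) * (\<integral>\<^sup>+y. u y \<partial>lborel)"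
    by (rule nn_integral_cmult) simp
  finally show ?thesis .
qed

lemma cell_avg_measurable [measurable]:
  assumes [measurable]: "h \<in> borel_measurable borel"
  shows "cell_avg N h \<in> borel_measurable borel"
proof -
  have "(\<lambda>x. LINT y|lborel. indicator (dcell N x) y *\<^sub>R h y) \<in> borel_measurable lborel"
    by (rule lborel.borel_measurable_lebesgue_integral) measurable
  then show ?thesis unfolding cell_avg_def by simp
qed

lemma integrable_on_dcell:
  fixes h :: "'a::euclidean_space \<Rightarrow> 'b::{banach,second_countable_topology}"
  assumes "integrable lborel h"
  shows "integrable lborel (\<lambda>y. indicator (dcell N x) y *\<^sub>R h y)"
  by (rule integrable_mult_indicator[OF _ assms]) simp

lemma cell_avg_nn:
  fixes h :: "'a::euclidean_space \<Rightarrow> 'b::{banach,second_countable_topology}"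
  assumes h: "integrable lborel h"
  shows "(\<integral>\<^sup>+x. norm (cell_avg N h x) \<partial>lborel) \<le> (\<integral>\<^sup>+x. norm (h x) \<partial>lborel)"
proof -
  note [measurable] = borel_measurable_integrable[OF h, simplified]
  let ?v = "cvol TYPE('a) N"
  have "(\<integral>\<^sup>+x. norm (cell_avg N h x) \<partial>lborel)
      \<le> (\<integral>\<^sup>+x. ennreal (1 / ?v) * (\<integral>\<^sup>+y. indicator (dcell N x) y * ennreal (norm (h y)) \<partial>lborel) \<partial>lborel)"
  proof (rule nn_integral_mono)
    fix x :: 'a
    have "ennreal (norm (cell_avg N h x)) = ennreal (1 / ?v) * ennreal (norm (LINT y|lborel. indicator (dcell N x) y *\<^sub>R h y))"
      using cvol_pos[where ?'a='a, of N] by (simp add: cell_avg_def flip: ennreal_mult)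
    also have "ennreal (norm (LINT y|lborel. indicator (dcell N x) y *\<^sub>R h y))
       \<le> (\<integral>\<^sup>+y. norm (indicator (dcell N x) y *\<^sub>R h y) \<partial>lborel)"
      by (rule integral_norm_bound_ennreal) (rule integrable_on_dcell[OF h])
    also have "\<dots> = (\<integral>\<^sup>+y. indicator (dcell N x) y * ennreal (norm (h y)) \<partial>lborel)"
      by (rule nn_integral_cong) (simp add: indicator_def)
    finally show "ennreal (norm (cell_avg N h x)) \<le> ennreal (1 / ?v) * (\<integral>\<^sup>+y. indicator (dcell N x) y * ennreal (norm (h y)) \<partial>lborel)"
      by (simp add: mult_left_mono)
  qed
  also have "\<dots> = ennreal (1 / ?v) * (\<integral>\<^sup>+x. (\<integral>\<^sup>+y. indicator (dcell N x) y * ennreal (norm (h y)) \<partial>lborel) \<partial>lborel)"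
    by (rule nn_integral_cmult) measurable
  also have "\<dots> = ennreal (1 / ?v) * (ennreal ?v * (\<integral>\<^sup>+y. norm (h y) \<partial>lborel))"
    by (subst cell_tonelli) simp_all
  also have "\<dots> = (\<integral>\<^sup>+y. norm (h y) \<partial>lborel)"
    using cvol_pos[where ?'a='a, of N] by (simp flip: mult.assoc ennreal_mult)
  finally show ?thesis .
qed

lemma integrable_cell_avg:
  assumes h: "integrable lborel h"
  shows "integrable lborel (cell_avg N h)"
proof (rule integrableI_bounded)
  note [measurable] = borel_measurable_integrable[OF h, simplified]
  show "cell_avg N h \<in> borel_measurable lborel" by simp
  show "(\<integral>\<^sup>+x. norm (cell_avg N h x) \<partial>lborel) < \<infinity>"
    using cell_avg_nn[OF h, of N] h by (auto simp: integrable_iff_bounded intro: le_less_trans)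
qed

lemma cell_avg_L1:
  assumes h: "integrable lborel h"
  shows "(LINT x|lborel. norm (cell_avg N h x)) \<le> (LINT x|lborel. norm (h x))"
proof -
  have "ennreal (LINT x|lborel. norm (cell_avg N h x)) \<le> ennreal (LINT x|lborel. norm (h x))"
    using cell_avg_nn[OF h, of N] h integrable_cell_avg[OF h, of N]
    by (simp add: nn_integral_eq_integral)
  then show ?thesis by (simp add: integral_nonneg_AE)
qed

lemma cell_avg_add:
  assumes "integrable lborel f" "integrable lborel g"
  shows "cell_avg N (\<lambda>x. f x + g x) x = cell_avg N f x + cell_avg N g x"
  using integrable_on_dcell[OF assms(1), of N x] integrable_on_dcell[OF assms(2), of N x]
  by (simp add: cell_avg_def scaleR_add_right)

lemma cell_avg_scale:
  fixes h :: "'a::euclidean_space \<Rightarrow> real" and c :: "'b::{banach,second_countable_topology}"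
  assumes "integrable lborel h"
  shows "cell_avg N (\<lambda>x. h x *\<^sub>R c) x = cell_avg N h x *\<^sub>R c"
proof -
  have "(LINT y|lborel. indicator (dcell N x) y *\<^sub>R h y *\<^sub>R c) = (LINT y|lborel. (indicator (dcell N x) y *\<^sub>R h y) *\<^sub>R c)"
    by simp
  also have "\<dots> = (LINT y|lborel. indicator (dcell N x) y *\<^sub>R h y) *\<^sub>R c"
    by (rule integral_scaleR_left) (rule integrable_on_dcell[OF assms])
  finally show ?thesis by (simp add: cell_avg_def)
qed

lemma cell_indicator_integrable:
  fixes h :: "'a::euclidean_space \<Rightarrow> 'b::{banach,second_countable_topology}"
  assumes h: "integrable lborel h"
  shows "integrable (lborel \<Otimes>\<^sub>M lborel) (\<lambda>(x, y). indicator (dcell N x) y *\<^sub>R h y)"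
proof (rule integrableI_bounded)
  note [measurable] = borel_measurable_integrable[OF h, simplified]
  show m: "(\<lambda>(x, y). indicator (dcell N x) y *\<^sub>R h y) \<in> borel_measurable (lborel \<Otimes>\<^sub>M lborel)"
    by measurable
  have "(\<integral>\<^sup>+z. norm (case z of (x, y) \<Rightarrow> indicator (dcell N x) y *\<^sub>R h y) \<partial>(lborel \<Otimes>\<^sub>M lborel))
    = (\<integral>\<^sup>+x. (\<integral>\<^sup>+y. norm (indicator (dcell N x) y *\<^sub>R h y) \<partial>lborel) \<partial>lborel)"
    by (subst lborel.nn_integral_fst[symmetric]) (use m in auto)
  also have "\<dots> = (\<integral>\<^sup>+x. (\<integral>\<^sup>+y. indicator (dcell N x) y * ennreal (norm (h y)) \<partial>lborel) \<partial>lborel)"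
    by (intro nn_integral_cong) (simp add: indicator_def)
  also have "\<dots> = ennreal (cvol TYPE('a) N) * (\<integral>\<^sup>+y. norm (h y) \<partial>lborel)"
    by (rule cell_tonelli) measurable
  also have "\<dots> < \<infinity>"
    using h by (simp add: integrable_iff_bounded ennreal_mult_less_top)
  finally show "(\<integral>\<^sup>+z. norm (case z of (x, y) \<Rightarrow> indicator (dcell N x) y *\<^sub>R h y) \<partial>(lborel \<Otimes>\<^sub>M lborel)) < \<infinity>" .
qed

lemma cell_avg_integral:
  fixes h :: "'a::euclidean_space \<Rightarrow> 'b::{banach,second_countable_topology}"
  assumes h: "integrable lborel h"
  shows "(LINT x|lborel. cell_avg N h x) = (LINT x|lborel. h x)"
proof -
  let ?v = "cvol TYPE('a) N"
  have "(LINT x|lborel. LINT y|lborel. indicator (dcell N x) y *\<^sub>R h y)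
    = (LINT y|lborel. LINT x|lborel. indicator (dcell N x) y *\<^sub>R h y)"
    by (rule lborel_pair.Fubini_integral[symmetric]) (rule cell_indicator_integrable[OF h])
  also have "\<dots> = (LINT y|lborel. ?v *\<^sub>R h y)"
  proof (rule Bochner_Integration.integral_cong[OF refl])
    fix y :: 'a
    have "(LINT x|lborel. indicator (dcell N x) y *\<^sub>R h y) = (LINT x|lborel. indicator (dcell N y) x *\<^sub>R h y)"
      by (rule Bochner_Integration.integral_cong) (auto simp: indicator_def dcell_sym)
    also have "\<dots> = ?v *\<^sub>R h y" by (simp add: emeasure_dcell measure_dcell)
    finally show "(LINT x|lborel. indicator (dcell N x) y *\<^sub>R h y) = ?v *\<^sub>R h y" .
  qed
  finally show ?thesis using cvol_pos[where ?'a='a, of N] by (simp add: cell_avg_def)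
qed

section \<open>Convergence of the averages in L^1 of a cube\<close>

definition cell_dev :: "nat \<Rightarrow> nat \<Rightarrow> ('a::euclidean_space \<Rightarrow> 'b::{banach,second_countable_topology}) \<Rightarrow> real" where
  "cell_dev R N h = (LINT x|lborel. indicator (dcube R) x * norm (cell_avg N h x - h x))"

lemma integrable_cell_dev:
  assumes h: "integrable lborel h"
  shows "integrable lborel (\<lambda>x. indicator (dcube R) x * norm (cell_avg N h x - h x))"
  using integrable_mult_indicator[of "dcube R" lborel "\<lambda>x. norm (cell_avg N h x - h x)"] 
  by (simp add: h integrable_cell_avg)

lemma cell_dev_nonneg: "0 \<le> cell_dev R N h"
  by (simp add: cell_dev_def)

lemma cell_dev_add:
  assumes f: "integrable lborel f" and g: "integrable lborel g"
  shows "cell_dev R N (\<lambda>x. f x + g x) \<le> cell_dev R N f + cell_dev R N g"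
  unfolding cell_dev_def
proof (subst Bochner_Integration.integral_add[symmetric, OF integrable_cell_dev[OF f] integrable_cell_dev[OF g]],
       rule integral_mono)
  show "integrable lborel (\<lambda>x. indicator (dcube R) x * norm (cell_avg N (\<lambda>x. f x + g x) x - (f x + g x)))"
    by (rule integrable_cell_dev) (simp add: f g)
  show "indicator (dcube R) x * norm (cell_avg N (\<lambda>x. f x + g x) x - (f x + g x))
      \<le> indicator (dcube R) x * norm (cell_avg N f x - f x) + indicator (dcube R) x * norm (cell_avg N g x - g x)" for x
    by (auto simp: indicator_def cell_avg_add[OF f g] intro: norm_diff_triangle_le norm_diff_triangle_ineq)
qed (simp_all add: integrable_cell_dev f g)

lemma cell_dev_scale:
  fixes h :: "'a::euclidean_space \<Rightarrow> real"
  assumes "integrable lborel h"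
  shows "cell_dev R N (\<lambda>x. h x *\<^sub>R c) = cell_dev R N h * norm c"
  by (simp add: cell_dev_def cell_avg_scale[OF assms] flip: scaleR_diff_left mult.assoc)

lemma cell_dev_le:
  assumes h: "integrable lborel h"
  shows "cell_dev R N h \<le> 2 * (LINT x|lborel. norm (h x))"
proof -
  have "cell_dev R N h \<le> (LINT x|lborel. norm (cell_avg N h x) + norm (h x))"
    unfolding cell_dev_def
    by (rule integral_mono[OF integrable_cell_dev[OF h]])
       (auto simp: indicator_def h integrable_cell_avg norm_triangle_ineq4)
  also have "\<dots> = (LINT x|lborel. norm (cell_avg N h x)) + (LINT x|lborel. norm (h x))"
    by (rule Bochner_Integration.integral_add) (simp_all add: h integrable_cell_avg)
  finally show ?thesis using cell_avg_L1[OF h, of N] by simp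
qed

text \<open>Averaging is an L^1 contraction, so the deviation is 2-Lipschitz in the function,
  uniformly in the level; the functions with vanishing deviation are therefore closed in
  L^1.\<close>

lemma cell_dev_limit:
  assumes s: "\<And>i::nat. integrable lborel (s i)" and f: "integrable lborel f"
    and dev: "\<And>i. (\<lambda>N. cell_dev R N (s i)) \<longlonglongrightarrow> 0"
    and lim: "(\<lambda>i. LINT x|lborel. norm (f x - s i x)) \<longlonglongrightarrow> 0"
  shows "(\<lambda>N. cell_dev R N f) \<longlonglongrightarrow> 0"
proof (rule LIMSEQ_I)
  fix e :: real assume "0 < e"
  then have "eventually (\<lambda>i. (LINT x|lborel. norm (f x - s i x)) < e / 4) sequentially"
    using order_tendstoD(2)[OF lim, of "e / 4"] by simp
  then obtain i where i: "(LINT x|lborel. norm (f x - s i x)) < e / 4"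
    using eventually_sequentially by auto
  have "eventually (\<lambda>N. cell_dev R N (s i) < e / 2) sequentially"
    using order_tendstoD(2)[OF dev[of i], of "e / 2"] \<open>0 < e\<close> by simp
  then obtain N0 where N0: "\<And>N. N \<ge> N0 \<Longrightarrow> cell_dev R N (s i) < e / 2"
    using eventually_sequentially by auto
  have "norm (cell_dev R N f - 0) < e" if "N \<ge> N0" for N
  proof -
    have "cell_dev R N f \<le> cell_dev R N (s i) + cell_dev R N (\<lambda>x. f x - s i x)"
      using cell_dev_add[OF s[of i], of "\<lambda>x. f x - s i x" R N] f s[of i] by simp
    also have "\<dots> \<le> cell_dev R N (s i) + 2 * (LINT x|lborel. norm (f x - s i x))"
      using cell_dev_le[of "\<lambda>x. f x - s i x" R N] f s[of i] by simp
    also have "\<dots> < e" using i N0[OF that] by simp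
    finally show ?thesis using cell_dev_nonneg[of R N f] by simp
  qed
  then show "\<exists>no. \<forall>n\<ge>no. norm (cell_dev R n f - 0) < e" by blast
qed

lemma integrable_indicator_dcube:
  "A \<in> sets borel \<Longrightarrow> integrable lborel (indicator (A \<inter> dcube R) :: 'a::euclidean_space \<Rightarrow> real)"
proof -
  assume "A \<in> sets borel"
  then have "emeasure lborel (A \<inter> dcube R) \<le> emeasure lborel (dcube R :: 'a set)"
    by (intro emeasure_mono) auto
  then show ?thesis
    using \<open>A \<in> sets borel\<close> emeasure_dcube_finite[where ?'a='a, of R]
    by (intro integrable_real_indicator) (auto intro: le_less_trans)
qed

text \<open>For open \<open>U\<close> the averages of the indicator are eventually \<open>1\<close> at each point of \<open>U\<close>;
  as averaging preserves the integral, the positive and negative parts of the deviation have the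
  same integral, so the behaviour outside \<open>U\<close> need not be examined.\<close>

lemma cell_dev_open:
  fixes U :: "'a::euclidean_space set"
  assumes U: "open U"
  shows "(\<lambda>N. cell_dev R N (indicator (U \<inter> dcube R) :: 'a \<Rightarrow> real)) \<longlonglongrightarrow> 0"
proof -
  let ?C = "dcube R :: 'a set"
  define u :: "'a \<Rightarrow> real" where "u = indicator (U \<inter> ?C)"
  have [measurable]: "U \<in> sets borel" using U by simp
  have u: "integrable lborel u"
    unfolding u_def by (rule integrable_indicator_dcube) simp
  have [measurable]: "u \<in> borel_measurable borel" by (simp add: u_def)
  have avg_nonneg: "0 \<le> cell_avg N u x" for N x
    unfolding cell_avg_def using cvol_pos[where ?'a='a, of N]
    by (auto intro!: mult_nonneg_nonneg integral_nonneg_AE simp: u_def)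
  have avg0: "cell_avg N u x = 0" if "x \<notin> ?C" for N x
  proof -
    have "indicator (dcell N x) y *\<^sub>R u y = 0" for y
      using that dcell_dcube_iff[of y N x R] by (auto simp: u_def indicator_def)
    then have "(\<lambda>y. indicator (dcell N x) y *\<^sub>R u y) = (\<lambda>_. 0)" by blast
    then show ?thesis by (simp only: cell_avg_def) simp
  qed
  have int_avg: "(LINT x|lborel. cell_avg N u x) = (LINT x|lborel. u x)" for N
    by (rule cell_avg_integral[OF u])
  have conv: "(\<lambda>N. max 0 (u x - cell_avg N u x)) \<longlonglongrightarrow> 0" for x
  proof (cases "x \<in> U \<inter> ?C")
    case False
    then have "max 0 (u x - cell_avg N u x) = 0" for N
      using avg_nonneg[of N x] by (simp add: u_def)
    then show ?thesis by simp
  next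
    case True
    then obtain r where r: "r > 0" "ball x r \<subseteq> U" using U by (auto simp: open_contains_ball)
    have "(\<lambda>N. real DIM('a) / 2 ^ N) \<longlonglongrightarrow> 0"
    by (rule cell_diameter_tendsto_0)
    then have "eventually (\<lambda>N. real DIM('a) / 2 ^ N < r) sequentially"
      using r(1) by (rule order_tendstoD(2))
    then have "eventually (\<lambda>N. max 0 (u x - cell_avg N u x) = 0) sequentially"
    proof eventually_elim
      case (elim N)
      have "y \<in> U \<inter> ?C" if "y \<in> dcell N x" for y
        using dcell_dist[OF that] elim r(2) dcell_subset_dcube[of x R N] True that
        by (auto simp: dist_norm norm_minus_commute)
      then have "(\<lambda>y. indicator (dcell N x) y *\<^sub>R u y) = indicator (dcell N x)"
        by (auto simp: u_def indicator_def fun_eq_iff)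
      then have "cell_avg N u x = 1"
        using cvol_pos[where ?'a='a, of N] by (simp add: cell_avg_def measure_dcell)
      then show ?case by (simp add: u_def)
    qed
    then show ?thesis by (rule tendsto_eventually)
  qed
  have lim: "(\<lambda>N. LINT x|lborel. max 0 (u x - cell_avg N u x)) \<longlonglongrightarrow> (LINT x|(lborel :: 'a measure). 0)"
  proof (rule integral_dominated_convergence[where w=u])
    show "AE x in lborel. norm (max 0 (u x - cell_avg N u x)) \<le> u x" for N
      using avg_nonneg[of N] by (auto simp: u_def)
  qed (auto simp: u conv)
  have pos_int: "integrable lborel (\<lambda>x. max 0 (u x - cell_avg N u x))" for N
    by (intro integrable_max) (simp_all add: u integrable_cell_avg)
  have "cell_dev R N u = 2 * (LINT x|lborel. max 0 (u x - cell_avg N u x))" for N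
  proof -
    have "cell_dev R N u = (LINT x|lborel. 2 * max 0 (u x - cell_avg N u x) + (cell_avg N u x - u x))"
      unfolding cell_dev_def
    proof (rule Bochner_Integration.integral_cong[OF refl])
      fix x :: 'a
      show "indicator (dcube R) x * norm (cell_avg N u x - u x) = 2 * max 0 (u x - cell_avg N u x) + (cell_avg N u x - u x)"
      proof (cases "x \<in> ?C")
        case False
        moreover have "u x = 0" using False by (simp add: u_def)
        ultimately show ?thesis by (simp add: avg0)
      qed (simp add: max_def abs_if)
    qed
    also have "\<dots> = (LINT x|lborel. 2 * max 0 (u x - cell_avg N u x)) + ((LINT x|lborel. cell_avg N u x) - (LINT x|lborel. u x))"
      using pos_int[of N] u integrable_cell_avg[OF u, of N] by simp
    finally show ?thesis by (simp add: int_avg)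
  qed
  then show ?thesis using tendsto_mult_left[OF lim, of 2] by (simp add: u_def)
qed

text \<open>Dynkin's argument: the open sets are an intersection-stable generator of the Borel sets.
  Subadditivity of the deviation gives complements and finite disjoint unions, and L^1 approximation
  by partial unions gives countable ones.\<close>

lemma cell_dev_indicator:
  fixes A :: "'a::euclidean_space set"
  assumes "A \<in> sets borel"
  shows "(\<lambda>N. cell_dev R N (indicator (A \<inter> dcube R) :: 'a \<Rightarrow> real)) \<longlonglongrightarrow> 0"
proof -
  have sets_eq: "sets (borel :: 'a measure) = sigma_sets UNIV {S. open S}"
    by (simp add: borel_def)
  have "Int_stable {S :: 'a set. open S}" by (auto simp: Int_stable_def)
  moreover have "{S :: 'a set. open S} \<subseteq> Pow UNIV" by simp
  moreover have "A \<in> sigma_sets UNIV {S. open S}" using assms sets_eq by simp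
  ultimately show ?thesis
  proof (induction rule: sigma_sets_induct_disjoint)
    case (basic A)
    then show ?case by (simp add: cell_dev_open)
  next
    case empty
    show ?case by (simp add: cell_dev_def cell_avg_def)
  next
    case (compl A)
    then have [measurable]: "A \<in> sets borel" using sets_eq by simp
    have eq: "(indicator ((UNIV - A) \<inter> dcube R) :: 'a \<Rightarrow> real)
      = (\<lambda>x. indicator (UNIV \<inter> dcube R) x + indicator (A \<inter> dcube R) x *\<^sub>R (-1))"
      by (auto simp: indicator_def fun_eq_iff)
    have 1: "integrable lborel (indicator (UNIV \<inter> dcube R) :: 'a \<Rightarrow> real)"
      and 2: "integrable lborel (indicator (A \<inter> dcube R) :: 'a \<Rightarrow> real)"
      by (rule integrable_indicator_dcube; simp)+
    have le: "cell_dev R N (indicator ((UNIV - A) \<inter> dcube R) :: 'a \<Rightarrow> real)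
       \<le> cell_dev R N (indicator (UNIV \<inter> dcube R) :: 'a \<Rightarrow> real) + cell_dev R N (indicator (A \<inter> dcube R) :: 'a \<Rightarrow> real)" for N
    proof -
      have "cell_dev R N (\<lambda>x. indicator (A \<inter> dcube R) x *\<^sub>R (-1 :: real)) = cell_dev R N (indicator (A \<inter> dcube R) :: 'a \<Rightarrow> real)"
        using cell_dev_scale[OF 2, of R N "-1::real"] by (simp only: norm_minus_cancel norm_one mult_1_right)
      moreover have "integrable lborel (\<lambda>x. indicator (A \<inter> dcube R) x *\<^sub>R (-1) :: real)"
        using 2 by (rule integrable_scaleR_left)
      ultimately show ?thesis
        unfolding eq using cell_dev_add[OF 1, of "\<lambda>x. indicator (A \<inter> dcube R) x *\<^sub>R (-1)" R N] by argo
    qed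
    have "(\<lambda>N. cell_dev R N (indicator (UNIV \<inter> dcube R) :: 'a \<Rightarrow> real)
       + cell_dev R N (indicator (A \<inter> dcube R) :: 'a \<Rightarrow> real)) \<longlonglongrightarrow> 0"
      using tendsto_add[OF cell_dev_open[of UNIV R] compl.IH] by simp
    then show ?case
      by (rule null_squeeze[OF cell_dev_nonneg le])
  next
    case (union A)
    then have [measurable]: "A i \<in> sets borel" for i using sets_eq by auto
    define B where "B i = (\<Union>j<i. A j)" for i
    have [measurable]: "B i \<in> sets borel" for i unfolding B_def by auto
    have B: "(\<lambda>N. cell_dev R N (indicator (B i \<inter> dcube R) :: 'a \<Rightarrow> real)) \<longlonglongrightarrow> 0" for i
    proof (induction i)
      case 0
      then show ?case by (simp add: B_def cell_dev_def cell_avg_def)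
    next
      case (Suc i)
      have "A i \<inter> A j = {}" if "j < i" for j
        using disjoint_family_onD[OF \<open>disjoint_family A\<close>, of i j] that by simp
      then have "A i \<inter> B i = {}" unfolding B_def by blast
      then have eq: "(indicator (B (Suc i) \<inter> dcube R) :: 'a \<Rightarrow> real)
        = (\<lambda>x. indicator (B i \<inter> dcube R) x + indicator (A i \<inter> dcube R) x)"
        by (auto simp: indicator_def fun_eq_iff B_def lessThan_Suc)
      have le: "cell_dev R N (indicator (B (Suc i) \<inter> dcube R) :: 'a \<Rightarrow> real)
         \<le> cell_dev R N (indicator (B i \<inter> dcube R) :: 'a \<Rightarrow> real) + cell_dev R N (indicator (A i \<inter> dcube R) :: 'a \<Rightarrow> real)" for N
        unfolding eq by (rule cell_dev_add) (rule integrable_indicator_dcube, simp)+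
      have "(\<lambda>N. cell_dev R N (indicator (B i \<inter> dcube R) :: 'a \<Rightarrow> real)
         + cell_dev R N (indicator (A i \<inter> dcube R) :: 'a \<Rightarrow> real)) \<longlonglongrightarrow> 0"
        using tendsto_add[OF Suc union.IH[of i]] by simp
      then show ?case
        by (rule null_squeeze[OF cell_dev_nonneg le])
    qed
    have lim: "(\<lambda>i. LINT x|lborel. norm (indicator ((\<Union>i. A i) \<inter> dcube R) x - indicator (B i \<inter> dcube R) x :: real))
        \<longlonglongrightarrow> (LINT x|(lborel::'a measure). 0)"
    proof (rule integral_dominated_convergence[where w="indicator (UNIV \<inter> dcube R)"])
      show "integrable lborel (indicator (UNIV \<inter> dcube R) :: 'a \<Rightarrow> real)"
        by (rule integrable_indicator_dcube) simp
      show "AE x in lborel. (\<lambda>i. norm (indicator ((\<Union>i. A i) \<inter> dcube R) x - indicator (B i \<inter> dcube R) x :: real)) \<longlonglongrightarrow> 0"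
      proof (rule AE_I2)
        fix x :: 'a
        show "(\<lambda>i. norm (indicator ((\<Union>i. A i) \<inter> dcube R) x - indicator (B i \<inter> dcube R) x :: real)) \<longlonglongrightarrow> 0"
        proof (cases "x \<in> (\<Union>i. A i)")
          case True
          then obtain j where "x \<in> A j" by blast
          then have "norm (indicator ((\<Union>i. A i) \<inter> dcube R) x - indicator (B i \<inter> dcube R) x :: real) = 0"
            if "i \<ge> Suc j" for i using that by (force simp: indicator_def B_def)
          then show ?thesis
            by (intro tendsto_eventually) (auto simp: eventually_sequentially)
        next
          case False
          then have "norm (indicator ((\<Union>i. A i) \<inter> dcube R) x - indicator (B i \<inter> dcube R) x :: real) = 0" for i
            by (auto simp: indicator_def B_def)
          then show ?thesis by simp
        qed
      qed
      show "AE x in lborel. norm (norm (indicator ((\<Union>i. A i) \<inter> dcube R) x - indicator (B i \<inter> dcube R) x :: real)) \<le> indicator (UNIV \<inter> dcube R) x" for i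
        by (rule AE_I2) (auto simp: indicator_def)
    qed auto
    show ?case
      by (rule cell_dev_limit[where s="\<lambda>i. indicator (B i \<inter> dcube R)", OF _ _ B])
         (use lim in \<open>auto intro!: integrable_indicator_dcube\<close>)
  qed
qed

theorem cell_avg_tendsto_L1:
  fixes h :: "'a::euclidean_space \<Rightarrow> 'b::{banach,second_countable_topology}"
  assumes "integrable lborel h"
  shows "(\<lambda>N. cell_dev R N h) \<longlonglongrightarrow> 0"
  using assms
proof (induction rule: integrable_induct)
  case (base A c)
  then have A [measurable]: "A \<in> sets borel" by simp
  have iA: "integrable lborel (indicator A :: 'a \<Rightarrow> real)"
    using base by simp
  \<comment> \<open>Cells of points of the cube stay in the cube, so the deviation sees only
    \<open>A \<inter> dcube R\<close>, whose indicator is already treated.\<close>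
  have "cell_dev R N (\<lambda>x. indicator A x *\<^sub>R c) = cell_dev R N (\<lambda>x. indicator (A \<inter> dcube R) x *\<^sub>R c)" for N
    unfolding cell_dev_def
  proof (rule Bochner_Integration.integral_cong[OF refl])
    fix x :: 'a
    show "indicator (dcube R) x * norm (cell_avg N (\<lambda>x. indicator A x *\<^sub>R c) x - indicator A x *\<^sub>R c) =
         indicator (dcube R) x * norm (cell_avg N (\<lambda>x. indicator (A \<inter> dcube R) x *\<^sub>R c) x - indicator (A \<inter> dcube R) x *\<^sub>R c)"
    proof (cases "x \<in> dcube R")
      case True
      have "(\<lambda>y. indicator (dcell N x) y *\<^sub>R indicator A y *\<^sub>R c) = (\<lambda>y. indicator (dcell N x) y *\<^sub>R indicator (A \<inter> dcube R) y *\<^sub>R c)"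
        using dcell_subset_dcube[OF True, of N] by (auto simp: indicator_def fun_eq_iff)
      then have "cell_avg N (\<lambda>x. indicator A x *\<^sub>R c) x = cell_avg N (\<lambda>x. indicator (A \<inter> dcube R) x *\<^sub>R c) x"
        by (simp add: cell_avg_def)
      then show ?thesis using True by (simp add: indicator_def)
    qed simp
  qed
  also have "cell_dev R N (\<lambda>x. indicator (A \<inter> dcube R) x *\<^sub>R c) = cell_dev R N (indicator (A \<inter> dcube R) :: 'a \<Rightarrow> real) * norm c" for N
    by (rule cell_dev_scale) (rule integrable_indicator_dcube[OF A])
  finally show ?case
    using tendsto_mult_left_zero[OF cell_dev_indicator[OF A, of R], of "norm c"] by simp
next
  case (add f g)
  have "(\<lambda>N. cell_dev R N f + cell_dev R N g) \<longlonglongrightarrow> 0"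
    using tendsto_add[OF add.IH] by simp
  then show ?case
    using add by (intro null_squeeze[OF cell_dev_nonneg cell_dev_add])
next
  case (lim f s)
  have sf: "(\<lambda>i. s i x) \<longlonglongrightarrow> f x" and sb: "norm (s i x) \<le> 2 * norm (f x)" for i x
    using lim by auto
  \<comment> \<open>The induction rule supplies \<open>norm (s i x) \<le> 2 * norm (f x)\<close>,
    whence the majorant \<open>3 * norm (f x)\<close>.\<close>
  have "(\<lambda>i. LINT x|lborel. norm (f x - s i x)) \<longlonglongrightarrow> (LINT x|(lborel::'a measure). 0)"
  proof (rule integral_dominated_convergence[where w="\<lambda>x. 3 * norm (f x)"])
    show "AE x in lborel. (\<lambda>i. norm (f x - s i x)) \<longlonglongrightarrow> 0"
    proof (rule AE_I2)
      fix x :: 'a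
      show "(\<lambda>i. norm (f x - s i x)) \<longlonglongrightarrow> 0"
        using tendsto_norm[OF tendsto_diff[OF tendsto_const sf[of x], of "f x"]] by simp
    qed
    show "AE x in lborel. norm (norm (f x - s i x)) \<le> 3 * norm (f x)" for i
    proof (rule AE_I2)
      fix x :: 'a
      show "norm (norm (f x - s i x)) \<le> 3 * norm (f x)"
        using sb[of i x] norm_triangle_ineq4[of "f x" "s i x"] by simp
    qed
  qed (use lim in auto)
  then have L: "(\<lambda>i. LINT x|lborel. norm (f x - s i x)) \<longlonglongrightarrow> 0" by simp
  show ?case
    by (rule cell_dev_limit[OF _ _ _ L]) (use lim in blast)+
qed

section \<open>Integrals over cycles\<close>

lemma ennreal_power2_le_imp_le:
  fixes a b :: ennreal
  assumes "a\<^sup>2 \<le> b\<^sup>2" shows "a \<le> b"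
proof (cases b)
  case (real r)
  show ?thesis
  proof (cases a)
    case (real s)
    with assms \<open>b = ennreal r\<close> \<open>0 \<le> r\<close> have "s\<^sup>2 \<le> r\<^sup>2" by (simp add: ennreal_power)
    then show ?thesis using real \<open>b = ennreal r\<close> \<open>0 \<le> r\<close> power2_le_imp_le[of s r] by simp
  next
    case top
    with assms real have "\<top> \<le> ennreal (r\<^sup>2)" by (simp add: ennreal_power)
    then show ?thesis by (simp add: top_unique)
  qed
qed simp

interpretation lborel_prod: product_sigma_finite "\<lambda>_. lborel" ..

text \<open>Induction on the index set.  A variable on a cycle of length at least two occurs in two
  factors; integrating it out merges them into one kernel, whose norm Cauchy--Schwarz controls.  A
  2-cycle turns into a fixed point this way.\<close>

lemma cycle_bound:
  fixes a :: "'i \<Rightarrow> 'a::euclidean_space \<Rightarrow> 'a \<Rightarrow> ennreal" and c :: "'i \<Rightarrow> ennreal"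
  assumes "finite I" "p permutes I"
    and "\<And>i. i \<in> I \<Longrightarrow> case_prod (a i) \<in> borel_measurable (borel \<Otimes>\<^sub>M borel)"
    and "\<And>i. i \<in> I \<Longrightarrow> p i = i \<Longrightarrow> (\<integral>\<^sup>+x. a i x x \<partial>lborel) \<le> c i"
    and "\<And>i. i \<in> I \<Longrightarrow> p i \<noteq> i \<Longrightarrow> (\<integral>\<^sup>+x. (\<integral>\<^sup>+y. (a i x y)\<^sup>2 \<partial>lborel) \<partial>lborel) \<le> (c i)\<^sup>2"
  shows "(\<integral>\<^sup>+x. (\<Prod>i\<in>I. a i (x i) (x (p i))) \<partial>PiM I (\<lambda>_. lborel)) \<le> (\<Prod>i\<in>I. c i)"
  using assms
proof (induction "card I" arbitrary: I p a c)
  case 0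
  then show ?case by (simp add: PiM_empty nn_integral_count_space_finite)
next
  case (Suc n)
  then obtain j where j: "j \<in> I" by fastforce
  define J where "J = I - {j}"
  have J: "finite J" "j \<notin> J" "I = insert j J" "card J = n"
    using Suc.prems(1) Suc.hyps(2) j by (auto simp: J_def)
  have pI: "p permutes I" by fact
  have pinI: "p k \<in> I \<longleftrightarrow> k \<in> I" for k by (rule permutes_in_image[OF pI])
  have [measurable]: "case_prod (a k) \<in> borel_measurable (borel \<Otimes>\<^sub>M borel)" if "k \<in> I" for k
    using Suc.prems(3)[OF that] .
  have ameas: "(\<lambda>x. a k (f x) (g x)) \<in> borel_measurable M"
    if "k \<in> I" "f \<in> M \<rightarrow>\<^sub>M borel" "g \<in> M \<rightarrow>\<^sub>M borel" for k f g and M :: "'z measure"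
    using measurable_compose[OF measurable_Pair[OF that(2,3)] Suc.prems(3)[OF that(1)]] by simp
  have comp: "(\<lambda>x. x k) \<in> PiM K (\<lambda>_. lborel :: 'a measure) \<rightarrow>\<^sub>M borel" if "k \<in> K" for k and K :: "'i set"
    using measurable_component_singleton[OF that, of "\<lambda>_. lborel :: 'a measure"] by simp
  have meas: "(\<lambda>x. \<Prod>i\<in>I. a i (x i) (x (p i))) \<in> borel_measurable (PiM I (\<lambda>_. lborel))"
    by (intro borel_measurable_prod_ennreal ameas comp) (simp_all add: pinI)
  have split: "(\<integral>\<^sup>+x. (\<Prod>i\<in>I. a i (x i) (x (p i))) \<partial>PiM I (\<lambda>_. lborel)) =
    (\<integral>\<^sup>+x. (\<integral>\<^sup>+y. (\<Prod>i\<in>I. a i ((x(j := y)) i) ((x(j := y)) (p i))) \<partial>lborel) \<partial>PiM J (\<lambda>_. lborel))"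
    using lborel_prod.product_nn_integral_insert[OF J(1,2)] meas unfolding J(3) by blast
  show ?case
  proof (cases "p j = j")
    case True
    have pJ: "p permutes J"
      by (rule permutes_superset[OF pI]) (use True J_def in auto)
    have pinJ: "p k \<in> J \<longleftrightarrow> k \<in> J" for k by (rule permutes_in_image[OF pJ])
    have measJ: "(\<lambda>x. \<Prod>i\<in>J. a i (x i) (x (p i))) \<in> borel_measurable (PiM J (\<lambda>_. lborel))"
      by (intro borel_measurable_prod_ennreal ameas comp) (simp_all add: pinJ, simp add: J_def)
    have "(\<Prod>i\<in>I. a i ((x(j := y)) i) ((x(j := y)) (p i))) = a j y y * (\<Prod>i\<in>J. a i (x i) (x (p i)))" for x y
    proof -
      have "(\<Prod>i\<in>J. a i ((x(j := y)) i) ((x(j := y)) (p i))) = (\<Prod>i\<in>J. a i (x i) (x (p i)))"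
        by (rule prod.cong[OF refl]) (use J(2) pinJ in \<open>metis fun_upd_other\<close>)
      then show ?thesis using J True by simp
    qed
    then have "(\<integral>\<^sup>+x. (\<Prod>i\<in>I. a i (x i) (x (p i))) \<partial>PiM I (\<lambda>_. lborel)) =
      (\<integral>\<^sup>+x. (\<integral>\<^sup>+y. a j y y * (\<Prod>i\<in>J. a i (x i) (x (p i))) \<partial>lborel) \<partial>PiM J (\<lambda>_. lborel))"
      unfolding split by simp
    also have "\<dots> = (\<integral>\<^sup>+x. (\<integral>\<^sup>+y. a j y y \<partial>lborel) * (\<Prod>i\<in>J. a i (x i) (x (p i))) \<partial>PiM J (\<lambda>_. lborel))"
      by (intro nn_integral_cong nn_integral_multc ameas) (use j in simp_all)
    also have "\<dots> = (\<integral>\<^sup>+y. a j y y \<partial>lborel) * (\<integral>\<^sup>+x. (\<Prod>i\<in>J. a i (x i) (x (p i))) \<partial>PiM J (\<lambda>_. lborel))"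
      by (rule nn_integral_cmult[OF measJ])
    also have "\<dots> \<le> c j * (\<Prod>i\<in>J. c i)"
    proof (rule mult_mono)
      show "(\<integral>\<^sup>+y. a j y y \<partial>lborel) \<le> c j" using Suc.prems(4)[OF j True] .
      show "(\<integral>\<^sup>+x. (\<Prod>i\<in>J. a i (x i) (x (p i))) \<partial>PiM J (\<lambda>_. lborel)) \<le> (\<Prod>i\<in>J. c i)"
        by (rule Suc.hyps(1)[OF J(4)[symmetric] J(1) pJ Suc.prems(3-5)]) (simp_all add: J_def)
    qed simp_all
    finally show ?thesis using J by simp
  next
    case False
    define l where "l = p j"
    obtain i where i: "p i = j" "i \<in> I" using pI j by (metis permutes_inverses(1) pinI)
    have iJ: "i \<in> J" and lJ: "l \<in> J"
      using i False j pinI by (auto simp: J_def l_def)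
    have lI: "l \<in> I" using lJ by (simp add: J_def)
    \<comment> \<open>The composition takes \<open>j\<close> out of its cycle: the arrows
      \<open>i -> j -> l\<close> become \<open>i -> l\<close>, and no other arrow on
      \<open>J\<close> changes. The new arrow carries the composite kernel \<open>b\<close>, with
      norm bound \<open>c i * c j\<close>.\<close>
    define q where "q = Transposition.transpose j l \<circ> p"
    have qi: "q i = l" using i(1) by (simp add: q_def)
    have qk: "q k = p k" if "k \<in> J" "k \<noteq> i" for k
    proof -
      have "p k \<noteq> j" "p k \<noteq> l"
        using that i(1) permutes_inj[OF pI] by (auto simp: l_def J_def dest: injD)
      then show ?thesis by (simp add: q_def transpose_def)
    qed
    have qI: "q permutes I" unfolding q_def
      by (rule permutes_compose[OF pI permutes_swap_id[OF j lI]])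
    have "q j = j" by (simp add: q_def l_def)
    then have qJ: "q permutes J"
      by (intro permutes_superset[OF qI]) (simp add: J_def)
    have qinJ: "q k \<in> J \<longleftrightarrow> k \<in> J" for k by (rule permutes_in_image[OF qJ])
    define b where "b x z = (\<integral>\<^sup>+y. a i x y * a j y z \<partial>lborel)" for x z
    define a' where "a' = a(i := b)"
    define c' where "c' = c(i := c i * c j)"
    have ai: "(\<lambda>x. a i (f x) (g x)) \<in> borel_measurable M" if "f \<in> M \<rightarrow>\<^sub>M borel" "g \<in> M \<rightarrow>\<^sub>M borel" for f g and M :: "'z measure"
      using ameas[OF i(2) that] .
    have aj: "(\<lambda>x. a j (f x) (g x)) \<in> borel_measurable M" if "f \<in> M \<rightarrow>\<^sub>M borel" "g \<in> M \<rightarrow>\<^sub>M borel" for f g and M :: "'z measure"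
      using ameas[OF j that] .
    have bmeas: "case_prod b \<in> borel_measurable (borel \<Otimes>\<^sub>M borel)"
    proof -
      have "(\<lambda>z. \<integral>\<^sup>+y. a i (fst z) y * a j y (snd z) \<partial>lborel) \<in> borel_measurable (borel \<Otimes>\<^sub>M borel)"
        by (rule lborel.borel_measurable_nn_integral)
           (unfold case_prod_beta', intro borel_measurable_times_ennreal ai aj; measurable)
      then show ?thesis by (simp add: b_def case_prod_beta')
    qed
    have L2i: "(\<integral>\<^sup>+x. (\<integral>\<^sup>+y. (a i x y)\<^sup>2 \<partial>lborel) \<partial>lborel) \<le> (c i)\<^sup>2"
      using Suc.prems(5)[OF i(2)] i(1) iJ J(2) by metis
    have L2j: "(\<integral>\<^sup>+x. (\<integral>\<^sup>+y. (a j x y)\<^sup>2 \<partial>lborel) \<partial>lborel) \<le> (c j)\<^sup>2"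
      using Suc.prems(5)[OF j False] .
    have "(\<integral>\<^sup>+z. (\<integral>\<^sup>+y. (a j y z)\<^sup>2 \<partial>lborel) \<partial>lborel) = (\<integral>\<^sup>+x. (\<integral>\<^sup>+y. (a j x y)\<^sup>2 \<partial>lborel) \<partial>lborel)"
      by (rule lborel_pair.Fubini') (unfold case_prod_beta', intro borel_measurable_power_ennreal aj; measurable)
    with L2j have L2j': "(\<integral>\<^sup>+z. (\<integral>\<^sup>+y. (a j y z)\<^sup>2 \<partial>lborel) \<partial>lborel) \<le> (c j)\<^sup>2" by simp
    have mi: "(\<lambda>x. \<integral>\<^sup>+y. (a i x y)\<^sup>2 \<partial>lborel) \<in> borel_measurable lborel"
      by (rule lborel.borel_measurable_nn_integral) (unfold case_prod_beta', intro borel_measurable_power_ennreal ai; measurable)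
    have mj: "(\<lambda>z. \<integral>\<^sup>+y. (a j y z)\<^sup>2 \<partial>lborel) \<in> borel_measurable lborel"
      by (rule lborel.borel_measurable_nn_integral) (unfold case_prod_beta', intro borel_measurable_power_ennreal aj; measurable)
    have bsq: "(b x z)\<^sup>2 \<le> (\<integral>\<^sup>+y. (a i x y)\<^sup>2 \<partial>lborel) * (\<integral>\<^sup>+y. (a j y z)\<^sup>2 \<partial>lborel)" for x z
      unfolding b_def by (rule Cauchy_Schwarz_nn_integral) (intro ai aj; measurable)+
    have b2: "(\<integral>\<^sup>+x. (\<integral>\<^sup>+z. (b x z)\<^sup>2 \<partial>lborel) \<partial>lborel) \<le> (c i * c j)\<^sup>2"
    proof -
      have "(\<integral>\<^sup>+x. (\<integral>\<^sup>+z. (b x z)\<^sup>2 \<partial>lborel) \<partial>lborel)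
        \<le> (\<integral>\<^sup>+x. (\<integral>\<^sup>+z. (\<integral>\<^sup>+y. (a i x y)\<^sup>2 \<partial>lborel) * (\<integral>\<^sup>+y. (a j y z)\<^sup>2 \<partial>lborel) \<partial>lborel) \<partial>lborel)"
        by (intro nn_integral_mono bsq)
      also have "\<dots> = (\<integral>\<^sup>+x. (\<integral>\<^sup>+y. (a i x y)\<^sup>2 \<partial>lborel) \<partial>lborel) * (\<integral>\<^sup>+z. (\<integral>\<^sup>+y. (a j y z)\<^sup>2 \<partial>lborel) \<partial>lborel)"
        by (simp add: nn_integral_cmult[OF mj] nn_integral_multc[OF mi])
      also have "\<dots> \<le> (c i)\<^sup>2 * (c j)\<^sup>2" by (rule mult_mono[OF L2i L2j']) simp_all
      finally show ?thesis by (simp add: power_mult_distrib)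
    qed
    \<comment> \<open>If \<open>l = i\<close>, then \<open>i\<close> is a fixed point of
      \<open>q\<close>, and the induction hypothesis asks for the integral of the diagonal of
      \<open>b\<close> in place of its square norm.\<close>
    have b1: "(\<integral>\<^sup>+x. b x x \<partial>lborel) \<le> c i * c j"
    proof (rule ennreal_power2_le_imp_le)
      have 1: "(\<lambda>z. a i (fst z) (snd z)) \<in> borel_measurable (lborel \<Otimes>\<^sub>M lborel)"
        by (intro ai; measurable)
      have 2: "(\<lambda>z. a j (snd z) (fst z)) \<in> borel_measurable (lborel \<Otimes>\<^sub>M lborel)"
        by (intro aj; measurable)
      have "(\<integral>\<^sup>+x. b x x \<partial>lborel) = (\<integral>\<^sup>+z. a i (fst z) (snd z) * a j (snd z) (fst z) \<partial>(lborel \<Otimes>\<^sub>M lborel))"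
        using lborel.nn_integral_fst[OF borel_measurable_times_ennreal[OF 1 2]] by (simp add: b_def)
      also have "\<dots>\<^sup>2 \<le> (\<integral>\<^sup>+z. (a i (fst z) (snd z))\<^sup>2 \<partial>(lborel \<Otimes>\<^sub>M lborel)) * (\<integral>\<^sup>+z. (a j (snd z) (fst z))\<^sup>2 \<partial>(lborel \<Otimes>\<^sub>M lborel))"
        by (rule Cauchy_Schwarz_nn_integral[OF 1 2])
      also have "\<dots> = (\<integral>\<^sup>+x. (\<integral>\<^sup>+y. (a i x y)\<^sup>2 \<partial>lborel) \<partial>lborel) * (\<integral>\<^sup>+z. (\<integral>\<^sup>+y. (a j y z)\<^sup>2 \<partial>lborel) \<partial>lborel)"
        using lborel.nn_integral_fst[OF borel_measurable_power_ennreal[OF 1], of 2] lborel.nn_integral_fst[OF borel_measurable_power_ennreal[OF 2], of 2]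
        by simp
      also have "\<dots> \<le> (c i)\<^sup>2 * (c j)\<^sup>2" by (rule mult_mono[OF L2i L2j']) simp_all
      finally show "(\<integral>\<^sup>+x. b x x \<partial>lborel)\<^sup>2 \<le> (c i * c j)\<^sup>2" by (simp add: power_mult_distrib)
    qed
    define R where "R x = (\<Prod>k\<in>J - {i}. a k (x k) (x (p k)))" for x
    have "(\<Prod>k\<in>I. a k ((x(j := y)) k) ((x(j := y)) (p k))) = a i (x i) y * a j y (x l) * R x" for x y
    proof -
      have "(\<Prod>k\<in>J - {i}. a k ((x(j := y)) k) ((x(j := y)) (p k))) = R x"
        unfolding R_def
      proof (rule prod.cong[OF refl])
        fix k assume k: "k \<in> J - {i}"
        then have "k \<noteq> j" using J(2) by auto
        moreover have "p k \<noteq> j" using k qk[of k] qinJ[of k] J(2) by auto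
        ultimately show "a k ((x(j := y)) k) ((x(j := y)) (p k)) = a k (x k) (x (p k))" by simp
      qed
      moreover have "l \<noteq> j" "i \<noteq> j" using lJ iJ J(2) by auto
      ultimately show ?thesis
        unfolding J(3) using J iJ
        by (simp add: prod.remove[OF J(1) iJ] i(1) l_def[symmetric] mult_ac)
    qed
    then have "(\<integral>\<^sup>+x. (\<Prod>i\<in>I. a i (x i) (x (p i))) \<partial>PiM I (\<lambda>_. lborel)) =
      (\<integral>\<^sup>+x. (\<integral>\<^sup>+y. a i (x i) y * a j y (x l) * R x \<partial>lborel) \<partial>PiM J (\<lambda>_. lborel))"
      unfolding split by simp
    also have "\<dots> = (\<integral>\<^sup>+x. b (x i) (x l) * R x \<partial>PiM J (\<lambda>_. lborel))"
      unfolding b_def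
      by (intro nn_integral_cong nn_integral_multc borel_measurable_times_ennreal ai aj; measurable)
    also have "\<dots> = (\<integral>\<^sup>+x. (\<Prod>k\<in>J. a' k (x k) (x (q k))) \<partial>PiM J (\<lambda>_. lborel))"
    proof (rule nn_integral_cong)
      fix x
      have "(\<Prod>k\<in>J - {i}. a' k (x k) (x (q k))) = R x"
        unfolding R_def by (rule prod.cong) (auto simp: a'_def qk)
      then show "b (x i) (x l) * R x = (\<Prod>k\<in>J. a' k (x k) (x (q k)))"
        by (simp add: prod.remove[OF J(1) iJ] qi a'_def)
    qed
    also have "\<dots> \<le> (\<Prod>k\<in>J. c' k)"
    proof (rule Suc.hyps(1)[OF J(4)[symmetric] J(1) qJ])
      fix k assume k: "k \<in> J"
      then have kI: "k \<in> I" by (simp add: J_def)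
      show "case_prod (a' k) \<in> borel_measurable (borel \<Otimes>\<^sub>M borel)"
        using bmeas Suc.prems(3)[OF kI] by (simp add: a'_def)
      show "(\<integral>\<^sup>+x. a' k x x \<partial>lborel) \<le> c' k" if "q k = k"
        using b1 Suc.prems(4)[OF kI] qk[OF k] that by (auto simp: a'_def c'_def)
      show "(\<integral>\<^sup>+x. (\<integral>\<^sup>+y. (a' k x y)\<^sup>2 \<partial>lborel) \<partial>lborel) \<le> (c' k)\<^sup>2" if "q k \<noteq> k"
        using b2 Suc.prems(5)[OF kI] qk[OF k] that by (auto simp: a'_def c'_def)
    qed
    also have "\<dots> = (\<Prod>k\<in>I. c k)"
    proof -
      have "(\<Prod>k\<in>J - {i}. c' k) = (\<Prod>k\<in>J - {i}. c k)"
        by (rule prod.cong) (auto simp: c'_def)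
      then show ?thesis
        unfolding J(3) using J(1,2)
        by (simp add: prod.remove[OF J(1) iJ] c'_def mult_ac)
    qed
    finally show ?thesis .
  qed
qed

section \<open>The Hilbert-Schmidt norm and integrals over cycles\<close>

definition hs_sq :: "('a::euclidean_space \<Rightarrow> 'a \<Rightarrow> complex) \<Rightarrow> ennreal" where
  "hs_sq u = (\<integral>\<^sup>+x. (\<integral>\<^sup>+y. ennreal ((cmod (u x y))\<^sup>2) \<partial>lborel) \<partial>lborel)"

text \<open>\<open>enn2real\<close> sends infinity to 0, so upper bounds by this number require
  finiteness of \<open>hs_sq\<close>.\<close>

definition hs_norm :: "('a::euclidean_space \<Rightarrow> 'a \<Rightarrow> complex) \<Rightarrow> real" where
  "hs_norm u = sqrt (enn2real (hs_sq u))"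

lemma hs_norm_nonneg [simp]: "0 \<le> hs_norm u"
  by (simp add: hs_norm_def)

lemma hs_sq_le_norm:
  assumes "hs_sq u < \<infinity>" shows "hs_sq u \<le> (ennreal (hs_norm u))\<^sup>2"
  using assms by (simp add: hs_norm_def ennreal_power)

lemma cycle_bound_complex:
  fixes w :: "'i \<Rightarrow> 'a::euclidean_space \<Rightarrow> 'a \<Rightarrow> complex"
  assumes I: "finite I" and p: "p permutes I"
    and meas: "\<And>i. i \<in> I \<Longrightarrow> case_prod (w i) \<in> borel_measurable (borel \<Otimes>\<^sub>M borel)"
    and fixed: "\<And>i. i \<in> I \<Longrightarrow> p i = i \<Longrightarrow> (\<integral>\<^sup>+x. cmod (w i x x) \<partial>lborel) \<le> c i"
    and free: "\<And>i. i \<in> I \<Longrightarrow> p i \<noteq> i \<Longrightarrow> hs_sq (w i) \<le> (c i)\<^sup>2"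
  shows "(\<integral>\<^sup>+x. ennreal (\<Prod>i\<in>I. cmod (w i (x i) (x (p i)))) \<partial>PiM I (\<lambda>_. lborel)) \<le> (\<Prod>i\<in>I. c i)"
proof -
  have "(\<integral>\<^sup>+x. ennreal (\<Prod>i\<in>I. cmod (w i (x i) (x (p i)))) \<partial>PiM I (\<lambda>_. lborel))
    = (\<integral>\<^sup>+x. (\<Prod>i\<in>I. ennreal (cmod (w i (x i) (x (p i))))) \<partial>PiM I (\<lambda>_. lborel))"
    by (simp add: prod_ennreal)
  also have "\<dots> \<le> (\<Prod>i\<in>I. c i)"
  proof (rule cycle_bound[OF I p])
    fix i assume i: "i \<in> I"
    show "(\<lambda>(x, y). ennreal (cmod (w i x y))) \<in> borel_measurable (borel \<Otimes>\<^sub>M borel)"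
      using meas[OF i] by (simp add: case_prod_beta')
    show "(\<integral>\<^sup>+x. ennreal (cmod (w i x x)) \<partial>lborel) \<le> c i" if "p i = i"
      using fixed[OF i that] .
    show "(\<integral>\<^sup>+x. (\<integral>\<^sup>+y. (ennreal (cmod (w i x y)))\<^sup>2 \<partial>lborel) \<partial>lborel) \<le> (c i)\<^sup>2" if "p i \<noteq> i"
      using free[OF i that] by (simp add: hs_sq_def ennreal_power)
  qed
  finally show ?thesis .
qed

lemma cycle_measurable:
  fixes w :: "'i \<Rightarrow> 'a::euclidean_space \<Rightarrow> 'a \<Rightarrow> complex"
  assumes p: "p permutes I"
    and meas: "\<And>i. i \<in> I \<Longrightarrow> case_prod (w i) \<in> borel_measurable (borel \<Otimes>\<^sub>M borel)"
  shows "(\<lambda>x. \<Prod>i\<in>I. w i (x i) (x (p i))) \<in> borel_measurable (PiM I (\<lambda>_. lborel))"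
proof (rule borel_measurable_prod)
  fix i assume i: "i \<in> I"
  have c: "(\<lambda>x. x k) \<in> PiM I (\<lambda>_. lborel :: 'a measure) \<rightarrow>\<^sub>M borel" if "k \<in> I" for k
    using measurable_component_singleton[OF that, of "\<lambda>_. lborel :: 'a measure"] by simp
  have "p i \<in> I" using i permutes_in_image[OF p] by blast
  then show "(\<lambda>x. w i (x i) (x (p i))) \<in> borel_measurable (PiM I (\<lambda>_. lborel))"
    using measurable_compose[OF measurable_Pair[OF c[OF i] c] meas[OF i]] by simp
qed

lemma cycle_integrable:
  fixes w :: "'i \<Rightarrow> 'a::euclidean_space \<Rightarrow> 'a \<Rightarrow> complex"
  assumes I: "finite I" and p: "p permutes I"
    and meas: "\<And>i. i \<in> I \<Longrightarrow> case_prod (w i) \<in> borel_measurable (borel \<Otimes>\<^sub>M borel)"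
    and fixed: "\<And>i. i \<in> I \<Longrightarrow> p i = i \<Longrightarrow> integrable lborel (\<lambda>x. w i x x)"
    and free: "\<And>i. i \<in> I \<Longrightarrow> p i \<noteq> i \<Longrightarrow> hs_sq (w i) < \<infinity>"
  shows "integrable (PiM I (\<lambda>_. lborel)) (\<lambda>x. \<Prod>i\<in>I. w i (x i) (x (p i)))"
proof (rule integrableI_bounded)
  show "(\<lambda>x. \<Prod>i\<in>I. w i (x i) (x (p i))) \<in> borel_measurable (PiM I (\<lambda>_. lborel))"
    by (rule cycle_measurable[OF p meas])
  define c where "c i = (if p i = i then (\<integral>\<^sup>+x. cmod (w i x x) \<partial>lborel) else ennreal (hs_norm (w i)))" for i
  have "(\<integral>\<^sup>+x. ennreal (\<Prod>i\<in>I. cmod (w i (x i) (x (p i)))) \<partial>PiM I (\<lambda>_. lborel)) \<le> (\<Prod>i\<in>I. c i)"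
    using hs_sq_le_norm[OF free] by (intro cycle_bound_complex[OF I p meas]) (auto simp: c_def)
  also have "\<dots> < \<infinity>"
  proof -
    have "c i < \<top>" if "i \<in> I" for i
      using fixed[OF that] by (auto simp: c_def integrable_iff_bounded)
    then show ?thesis using I by (simp add: ennreal_prod_eq_top less_top[symmetric])
  qed
  finally show "(\<integral>\<^sup>+x. norm (\<Prod>i\<in>I. w i (x i) (x (p i))) \<partial>PiM I (\<lambda>_. lborel)) < \<infinity>"
    by (simp add: prod_norm)
qed

text \<open>Expansion of the product of \<open>w i + (u i - w i)\<close>, where \<open>S\<close> is
  the set of indices at which \<open>w i\<close> is chosen. The term \<open>S = I\<close> cancels,
  and every other term contains a difference.\<close>

lemma cmod_prod_diff_le:
  fixes u w :: "'i \<Rightarrow> complex"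
  assumes I: "finite I"
  shows "cmod ((\<Prod>i\<in>I. u i) - (\<Prod>i\<in>I. w i))
    \<le> (\<Sum>S\<in>Pow I - {I}. \<Prod>i\<in>I. if i \<in> S then cmod (w i) else cmod (u i - w i))"
proof -
  have "(\<Prod>i\<in>I. u i) = (\<Prod>i\<in>I. w i + (u i - w i))" by simp
  also have "\<dots> = (\<Sum>S\<in>Pow I. (\<Prod>i\<in>S. w i) * (\<Prod>i\<in>I - S. u i - w i))"
    by (rule prod_add[OF I])
  also have "\<dots> = (\<Sum>S\<in>Pow I. \<Prod>i\<in>I. if i \<in> S then w i else u i - w i)"
  proof (rule sum.cong[OF refl])
    fix S assume "S \<in> Pow I"
    then have "I \<inter> {i. i \<in> S} = S" "I \<inter> - {i. i \<in> S} = I - S" by auto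
    then show "(\<Prod>i\<in>S. w i) * (\<Prod>i\<in>I - S. u i - w i) = (\<Prod>i\<in>I. if i \<in> S then w i else u i - w i)"
      using prod.If_cases[OF I, of "\<lambda>i. i \<in> S" w "\<lambda>i. u i - w i"] by simp
  qed
  also have "\<dots> = (\<Prod>i\<in>I. if i \<in> I then w i else u i - w i) + (\<Sum>S\<in>Pow I - {I}. \<Prod>i\<in>I. if i \<in> S then w i else u i - w i)"
    using I by (intro sum.remove) auto
  also have "(\<Prod>i\<in>I. if i \<in> I then w i else u i - w i) = (\<Prod>i\<in>I. w i)" by simp
  finally have "(\<Prod>i\<in>I. u i) - (\<Prod>i\<in>I. w i) = (\<Sum>S\<in>Pow I - {I}. \<Prod>i\<in>I. if i \<in> S then w i else u i - w i)"
    by simp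
  then have "cmod ((\<Prod>i\<in>I. u i) - (\<Prod>i\<in>I. w i)) \<le> (\<Sum>S\<in>Pow I - {I}. cmod (\<Prod>i\<in>I. if i \<in> S then w i else u i - w i))"
    by (simp add: norm_sum)
  also have "\<dots> = (\<Sum>S\<in>Pow I - {I}. \<Prod>i\<in>I. if i \<in> S then cmod (w i) else cmod (u i - w i))"
    by (intro sum.cong refl) (simp add: prod_norm[symmetric] if_distrib[of cmod])
  finally show ?thesis .
qed

text \<open>On cycles of length at least two the Hilbert-Schmidt norm alone controls the integral.
  Fixed points are excluded because a small Hilbert-Schmidt norm says nothing about the
  diagonal.\<close>

lemma cycle_diff_bound:
  fixes u w :: "'i \<Rightarrow> 'a::euclidean_space \<Rightarrow> 'a \<Rightarrow> complex"
  assumes I: "finite I" and p: "p permutes I" and np: "\<And>i. i \<in> I \<Longrightarrow> p i \<noteq> i"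
    and mu: "\<And>i. i \<in> I \<Longrightarrow> case_prod (u i) \<in> borel_measurable (borel \<Otimes>\<^sub>M borel)"
    and mw: "\<And>i. i \<in> I \<Longrightarrow> case_prod (w i) \<in> borel_measurable (borel \<Otimes>\<^sub>M borel)"
    and fu: "\<And>i. i \<in> I \<Longrightarrow> hs_sq (u i) < \<infinity>"
    and fw: "\<And>i. i \<in> I \<Longrightarrow> hs_sq (w i) < \<infinity>"
    and fd: "\<And>i. i \<in> I \<Longrightarrow> hs_sq (\<lambda>x y. u i x y - w i x y) < \<infinity>"
  shows "cmod ((LINT x|PiM I (\<lambda>_. lborel). (\<Prod>i\<in>I. u i (x i) (x (p i)))) - (LINT x|PiM I (\<lambda>_. lborel). (\<Prod>i\<in>I. w i (x i) (x (p i)))))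
   \<le> (\<Sum>S\<in>Pow I - {I}. \<Prod>i\<in>I. if i \<in> S then hs_norm (w i) else hs_norm (\<lambda>x y. u i x y - w i x y))"
proof -
  let ?M = "PiM I (\<lambda>_. lborel :: 'a measure)"
  have iu: "integrable ?M (\<lambda>x. \<Prod>i\<in>I. u i (x i) (x (p i)))"
    by (rule cycle_integrable[OF I p mu _ fu]) (use np in auto)
  have iw: "integrable ?M (\<lambda>x. \<Prod>i\<in>I. w i (x i) (x (p i)))"
    by (rule cycle_integrable[OF I p mw _ fw]) (use np in auto)
  define g where "g S i = (if i \<in> S then w i else (\<lambda>x y. u i x y - w i x y))" for S i
  have mg: "case_prod (g S i) \<in> borel_measurable (borel \<Otimes>\<^sub>M borel)" if "i \<in> I" for S i
    using mu[OF that] mw[OF that] by (auto simp: g_def case_prod_beta' intro!: borel_measurable_diff)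
  have mgp: "(\<lambda>x. ennreal (\<Prod>i\<in>I. cmod (g S i (x i) (x (p i))))) \<in> borel_measurable ?M" for S
    using cycle_measurable[OF p, of "g S"] mg by (simp add: prod_norm)
  have "ennreal (cmod ((LINT x|?M. (\<Prod>i\<in>I. u i (x i) (x (p i)))) - (LINT x|?M. (\<Prod>i\<in>I. w i (x i) (x (p i))))))
    = ennreal (cmod (LINT x|?M. (\<Prod>i\<in>I. u i (x i) (x (p i))) - (\<Prod>i\<in>I. w i (x i) (x (p i)))))"
    using iu iw by simp
  also have "\<dots> \<le> (\<integral>\<^sup>+x. cmod ((\<Prod>i\<in>I. u i (x i) (x (p i))) - (\<Prod>i\<in>I. w i (x i) (x (p i)))) \<partial>?M)"
    using iu iw by (intro integral_norm_bound_ennreal) simp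
  also have "\<dots> \<le> (\<integral>\<^sup>+x. (\<Sum>S\<in>Pow I - {I}. ennreal (\<Prod>i\<in>I. cmod (g S i (x i) (x (p i))))) \<partial>?M)"
  proof (rule nn_integral_mono)
    fix x
    have "ennreal (cmod ((\<Prod>i\<in>I. u i (x i) (x (p i))) - (\<Prod>i\<in>I. w i (x i) (x (p i)))))
      \<le> ennreal (\<Sum>S\<in>Pow I - {I}. \<Prod>i\<in>I. cmod (g S i (x i) (x (p i))))"
      using cmod_prod_diff_le[OF I, of "\<lambda>i. u i (x i) (x (p i))" "\<lambda>i. w i (x i) (x (p i))"]
      by (intro ennreal_leI) (simp add: g_def if_distrib[of cmod] if_distribR cong: if_cong)
    also have "\<dots> = (\<Sum>S\<in>Pow I - {I}. ennreal (\<Prod>i\<in>I. cmod (g S i (x i) (x (p i)))))"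
      by (simp add: sum_ennreal prod_nonneg)
    finally show "ennreal (cmod ((\<Prod>i\<in>I. u i (x i) (x (p i))) - (\<Prod>i\<in>I. w i (x i) (x (p i)))))
      \<le> (\<Sum>S\<in>Pow I - {I}. ennreal (\<Prod>i\<in>I. cmod (g S i (x i) (x (p i)))))" .
  qed
  also have "\<dots> = (\<Sum>S\<in>Pow I - {I}. (\<integral>\<^sup>+x. ennreal (\<Prod>i\<in>I. cmod (g S i (x i) (x (p i)))) \<partial>?M))"
    by (rule nn_integral_sum) (rule mgp)
  also have "\<dots> \<le> (\<Sum>S\<in>Pow I - {I}. \<Prod>i\<in>I. ennreal (hs_norm (g S i)))"
  proof (rule sum_mono)
    fix S
    show "(\<integral>\<^sup>+x. ennreal (\<Prod>i\<in>I. cmod (g S i (x i) (x (p i)))) \<partial>?M) \<le> (\<Prod>i\<in>I. ennreal (hs_norm (g S i)))"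
    proof (rule cycle_bound_complex[OF I p mg])
      fix i assume i: "i \<in> I"
      show "hs_sq (g S i) \<le> (ennreal (hs_norm (g S i)))\<^sup>2"
        by (rule hs_sq_le_norm) (use fw[OF i] fd[OF i] in \<open>simp add: g_def\<close>)
      show "(\<integral>\<^sup>+x. cmod (g S i x x) \<partial>lborel) \<le> ennreal (hs_norm (g S i))" if "p i = i"
        using np[OF i] that by simp
    qed
  qed
  also have "\<dots> = ennreal (\<Sum>S\<in>Pow I - {I}. \<Prod>i\<in>I. hs_norm (g S i))"
    by (simp add: prod_ennreal sum_ennreal prod_nonneg)
  finally show ?thesis
    by (simp add: ennreal_le_iff sum_nonneg prod_nonneg g_def if_distrib[of hs_norm] cong: if_cong)
qed

lemma hs_norm_tendsto_0:
  assumes "(\<lambda>n. hs_sq (u n)) \<longlonglongrightarrow> 0"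
  shows "(\<lambda>n. hs_norm (u n)) \<longlonglongrightarrow> 0"
  unfolding hs_norm_def
  using tendsto_real_sqrt[OF tendsto_enn2real[of _ 0, OF assms[folded ennreal_0]]] by simp

lemma hs_sq_add_le:
  fixes u w :: "'a::euclidean_space \<Rightarrow> 'a \<Rightarrow> complex"
  assumes mu: "case_prod u \<in> borel_measurable (borel \<Otimes>\<^sub>M borel)"
    and mw: "case_prod w \<in> borel_measurable (borel \<Otimes>\<^sub>M borel)"
  shows "hs_sq (\<lambda>x y. u x y + w x y) \<le> 2 * hs_sq u + 2 * hs_sq w"
proof -
  have m: "(\<lambda>z. ennreal ((cmod (v (fst z) (snd z)))\<^sup>2)) \<in> borel_measurable (lborel \<Otimes>\<^sub>M lborel)"
    if "case_prod v \<in> borel_measurable (borel \<Otimes>\<^sub>M borel)" for v :: "'a \<Rightarrow> 'a \<Rightarrow> complex"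
    using that by (simp add: case_prod_beta')
  have "(\<lambda>z. u (fst z) (snd z) + w (fst z) (snd z)) \<in> borel_measurable (borel \<Otimes>\<^sub>M borel)"
    using mu mw by (simp add: case_prod_beta' borel_measurable_add)
  then have muw: "case_prod (\<lambda>x y. u x y + w x y) \<in> borel_measurable (borel \<Otimes>\<^sub>M borel)"
    by (simp add: case_prod_beta')
  have eq: "hs_sq v = (\<integral>\<^sup>+z. ennreal ((cmod (v (fst z) (snd z)))\<^sup>2) \<partial>(lborel \<Otimes>\<^sub>M lborel))"
    if "case_prod v \<in> borel_measurable (borel \<Otimes>\<^sub>M borel)" for v :: "'a \<Rightarrow> 'a \<Rightarrow> complex"
    unfolding hs_sq_def using lborel.nn_integral_fst[OF m[OF that]] by simp
  have "hs_sq (\<lambda>x y. u x y + w x y) \<le> (\<integral>\<^sup>+z. 2 * ennreal ((cmod (u (fst z) (snd z)))\<^sup>2) + 2 * ennreal ((cmod (w (fst z) (snd z)))\<^sup>2) \<partial>(lborel \<Otimes>\<^sub>M lborel))"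
    unfolding eq[OF muw]
  proof (rule nn_integral_mono)
    fix z :: "'a \<times> 'a"
    let ?a = "u (fst z) (snd z)" and ?b = "w (fst z) (snd z)"
    have "(cmod (?a + ?b))\<^sup>2 \<le> (cmod ?a + cmod ?b)\<^sup>2" by (simp add: norm_triangle_ineq power_mono)
    also have "\<dots> \<le> 2 * (cmod ?a)\<^sup>2 + 2 * (cmod ?b)\<^sup>2" 
      using sum_squares_bound[of "cmod ?a" "cmod ?b"] by (simp add: power2_sum)
    finally have "ennreal ((cmod (?a + ?b))\<^sup>2) \<le> ennreal (2 * (cmod ?a)\<^sup>2 + 2 * (cmod ?b)\<^sup>2)" by (rule ennreal_leI)
    then show "ennreal ((cmod (?a + ?b))\<^sup>2) \<le> 2 * ennreal ((cmod ?a)\<^sup>2) + 2 * ennreal ((cmod ?b)\<^sup>2)"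
      by (simp add: ennreal_plus ennreal_mult)
  qed
  also have "\<dots> = 2 * hs_sq u + 2 * hs_sq w"
    unfolding eq[OF mu] eq[OF mw]
    using m[OF mu] m[OF mw] by (subst nn_integral_add) (auto simp: nn_integral_cmult)
  finally show ?thesis .
qed

text \<open>Fixed points contribute separate factors. Only the integrals of their diagonals are
  assumed to converge, not the diagonals in L^1, so they cannot enter the difference estimate and
  are split off by Fubini.\<close>

lemma cycle_tendsto:
  fixes u :: "nat \<Rightarrow> 'i \<Rightarrow> 'a::euclidean_space \<Rightarrow> 'a \<Rightarrow> complex"
  assumes I: "finite I" and p: "p permutes I"
    and mu: "\<And>n i. i \<in> I \<Longrightarrow> case_prod (u n i) \<in> borel_measurable (borel \<Otimes>\<^sub>M borel)"
    and mw: "\<And>i. i \<in> I \<Longrightarrow> case_prod (w i) \<in> borel_measurable (borel \<Otimes>\<^sub>M borel)"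
    and diag: "\<And>n i. i \<in> I \<Longrightarrow> integrable lborel (\<lambda>x. u n i x x)" "\<And>i. i \<in> I \<Longrightarrow> integrable lborel (\<lambda>x. w i x x)"
    and hs: "\<And>n i. i \<in> I \<Longrightarrow> hs_sq (u n i) < \<infinity>" "\<And>i. i \<in> I \<Longrightarrow> hs_sq (w i) < \<infinity>"
    and lim_diag: "\<And>i. i \<in> I \<Longrightarrow> (\<lambda>n. LINT x|lborel. u n i x x) \<longlonglongrightarrow> (LINT x|lborel. w i x x)"
    and lim_hs: "\<And>i. i \<in> I \<Longrightarrow> (\<lambda>n. hs_sq (\<lambda>x y. u n i x y - w i x y)) \<longlonglongrightarrow> 0"
  shows "(\<lambda>n. LINT x|PiM I (\<lambda>_. lborel). (\<Prod>i\<in>I. u n i (x i) (x (p i))))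
    \<longlonglongrightarrow> (LINT x|PiM I (\<lambda>_. lborel). (\<Prod>i\<in>I. w i (x i) (x (p i))))"
proof -
  define A where "A = {i\<in>I. p i = i}"
  define B where "B = {i\<in>I. p i \<noteq> i}"
  have AB: "A \<inter> B = {}" "finite A" "finite B" "A \<union> B = I" "A \<subseteq> I" "B \<subseteq> I"
    using I by (auto simp: A_def B_def)
  have pB: "p permutes B"
    by (rule permutes_superset[OF p]) (simp add: B_def)
  have pinB: "p k \<in> B \<longleftrightarrow> k \<in> B" for k by (rule permutes_in_image[OF pB])
  have fact: "(LINT x|PiM I (\<lambda>_. lborel). (\<Prod>i\<in>I. v i (x i) (x (p i))))
     = (\<Prod>i\<in>A. LINT x|lborel. v i x x) * (LINT y|PiM B (\<lambda>_. lborel). (\<Prod>i\<in>B. v i (y i) (y (p i))))"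
    if mv: "\<And>i. i \<in> I \<Longrightarrow> case_prod (v i) \<in> borel_measurable (borel \<Otimes>\<^sub>M borel)"
     and dv: "\<And>i. i \<in> I \<Longrightarrow> integrable lborel (\<lambda>x. v i x x)"
     and hv: "\<And>i. i \<in> I \<Longrightarrow> hs_sq (v i) < \<infinity>" for v :: "'i \<Rightarrow> 'a \<Rightarrow> 'a \<Rightarrow> complex"
  proof -
    have "integrable (PiM I (\<lambda>_. lborel)) (\<lambda>x. \<Prod>i\<in>I. v i (x i) (x (p i)))"
      by (rule cycle_integrable[OF I p mv dv hv])
    then have "(LINT x|PiM I (\<lambda>_. lborel). (\<Prod>i\<in>I. v i (x i) (x (p i))))
      = (LINT x|PiM A (\<lambda>_. lborel). LINT y|PiM B (\<lambda>_. lborel). (\<Prod>i\<in>I. v i (merge A B (x, y) i) (merge A B (x, y) (p i))))"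
      using lborel_prod.product_integral_fold[OF AB(1-3), unfolded AB(4)] by blast
    also have "\<dots> = (LINT x|PiM A (\<lambda>_. lborel). LINT y|PiM B (\<lambda>_. lborel). (\<Prod>i\<in>A. v i (x i) (x i)) * (\<Prod>i\<in>B. v i (y i) (y (p i))))"
    proof (intro Bochner_Integration.integral_cong refl)
      fix x y :: "'i \<Rightarrow> 'a"
      have "(\<Prod>i\<in>I. v i (merge A B (x, y) i) (merge A B (x, y) (p i))) =
        (\<Prod>i\<in>A. v i (merge A B (x, y) i) (merge A B (x, y) (p i))) * (\<Prod>i\<in>B. v i (merge A B (x, y) i) (merge A B (x, y) (p i)))"
        unfolding AB(4)[symmetric] by (rule prod.union_disjoint[OF AB(2,3,1)])
      also have "(\<Prod>i\<in>A. v i (merge A B (x, y) i) (merge A B (x, y) (p i))) = (\<Prod>i\<in>A. v i (x i) (x i))"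
        by (rule prod.cong) (auto simp: merge_def A_def)
      also have "(\<Prod>i\<in>B. v i (merge A B (x, y) i) (merge A B (x, y) (p i))) = (\<Prod>i\<in>B. v i (y i) (y (p i)))"
      proof (rule prod.cong[OF refl])
        fix i assume "i \<in> B"
        then have "i \<in> B" "i \<notin> A" "p i \<in> B" "p i \<notin> A" using pinB AB(1) by blast+
        then show "v i (merge A B (x, y) i) (merge A B (x, y) (p i)) = v i (y i) (y (p i))"
          by (simp add: merge_def)
      qed
      finally show "(\<Prod>i\<in>I. v i (merge A B (x, y) i) (merge A B (x, y) (p i))) = (\<Prod>i\<in>A. v i (x i) (x i)) * (\<Prod>i\<in>B. v i (y i) (y (p i)))" .
    qed
    also have "\<dots> = (LINT x|PiM A (\<lambda>_. lborel). (\<Prod>i\<in>A. v i (x i) (x i))) * (LINT y|PiM B (\<lambda>_. lborel). (\<Prod>i\<in>B. v i (y i) (y (p i))))"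
      by simp
    also have "(LINT x|PiM A (\<lambda>_. lborel). (\<Prod>i\<in>A. v i (x i) (x i))) = (\<Prod>i\<in>A. LINT x|lborel. v i x x)"
      using AB dv by (intro lborel_prod.product_integral_prod[OF AB(2), of "\<lambda>i x. v i x x"]) blast
    finally show ?thesis .
  qed
  have hd: "hs_sq (\<lambda>x y. u n i x y - w i x y) < \<infinity>" if "i \<in> I" for n i
  proof -
    have "case_prod (\<lambda>x y. - w i x y) \<in> borel_measurable (borel \<Otimes>\<^sub>M borel)"
      using mw[OF that] by (simp add: case_prod_beta')
    then have "hs_sq (\<lambda>x y. u n i x y - w i x y) \<le> 2 * hs_sq (u n i) + 2 * hs_sq (w i)"
      using hs_sq_add_le[OF mu[OF that], of "\<lambda>x y. - w i x y"] by (simp add: hs_sq_def)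
    also have "\<dots> < \<infinity>" using hs[OF that] by (simp add: ennreal_mult_less_top)
    finally show ?thesis .
  qed
  have "(\<lambda>n. LINT y|PiM B (\<lambda>_. lborel). (\<Prod>i\<in>B. u n i (y i) (y (p i))))
     \<longlonglongrightarrow> (LINT y|PiM B (\<lambda>_. lborel). (\<Prod>i\<in>B. w i (y i) (y (p i))))"
  proof (rule Lim_transform2[OF tendsto_const], rule tendsto_norm_zero_cancel)
    have *: "(\<lambda>n. \<Sum>S\<in>Pow B - {B}. \<Prod>i\<in>B. if i \<in> S then hs_norm (w i) else hs_norm (\<lambda>x y. u n i x y - w i x y))
      \<longlonglongrightarrow> (\<Sum>S\<in>Pow B - {B}. \<Prod>i\<in>B. if i \<in> S then hs_norm (w i) else 0)"
    proof (intro tendsto_sum tendsto_prod)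
      fix S i assume "i \<in> B"
      then have "(\<lambda>n. hs_norm (\<lambda>x y. u n i x y - w i x y)) \<longlonglongrightarrow> 0"
        using AB by (intro hs_norm_tendsto_0 lim_hs) auto
      then show "(\<lambda>n. if i \<in> S then hs_norm (w i) else hs_norm (\<lambda>x y. u n i x y - w i x y))
        \<longlonglongrightarrow> (if i \<in> S then hs_norm (w i) else 0)" by simp
    qed
    have "(\<Prod>i\<in>B. if i \<in> S then hs_norm (w i) else 0) = 0" if "S \<in> Pow B - {B}" for S
      using that AB(3) by (auto intro!: prod_zero)
    then have "(\<Sum>S\<in>Pow B - {B}. \<Prod>i\<in>B. if i \<in> S then hs_norm (w i) else 0) = 0"
      by (rule sum.neutral[rule_format])
    note 0 = *[unfolded this]
    have le: "cmod ((LINT y|PiM B (\<lambda>_. lborel). (\<Prod>i\<in>B. w i (y i) (y (p i)))) - (LINT y|PiM B (\<lambda>_. lborel). (\<Prod>i\<in>B. u n i (y i) (y (p i)))))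
      \<le> (\<Sum>S\<in>Pow B - {B}. \<Prod>i\<in>B. if i \<in> S then hs_norm (w i) else hs_norm (\<lambda>x y. u n i x y - w i x y))" for n
      unfolding norm_minus_commute[of "LINT y|PiM B (\<lambda>_. lborel). (\<Prod>i\<in>B. w i (y i) (y (p i)))"]
    proof (rule cycle_diff_bound[OF AB(3) pB])
      fix i assume i: "i \<in> B"
      then have "i \<in> I" using AB by blast
      then show "case_prod (u n i) \<in> borel_measurable (borel \<Otimes>\<^sub>M borel)" "case_prod (w i) \<in> borel_measurable (borel \<Otimes>\<^sub>M borel)"
        "hs_sq (u n i) < \<infinity>" "hs_sq (w i) < \<infinity>" "hs_sq (\<lambda>x y. u n i x y - w i x y) < \<infinity>"
        by (rule mu mw hs hd)+
      show "p i \<noteq> i" using i by (simp add: B_def)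
    qed
    show "(\<lambda>n. norm ((LINT y|PiM B (\<lambda>_. lborel). (\<Prod>i\<in>B. w i (y i) (y (p i)))) - (LINT y|PiM B (\<lambda>_. lborel). (\<Prod>i\<in>B. u n i (y i) (y (p i)))))) \<longlonglongrightarrow> 0"
      by (rule null_squeeze[OF norm_ge_zero le 0])
  qed
  moreover have "(\<lambda>n. \<Prod>i\<in>A. LINT x|lborel. u n i x x) \<longlonglongrightarrow> (\<Prod>i\<in>A. LINT x|lborel. w i x x)"
    using AB by (intro tendsto_prod lim_diag) blast
  ultimately have "(\<lambda>n. (\<Prod>i\<in>A. LINT x|lborel. u n i x x) * (LINT y|PiM B (\<lambda>_. lborel). (\<Prod>i\<in>B. u n i (y i) (y (p i)))))
    \<longlonglongrightarrow> (\<Prod>i\<in>A. LINT x|lborel. w i x x) * (LINT y|PiM B (\<lambda>_. lborel). (\<Prod>i\<in>B. w i (y i) (y (p i))))"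
    by (intro tendsto_mult)
  then show ?thesis
    by (subst (1 2) fact) (use mu mw diag hs in blast)+
qed

section \<open>Determinants of kernels\<close>

text \<open>Stated for numbers, so that it serves both the entries of a matrix and the form of an
  operator.\<close>

lemma sesqui_cauchy_schwarz:
  fixes a b :: real and z :: complex
  assumes pos: "\<And>s t :: complex. 0 \<le> (cmod s)\<^sup>2 * a + (cmod t)\<^sup>2 * b + 2 * Re (s * cnj t * z)"
  shows "(cmod z)\<^sup>2 \<le> a * b"
proof -
  have a: "0 \<le> a" using pos[of 1 0] by simp
  have b: "0 \<le> b" using pos[of 0 1] by simp
  \<comment> \<open>With \<open>s\<close> a negative multiple of \<open>cnj z\<close> and
    \<open>t\<close> positive, the cross term is real and lowers the form; \<open>x = 1\<close>,
    \<open>y = a\<close> then gives the claim for \<open>a > 0\<close>.\<close>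
  have key: "0 \<le> x\<^sup>2 * (cmod z)\<^sup>2 * a + y\<^sup>2 * b - 2 * x * y * (cmod z)\<^sup>2" for x y :: real
  proof -
    have "of_real (- x) * cnj z * cnj (of_real y) * z = complex_of_real (- (x * y * (cmod z)\<^sup>2))"
      by (simp add: complex_norm_square mult_ac del: of_real_power)
    moreover have "(cmod (of_real (- x) * cnj z))\<^sup>2 = x\<^sup>2 * (cmod z)\<^sup>2" "(cmod (of_real y))\<^sup>2 = y\<^sup>2"
      by (simp_all add: norm_mult power_mult_distrib)
    ultimately show ?thesis
      using pos[of "of_real (- x) * cnj z" "of_real y"] by (simp only: Re_complex_of_real)
  qed
  show ?thesis
  proof (cases "a = 0")
    case True
    show ?thesis
    proof (rule ccontr)
      assume "\<not> ?thesis"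
      then have z: "0 < (cmod z)\<^sup>2" using True by simp
      \<comment> \<open>For \<open>a = 0\<close> the form is affine in \<open>x\<close> with
        negative slope, and this \<open>x\<close> is large enough to make it negative.\<close>
      have "0 \<le> b - 2 * ((b + 1) / (cmod z)\<^sup>2) * (cmod z)\<^sup>2"
        using key[of "(b + 1) / (cmod z)\<^sup>2" 1] True by simp
      also have "\<dots> = b - 2 * (b + 1)" using z by simp
      finally show False using b by simp
    qed
  next
    case False
    then have "0 < a" using a by simp
    have "0 \<le> (cmod z)\<^sup>2 * a + a\<^sup>2 * b - 2 * a * (cmod z)\<^sup>2" using key[of 1 a] by simp
    then have "0 \<le> a * (a * b - (cmod z)\<^sup>2)" by (simp add: algebra_simps power2_eq_square)
    then show ?thesis using \<open>0 < a\<close> by (simp add: zero_le_mult_iff)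
  qed
qed

section \<open>Positive semidefinite matrices and Hadamard's inequality\<close>

definition hermitian_psd :: "nat \<Rightarrow> (nat \<Rightarrow> nat \<Rightarrow> complex) \<Rightarrow> bool" where
  "hermitian_psd n M \<longleftrightarrow> (\<forall>i<n. \<forall>j<n. M j i = cnj (M i j)) \<and>
     (\<forall>c. 0 \<le> Re (\<Sum>i<n. \<Sum>j<n. cnj (c i) * M i j * c j))"

lemma hermitian_psd_quad:
  "hermitian_psd n M \<Longrightarrow> 0 \<le> Re (\<Sum>i<n. \<Sum>j<n. cnj (c i) * M i j * c j)"
  unfolding hermitian_psd_def by blast

lemma hermitian_psd_diag:
  assumes "hermitian_psd n M" "i < n"
  shows "0 \<le> Re (M i i)" "M i i = complex_of_real (Re (M i i))"
proof -
  let ?c = "\<lambda>j. if j = i then 1 else 0 :: complex"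
  have "(\<Sum>j<n. cnj (?c k) * M k j * ?c j) = (if k = i then M i i else 0)" for k
    using assms(2) by (simp add: if_distrib[of "\<lambda>x. _ * x"] sum.delta cong: if_cong)
  then have "(\<Sum>k<n. \<Sum>j<n. cnj (?c k) * M k j * ?c j) = M i i"
    using assms(2) by simp
  then show "0 \<le> Re (M i i)" using hermitian_psd_quad[OF assms(1), of ?c] by (simp only:)
  have "M i i = cnj (M i i)" using assms unfolding hermitian_psd_def by blast
  then show "M i i = complex_of_real (Re (M i i))" by (simp add: complex_eq_iff)
qed

lemma hermitian_psd_offdiag:
  assumes M: "hermitian_psd n M" and i: "i < n" and j: "j < n"
  shows "(cmod (M i j))\<^sup>2 \<le> Re (M i i) * Re (M j j)"
proof (cases "i = j")
  case True
  then show ?thesis using hermitian_psd_diag[OF M i] by (metis norm_of_real order_refl power2_abs power2_eq_square)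
next
  case False
  show ?thesis
  proof (rule sesqui_cauchy_schwarz)
    fix s t :: complex
    define c where "c k = (if k = i then cnj s else if k = j then cnj t else 0)" for k
    have *: "(\<Sum>k<n. f k * c k) = f i * cnj s + f j * cnj t" for f
    proof -
      have "(\<Sum>k<n. f k * c k) = (\<Sum>k\<in>{i,j}. f k * c k)"
        by (rule sum.mono_neutral_right) (use i j in \<open>auto simp: c_def\<close>)
      then show ?thesis using False by (simp add: c_def)
    qed
    have **: "(\<Sum>k<n. cnj (c k) * f k) = s * f i + t * f j" for f
    proof -
      have "(\<Sum>k<n. cnj (c k) * f k) = (\<Sum>k\<in>{i,j}. cnj (c k) * f k)"
        by (rule sum.mono_neutral_right) (use i j in \<open>auto simp: c_def\<close>)
      then show ?thesis using False by (simp add: c_def)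
    qed
    have "(\<Sum>k<n. \<Sum>l<n. cnj (c k) * M k l * c l) = (\<Sum>k<n. cnj (c k) * (M k i * cnj s + M k j * cnj t))"
      by (simp only: mult.assoc sum_distrib_left[symmetric] *)
    also have "\<dots> = s * (M i i * cnj s + M i j * cnj t) + t * (M j i * cnj s + M j j * cnj t)"
      by (rule **)
    also have "M j i = cnj (M i j)" using M i j unfolding hermitian_psd_def by blast
    finally have "0 \<le> Re (s * (M i i * cnj s + M i j * cnj t) + t * (cnj (M i j) * cnj s + M j j * cnj t))"
      using hermitian_psd_quad[OF M, of c] by (simp only:)
    also have "s * (M i i * cnj s + M i j * cnj t) + t * (cnj (M i j) * cnj s + M j j * cnj t)
      = complex_of_real ((cmod s)\<^sup>2 * Re (M i i)) + complex_of_real ((cmod t)\<^sup>2 * Re (M j j))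
       + (s * cnj t * M i j + cnj (s * cnj t * M i j))"
      using hermitian_psd_diag(2)[OF M i] hermitian_psd_diag(2)[OF M j]
      by (simp add: complex_norm_square algebra_simps del: of_real_power)
    finally show "0 \<le> (cmod s)\<^sup>2 * Re (M i i) + (cmod t)\<^sup>2 * Re (M j j) + 2 * Re (s * cnj t * M i j)"
      by (simp only: complex_add_cnj plus_complex.sel Re_complex_of_real)
  qed
qed

text \<open>One step of Gaussian elimination: \<open>A = L * B\<close>, where \<open>L\<close> is
  unit lower triangular and \<open>B\<close> has a first column that is zero below the pivot, so
  that expansion along it leaves one minor.\<close>

lemma det_schur_step:
  fixes M :: "nat \<Rightarrow> nat \<Rightarrow> complex"
  assumes "M 0 0 \<noteq> 0"
  shows "Determinant.det (mat (Suc n) (Suc n) (\<lambda>(i, j). M i j)) = M 0 0 *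
     Determinant.det (mat n n (\<lambda>(i, j). M (Suc i) (Suc j) - M (Suc i) 0 * M 0 (Suc j) / M 0 0))"
proof -
  define A where "A = mat (Suc n) (Suc n) (\<lambda>(i, j). M i j)"
  define L where "L = mat (Suc n) (Suc n) (\<lambda>(i, j). if i = j then 1 else if j = 0 then M i 0 / M 0 0 else 0)"
  define B where "B = mat (Suc n) (Suc n) (\<lambda>(i, j). if i = 0 then M 0 j else M i j - M i 0 * M 0 j / M 0 0)"
  have dims: "A \<in> carrier_mat (Suc n) (Suc n)" "L \<in> carrier_mat (Suc n) (Suc n)" "B \<in> carrier_mat (Suc n) (Suc n)"
    by (simp_all add: A_def L_def B_def)
  have "A = L * B"
  proof (rule eq_matI)
    fix i j assume "i < dim_row (L * B)" "j < dim_col (L * B)"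
    then have ij: "i < Suc n" "j < Suc n" by (simp_all add: L_def B_def)
    have "(L * B) $$ (i, j) = (\<Sum>k = 0..<Suc n. L $$ (i, k) * B $$ (k, j))"
      using ij by (simp add: L_def B_def scalar_prod_def)
    also have "\<dots> = (\<Sum>k\<in>{0, i}. L $$ (i, k) * B $$ (k, j))"
      by (rule sum.mono_neutral_right) (use ij in \<open>auto simp: L_def\<close>)
    also have "\<dots> = A $$ (i, j)"
      using ij assms by (cases "i = 0") (auto simp: L_def B_def A_def)
    finally show "A $$ (i, j) = (L * B) $$ (i, j)" ..
  qed (simp_all add: A_def L_def B_def)
  then have "Determinant.det A = Determinant.det L * Determinant.det B"
    using det_mult[OF dims(2,3)] by simp
  moreover have "Determinant.det L = 1"
  proof -
    have "Determinant.det L = prod_list (diag_mat L)"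
      by (rule det_lower_triangular[OF _ dims(2)]) (simp add: L_def)
    also have "diag_mat L = map (\<lambda>i. 1) [0..<Suc n]"
      unfolding diag_mat_def by (rule map_cong) (auto simp: L_def)
    also have "prod_list (map (\<lambda>i. 1 :: complex) [0..<Suc n]) = 1"
      by (induction n) auto
    finally show ?thesis .
  qed
  moreover have "Determinant.det B = M 0 0 * Determinant.det (mat n n (\<lambda>(i, j). M (Suc i) (Suc j) - M (Suc i) 0 * M 0 (Suc j) / M 0 0))"
  proof -
    have "Determinant.det B = (\<Sum>i<Suc n. B $$ (i, 0) * cofactor B i 0)"
      by (rule laplace_expansion_column[OF dims(3)]) simp
    also have "\<dots> = (\<Sum>i\<in>{0}. B $$ (i, 0) * cofactor B i 0)"
      by (rule sum.mono_neutral_right) (use assms in \<open>auto simp: B_def\<close>)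
    also have "\<dots> = M 0 0 * Determinant.det (mat_delete B 0 0)"
      by (simp add: cofactor_def B_def)
    also have "mat_delete B 0 0 = mat n n (\<lambda>(i, j). M (Suc i) (Suc j) - M (Suc i) 0 * M 0 (Suc j) / M 0 0)"
      by (rule eq_matI) (auto simp: mat_delete_def B_def)
    finally show ?thesis .
  qed
  ultimately show ?thesis by (simp add: A_def)
qed

text \<open>Eliminating the first row and column leaves the Schur complement, which is again
  positive semidefinite and has no larger diagonal entries. A zero pivot forces the whole first
  column to vanish, by Cauchy-Schwarz.\<close>

theorem hadamard_inequality:
  assumes "hermitian_psd n M"
  shows "cmod (Determinant.det (mat n n (\<lambda>(i, j). M i j))) \<le> (\<Prod>i<n. Re (M i i))"
  using assms
proof (induction n arbitrary: M)
  case 0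
  then show ?case by (simp add: det_dim_zero)
next
  case (Suc n)
  note M = Suc.prems
  have herm: "M j i = cnj (M i j)" if "i < Suc n" "j < Suc n" for i j
    using M that unfolding hermitian_psd_def by blast
  define a where "a = Re (M 0 0)"
  have Ma: "M 0 0 = complex_of_real a" and a0: "0 \<le> a"
    using hermitian_psd_diag[OF M, of 0] by (simp_all add: a_def)
  show ?case
  proof (cases "a = 0")
    case True
    have "M i 0 = 0" if "i < Suc n" for i
      using hermitian_psd_offdiag[OF M that, of 0] True by (simp add: a_def)
    then have "Determinant.det (mat (Suc n) (Suc n) (\<lambda>(i, j). M i j)) = 0"
      by (subst laplace_expansion_column[where n="Suc n" and j=0]) auto
    moreover have "0 \<le> (\<Prod>i<Suc n. Re (M i i))"
      by (rule prod_nonneg) (metis hermitian_psd_diag(1)[OF M] lessThan_iff)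
    ultimately show ?thesis by simp
  next
    case False
    with a0 have a: "0 < a" by simp
    define M' where "M' i j = M (Suc i) (Suc j) - M (Suc i) 0 * M 0 (Suc j) / M 0 0" for i j
    have psd: "hermitian_psd n M'"
      unfolding hermitian_psd_def
    proof (intro conjI allI impI)
      fix i j assume "i < n" "j < n"
      then show "M' j i = cnj (M' i j)"
        using herm[of "Suc i" "Suc j"] herm[of "Suc i" 0] herm[of 0 "Suc j"] by (simp add: M'_def Ma)
    next
      fix c :: "nat \<Rightarrow> complex"
      define S where "S = (\<Sum>j<n. M 0 (Suc j) * c j)"
      \<comment> \<open>The first coordinate minimises the quadratic form of \<open>M\<close> for
        given \<open>c\<close>; completing the square leaves the form of the Schur
        complement.\<close>
      define d where "d k = (case k of 0 \<Rightarrow> - S / M 0 0 | Suc j \<Rightarrow> c j)" for k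
      have S': "(\<Sum>i<n. cnj (c i) * M (Suc i) 0) = cnj S"
        unfolding S_def cnj_sum by (rule sum.cong) (use herm[of 0] in auto)
      have "(\<Sum>i<Suc n. \<Sum>j<Suc n. cnj (d i) * M i j * d j)
        = (cnj (d 0) * M 0 0 * d 0 + (\<Sum>j<n. cnj (d 0) * M 0 (Suc j) * c j))
          + (\<Sum>i<n. cnj (c i) * M (Suc i) 0 * d 0 + (\<Sum>j<n. cnj (c i) * M (Suc i) (Suc j) * c j))"
        by (simp only: sum.lessThan_Suc_shift) (simp add: d_def)
      also have "\<dots> = cnj (d 0) * M 0 0 * d 0 + cnj (d 0) * S + cnj S * d 0
          + (\<Sum>i<n. \<Sum>j<n. cnj (c i) * M (Suc i) (Suc j) * c j)"
        by (simp add: sum.distrib S_def[symmetric] S'[symmetric] sum_distrib_left sum_distrib_right mult.assoc)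
           (simp add: S_def sum_distrib_left mult.assoc)
      also have "cnj (d 0) * M 0 0 * d 0 + cnj (d 0) * S + cnj S * d 0 = - (cnj S * S / M 0 0)"
        using a by (simp add: d_def Ma field_simps)
      also have "cnj S * S / M 0 0 = (\<Sum>i<n. \<Sum>j<n. cnj (c i) * (M (Suc i) 0 * M 0 (Suc j) / M 0 0) * c j)"
      proof -
        have "cnj S * S = (\<Sum>i<n. cnj (c i) * M (Suc i) 0) * (\<Sum>j<n. M 0 (Suc j) * c j)"
          by (simp only: S' flip: S_def)
        then show ?thesis
          by (simp only: sum_product sum_divide_distrib) (intro sum.cong refl, simp)
      qed
      finally have "(\<Sum>i<Suc n. \<Sum>j<Suc n. cnj (d i) * M i j * d j) = (\<Sum>i<n. \<Sum>j<n. cnj (c i) * M' i j * c j)"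
        by (simp add: M'_def algebra_simps sum_subtractf)
      then show "0 \<le> Re (\<Sum>i<n. \<Sum>j<n. cnj (c i) * M' i j * c j)"
        using hermitian_psd_quad[OF M, of d] by (simp only:)
    qed
    have le: "Re (M' i i) \<le> Re (M (Suc i) (Suc i))" if "i < n" for i
    proof -
      have "M 0 (Suc i) = cnj (M (Suc i) 0)" using herm[of "Suc i" 0] that by simp
      then have "M (Suc i) 0 * M 0 (Suc i) / M 0 0 = complex_of_real ((cmod (M (Suc i) 0))\<^sup>2 / a)"
        by (simp add: Ma complex_norm_square del: of_real_power)
      then have "Re (M' i i) = Re (M (Suc i) (Suc i)) - (cmod (M (Suc i) 0))\<^sup>2 / a"
        by (simp add: M'_def)
      then show ?thesis using a by simp
    qed
    have "cmod (Determinant.det (mat (Suc n) (Suc n) (\<lambda>(i, j). M i j))) = a * cmod (Determinant.det (mat n n (\<lambda>(i, j). M' i j)))"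
      using det_schur_step[of M n] a by (simp add: Ma M'_def norm_mult)
    also have "\<dots> \<le> a * (\<Prod>i<n. Re (M' i i))"
      using Suc.IH[OF psd] a by simp
    also have "\<dots> \<le> a * (\<Prod>i<n. Re (M (Suc i) (Suc i)))"
      using a hermitian_psd_diag(1)[OF psd] le by (intro mult_left_mono prod_mono) auto
    also have "\<dots> = (\<Prod>i<Suc n. Re (M i i))"
      by (simp only: prod.lessThan_Suc_shift a_def)
    finally show ?thesis .
  qed
qed

section \<open>Determinants of kernels integrated over boxes\<close>

definition cut_kernel :: "'a set \<Rightarrow> ('a \<Rightarrow> 'a \<Rightarrow> complex) \<Rightarrow> 'a \<Rightarrow> 'a \<Rightarrow> complex" where
  "cut_kernel C u x y = indicator C x * indicator C y * u x y"

lemma cut_kernel_measurable [measurable]: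
  assumes [measurable]: "case_prod u \<in> borel_measurable (borel \<Otimes>\<^sub>M borel)" "C \<in> sets borel"
  shows "case_prod (cut_kernel C u) \<in> borel_measurable (borel \<Otimes>\<^sub>M (borel :: 'a::euclidean_space measure))"
proof -
  have [measurable]: "(\<lambda>z. u (fst z) (snd z)) \<in> borel_measurable (borel \<Otimes>\<^sub>M borel)"
    using assms(1) by (simp add: case_prod_beta')
  show ?thesis unfolding case_prod_beta' cut_kernel_def by measurable
qed

lemma det_mat_expand:
  "Determinant.det (mat m m f) = (\<Sum>p\<in>{p. p permutes {..<m}}. signof p * (\<Prod>i<m. f (i, p i)))"
proof -
  have "Determinant.det (mat m m f) = (\<Sum>p\<in>{p. p permutes {0..<m}}. signof p * (\<Prod>i = 0..<m. mat m m f $$ (i, p i)))"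
    by (rule det_def') simp
  also have "\<dots> = (\<Sum>p\<in>{p. p permutes {0..<m}}. signof p * (\<Prod>i = 0..<m. f (i, p i)))"
  proof (rule sum.cong[OF refl])
    fix p assume "p \<in> {p. p permutes {0..<m}}"
    then have "p i < m" if "i < m" for i
      using permutes_in_image[of p "{0..<m}" i] that by auto
    then show "signof p * (\<Prod>i = 0..<m. mat m m f $$ (i, p i)) = signof p * (\<Prod>i = 0..<m. f (i, p i))"
      by simp
  qed
  finally show ?thesis by (simp add: atLeast0LessThan)
qed

text \<open>The indicator of the box is distributed over the rows, one factor per index, which turns
  each permutation term into a product to which the cycle estimates apply. Points of the space are
  extensional, so a point outside the box violates some factor.\<close>

lemma box_det_expand:
  fixes u :: "'a::euclidean_space \<Rightarrow> 'a \<Rightarrow> complex"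
  assumes F: "\<And>i. i < m \<Longrightarrow> F i \<subseteq> C" and x: "x \<in> space (lborel_pow m)"
  shows "indicator (PiE {..<m} F) x * Determinant.det (mat m m (\<lambda>(i, j). u (x i) (x j)))
    = (\<Sum>p\<in>{p. p permutes {..<m}}. signof p * (\<Prod>i<m. indicator (F i) (x i) * cut_kernel C u (x i) (x (p i))))"
proof -
  have xe: "x \<in> extensional {..<m}" using x by (simp add: space_PiM PiE_iff)
  have "indicator (PiE {..<m} F) x * (\<Prod>i<m. u (x i) (x (p i))) = (\<Prod>i<m. indicator (F i) (x i) * cut_kernel C u (x i) (x (p i)))"
    if p: "p permutes {..<m}" for p
  proof (cases "x \<in> PiE {..<m} F")
    case True
    have "u (x i) (x (p i)) = indicator (F i) (x i) * cut_kernel C u (x i) (x (p i))" if "i < m" for i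
    proof -
      have "p i < m" using permutes_in_image[OF p, of i] that by simp
      then have "x i \<in> F i" "x i \<in> C" "x (p i) \<in> C" using True F that by (auto simp: PiE_iff)
      then show ?thesis by (simp add: cut_kernel_def)
    qed
    then show ?thesis using True by simp
  next
    case False
    then obtain i where "i < m" "x i \<notin> F i" using xe by (auto simp: PiE_iff)
    then have "(\<Prod>i<m. indicator (F i) (x i) * cut_kernel C u (x i) (x (p i))) = 0"
      by (intro prod_zero) (auto intro!: bexI[of _ i])
    then show ?thesis using False by simp
  qed
  then show ?thesis
    by (simp add: det_mat_expand sum_distrib_left mult.left_commute[of "indicator _ _" "signof _"])
qed

lemma hs_sq_box_le:
  "hs_sq (\<lambda>x y. indicator B x * u x y) \<le> hs_sq u"
  unfolding hs_sq_def by (intro nn_integral_mono) (auto simp: indicator_def)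

context
  fixes C :: "'a::euclidean_space set" and F :: "nat \<Rightarrow> 'a set" and m :: nat
  assumes C [measurable]: "C \<in> sets borel"
    and F [measurable]: "\<And>i. i < m \<Longrightarrow> F i \<in> sets borel"
    and FC: "\<And>i. i < m \<Longrightarrow> F i \<subseteq> C"
begin

lemma box_kernel_measurable:
  assumes "case_prod u \<in> borel_measurable (borel \<Otimes>\<^sub>M borel)" and i: "i < m"
  shows "case_prod (\<lambda>x y. indicator (F i) x * cut_kernel C u x y) \<in> borel_measurable (borel \<Otimes>\<^sub>M borel)"
proof -
  have [measurable]: "(\<lambda>z. cut_kernel C u (fst z) (snd z)) \<in> borel_measurable (borel \<Otimes>\<^sub>M borel)"
    using cut_kernel_measurable[OF assms(1) C] by (simp add: case_prod_beta')
  have [measurable]: "F i \<in> sets borel" by (rule F[OF i])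
  show ?thesis unfolding case_prod_beta' by measurable
qed

lemma box_kernel_diag: "i < m \<Longrightarrow> indicator (F i) x * cut_kernel C u x x = indicator (F i) x * u x x"
  using FC by (auto simp: cut_kernel_def indicator_def)

lemma box_kernel_diag_integrable:
  assumes "integrable lborel (\<lambda>x. indicator C x * u x x :: complex)" and i: "i < m"
  shows "integrable lborel (\<lambda>x. indicator (F i) x * cut_kernel C u x x)"
proof -
  have "integrable lborel (\<lambda>x. indicator (F i) x *\<^sub>R (indicator C x * u x x))"
    by (rule integrable_mult_indicator[OF _ assms(1)]) (simp add: F[OF i])
  moreover have "indicator (F i) x *\<^sub>R (indicator C x * u x x) = indicator (F i) x * cut_kernel C u x x" for x
    using FC[OF i] by (auto simp: indicator_def cut_kernel_def)
  ultimately show ?thesis by simp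
qed

lemma box_det_integrable:
  assumes mu: "case_prod u \<in> borel_measurable (borel \<Otimes>\<^sub>M borel)"
    and du: "integrable lborel (\<lambda>x. indicator C x * u x x :: complex)"
    and hu: "hs_sq (cut_kernel C u) < \<infinity>"
  shows "integrable (lborel_pow m) (\<lambda>x. indicator (PiE {..<m} F) x * Determinant.det (mat m m (\<lambda>(i, j). u (x i) (x j))))"
    and "(LINT x|lborel_pow m. indicator (PiE {..<m} F) x * Determinant.det (mat m m (\<lambda>(i, j). u (x i) (x j))))
     = (\<Sum>p\<in>{p. p permutes {..<m}}. signof p * (LINT x|lborel_pow m. (\<Prod>i<m. indicator (F i) (x i) * cut_kernel C u (x i) (x (p i)))))"
proof -
  have int: "integrable (lborel_pow m) (\<lambda>x. \<Prod>i<m. indicator (F i) (x i) * cut_kernel C u (x i) (x (p i)))"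
    if "p permutes {..<m}" for p
    using cycle_integrable[OF finite_lessThan that, of "\<lambda>i x y. indicator (F i) x * cut_kernel C u x y"]
      box_kernel_measurable[OF mu] box_kernel_diag_integrable[where u=u, OF du] le_less_trans[OF hs_sq_box_le hu] by simp
  have "integrable (lborel_pow m) (\<lambda>x. \<Sum>p\<in>{p. p permutes {..<m}}. signof p * (\<Prod>i<m. indicator (F i) (x i) * cut_kernel C u (x i) (x (p i))))"
    by (intro Bochner_Integration.integrable_sum integrable_mult_right int) simp
  then show "integrable (lborel_pow m) (\<lambda>x. indicator (PiE {..<m} F) x * Determinant.det (mat m m (\<lambda>(i, j). u (x i) (x j))))"
    by (rule Bochner_Integration.integrable_cong[THEN iffD2, rotated -1]) (rule refl, rule box_det_expand[OF FC])
  have "(LINT x|lborel_pow m. indicator (PiE {..<m} F) x * Determinant.det (mat m m (\<lambda>(i, j). u (x i) (x j))))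
    = (LINT x|lborel_pow m. (\<Sum>p\<in>{p. p permutes {..<m}}. signof p * (\<Prod>i<m. indicator (F i) (x i) * cut_kernel C u (x i) (x (p i)))))"
    by (rule Bochner_Integration.integral_cong[OF refl]) (rule box_det_expand[OF FC])
  also have "\<dots> = (\<Sum>p\<in>{p. p permutes {..<m}}. LINT x|lborel_pow m. signof p * (\<Prod>i<m. indicator (F i) (x i) * cut_kernel C u (x i) (x (p i))))"
    by (rule Bochner_Integration.integral_sum) (intro integrable_mult_right int, simp)
  finally show "(LINT x|lborel_pow m. indicator (PiE {..<m} F) x * Determinant.det (mat m m (\<lambda>(i, j). u (x i) (x j))))
     = (\<Sum>p\<in>{p. p permutes {..<m}}. signof p * (LINT x|lborel_pow m. (\<Prod>i<m. indicator (F i) (x i) * cut_kernel C u (x i) (x (p i)))))"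
    by simp
qed

text \<open>Formulated for arbitrary kernels, since it serves two limits: cell averages tending to
  one kernel, and the kernels of the operators \<open>Kn n\<close> tending to that of
  \<open>K\<close>.\<close>

theorem box_det_tendsto:
  assumes mu: "\<And>n. case_prod (u n) \<in> borel_measurable (borel \<Otimes>\<^sub>M borel)"
    and mw: "case_prod w \<in> borel_measurable (borel \<Otimes>\<^sub>M borel)"
    and du: "\<And>n. integrable lborel (\<lambda>x. indicator C x * u n x x :: complex)"
    and dw: "integrable lborel (\<lambda>x. indicator C x * w x x :: complex)"
    and hu: "\<And>n. hs_sq (cut_kernel C (u n)) < \<infinity>"
    and hw: "hs_sq (cut_kernel C w) < \<infinity>"
    and lim_diag: "\<And>i. i < m \<Longrightarrow> (\<lambda>n. LINT x|lborel. indicator (F i) x * u n x x) \<longlonglongrightarrow> (LINT x|lborel. indicator (F i) x * w x x)"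
    and lim_hs: "(\<lambda>n. hs_sq (\<lambda>x y. cut_kernel C (u n) x y - cut_kernel C w x y)) \<longlonglongrightarrow> 0"
  shows "(\<lambda>n. LINT x|lborel_pow m. indicator (PiE {..<m} F) x * Determinant.det (mat m m (\<lambda>(i, j). u n (x i) (x j))))
   \<longlonglongrightarrow> (LINT x|lborel_pow m. indicator (PiE {..<m} F) x * Determinant.det (mat m m (\<lambda>(i, j). w (x i) (x j))))"
proof -
  have "(\<lambda>n. LINT x|lborel_pow m. (\<Prod>i<m. indicator (F i) (x i) * cut_kernel C (u n) (x i) (x (p i))))
     \<longlonglongrightarrow> (LINT x|lborel_pow m. (\<Prod>i<m. indicator (F i) (x i) * cut_kernel C w (x i) (x (p i))))"
    if p: "p permutes {..<m}" for p
  proof (rule cycle_tendsto[OF finite_lessThan p, of "\<lambda>n i x y. indicator (F i) x * cut_kernel C (u n) x y" "\<lambda>i x y. indicator (F i) x * cut_kernel C w x y"])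
    fix i n assume "i \<in> {..<m}"
    then have i: "i < m" by simp
    show "(\<lambda>n. hs_sq (\<lambda>x y. indicator (F i) x * cut_kernel C (u n) x y - indicator (F i) x * cut_kernel C w x y)) \<longlonglongrightarrow> 0"
    proof (rule tendsto_sandwich[OF _ _ tendsto_const lim_hs])
      show "\<forall>\<^sub>F n in sequentially. hs_sq (\<lambda>x y. indicator (F i) x * cut_kernel C (u n) x y - indicator (F i) x * cut_kernel C w x y)
         \<le> hs_sq (\<lambda>x y. cut_kernel C (u n) x y - cut_kernel C w x y)"
        using hs_sq_box_le[of "F i" "\<lambda>x y. cut_kernel C (u _) x y - cut_kernel C w x y"] by (simp add: right_diff_distrib)
    qed simp
    show "(\<lambda>n. LINT x|lborel. indicator (F i) x * cut_kernel C (u n) x x) \<longlonglongrightarrow> (LINT x|lborel. indicator (F i) x * cut_kernel C w x x)"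
      using lim_diag[OF i] by (simp add: box_kernel_diag[OF i])
  qed (use box_kernel_measurable[OF mu] box_kernel_measurable[OF mw] box_kernel_diag_integrable[where u="u n" for n, OF du] box_kernel_diag_integrable[where u=w, OF dw]
        le_less_trans[OF hs_sq_box_le hu] le_less_trans[OF hs_sq_box_le hw] in simp_all)
  then show ?thesis
    unfolding box_det_integrable(2)[where u="u n" for n, OF mu du hu] box_det_integrable(2)[where u=w, OF mw dw hw]
    by (intro tendsto_sum tendsto_mult tendsto_const) simp
qed

end

section \<open>Sesquilinear forms on square-integrable functions\<close>

lemma borel_measurable_cnj [measurable (raw)]:
  assumes "f \<in> borel_measurable M" shows "(\<lambda>x. cnj (f x)) \<in> borel_measurable M"
  by (rule measurable_compose[OF assms borel_measurable_continuous_onI]) (intro continuous_intros)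

lemma L2_measurable: "f \<in> L2 \<Longrightarrow> f \<in> borel_measurable borel"
  by (simp add: L2_def)

lemma L2_sq_integrable: "f \<in> L2 \<Longrightarrow> integrable lborel (\<lambda>x. (cmod (f x))\<^sup>2)"
  by (simp add: L2_def)

lemma L2I: "f \<in> borel_measurable borel \<Longrightarrow> integrable lborel (\<lambda>x. (cmod (f x))\<^sup>2) \<Longrightarrow> f \<in> L2"
  by (simp add: L2_def)

lemma L2_add:
  assumes f: "f \<in> L2" and g: "g \<in> L2" shows "(\<lambda>x. f x + g x) \<in> L2"
proof (rule L2I)
  note [measurable] = L2_measurable[OF f] L2_measurable[OF g]
  show "(\<lambda>x. f x + g x) \<in> borel_measurable borel" by measurable
  show "integrable lborel (\<lambda>x. (cmod (f x + g x))\<^sup>2)"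
  proof (rule Bochner_Integration.integrable_bound)
    show "integrable lborel (\<lambda>x. 2 * (cmod (f x))\<^sup>2 + 2 * (cmod (g x))\<^sup>2)"
      using L2_sq_integrable[OF f] L2_sq_integrable[OF g] by simp
    show "AE x in lborel. norm ((cmod (f x + g x))\<^sup>2) \<le> norm (2 * (cmod (f x))\<^sup>2 + 2 * (cmod (g x))\<^sup>2)"
    proof (rule AE_I2)
      fix x
      have "(cmod (f x + g x))\<^sup>2 \<le> (cmod (f x) + cmod (g x))\<^sup>2" by (simp add: norm_triangle_ineq power_mono)
      also have "\<dots> \<le> 2 * (cmod (f x))\<^sup>2 + 2 * (cmod (g x))\<^sup>2"
        using sum_squares_bound[of "cmod (f x)" "cmod (g x)"] by (simp add: power2_sum)
      finally show "norm ((cmod (f x + g x))\<^sup>2) \<le> norm (2 * (cmod (f x))\<^sup>2 + 2 * (cmod (g x))\<^sup>2)" by simp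
    qed
  qed measurable
qed

lemma L2_cmult:
  assumes f: "f \<in> L2" shows "(\<lambda>x. c * f x) \<in> L2"
  using L2_measurable[OF f] L2_sq_integrable[OF f]
  by (intro L2I) (simp_all add: norm_mult power_mult_distrib)

lemma L2_diff:
  assumes f: "f \<in> L2" and g: "g \<in> L2" shows "(\<lambda>x. f x - g x) \<in> L2"
  using L2_add[OF f L2_cmult[OF g, of "-1"]] by simp

lemma L2_zero: "(\<lambda>_. 0) \<in> L2"
  by (intro L2I) simp_all

lemma L2_sum: "finite I \<Longrightarrow> (\<And>i. i \<in> I \<Longrightarrow> f i \<in> L2) \<Longrightarrow> (\<lambda>x. \<Sum>i\<in>I. f i x) \<in> L2"
  by (induction I rule: finite_induct) (simp_all add: L2_zero L2_add)

lemma L2_indicator: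
  assumes "B \<in> sets borel" "emeasure lborel B < \<infinity>" shows "indicator B \<in> L2"
proof (rule L2I)
  have "(\<lambda>x. (cmod (indicator B x))\<^sup>2) = (indicator B :: _ \<Rightarrow> real)"
    by (auto simp: indicator_def fun_eq_iff)
  then show "integrable lborel (\<lambda>x. (cmod (indicator B x))\<^sup>2)" using assms by simp
qed (use assms in simp)

lemma L2_mult_integrable:
  assumes f: "f \<in> L2" and g: "g \<in> L2" shows "integrable lborel (\<lambda>x. f x * cnj (g x))"
proof (rule Bochner_Integration.integrable_bound)
  note [measurable] = L2_measurable[OF f] L2_measurable[OF g]
  show "integrable lborel (\<lambda>x. (cmod (f x))\<^sup>2 + (cmod (g x))\<^sup>2)"
    using L2_sq_integrable[OF f] L2_sq_integrable[OF g] by simp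
  show "(\<lambda>x. f x * cnj (g x)) \<in> borel_measurable lborel" by measurable
  show "AE x in lborel. norm (f x * cnj (g x)) \<le> norm ((cmod (f x))\<^sup>2 + (cmod (g x))\<^sup>2)"
  proof (rule AE_I2)
    fix x
    have "0 \<le> cmod (f x) * cmod (g x)" by simp
    then have "cmod (f x) * cmod (g x) \<le> (cmod (f x))\<^sup>2 + (cmod (g x))\<^sup>2"
      using sum_squares_bound[of "cmod (f x)" "cmod (g x)"] by linarith
    then show "norm (f x * cnj (g x)) \<le> norm ((cmod (f x))\<^sup>2 + (cmod (g x))\<^sup>2)"
      by (simp add: norm_mult)
  qed
qed

lemma L2_inner_add_left:
  assumes "f \<in> L2" "g \<in> L2" "h \<in> L2"
  shows "L2_inner (\<lambda>x. f x + g x) h = L2_inner f h + L2_inner g h"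
  unfolding L2_inner_def using L2_mult_integrable[OF assms(1,3)] L2_mult_integrable[OF assms(2,3)]
  by (simp add: distrib_right)

lemma L2_inner_cmult_left: "L2_inner (\<lambda>x. c * f x) h = c * L2_inner f h"
  by (simp add: L2_inner_def mult.assoc)

lemma L2_inner_cnj: "cnj (L2_inner f g) = L2_inner g f"
  unfolding L2_inner_def by (subst Bochner_Integration.integral_cnj[symmetric]) (simp add: mult.commute)

lemma L2_inner_add_right:
  assumes "f \<in> L2" "g \<in> L2" "h \<in> L2"
  shows "L2_inner h (\<lambda>x. f x + g x) = L2_inner h f + L2_inner h g"
  using arg_cong[OF L2_inner_add_left[OF assms], of cnj] by (simp add: L2_inner_cnj)

lemma L2_inner_cmult_right: "L2_inner h (\<lambda>x. c * f x) = cnj c * L2_inner h f"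
  using arg_cong[OF L2_inner_cmult_left[of c f h], of cnj] by (simp add: L2_inner_cnj)

lemma L2_inner_diff_left:
  assumes "f \<in> L2" "g \<in> L2" "h \<in> L2"
  shows "L2_inner (\<lambda>x. f x - g x) h = L2_inner f h - L2_inner g h"
  using L2_inner_add_left[OF assms(1) L2_cmult[OF assms(2), of "-1"] assms(3)] L2_inner_cmult_left[of "-1" g h]
  by simp

lemma L2_inner_sum_left:
  assumes "finite I" "\<And>i. i \<in> I \<Longrightarrow> f i \<in> L2" "h \<in> L2"
  shows "L2_inner (\<lambda>x. \<Sum>i\<in>I. f i x) h = (\<Sum>i\<in>I. L2_inner (f i) h)"
  using assms(1,2)
proof (induction I rule: finite_induct)
  case empty
  then show ?case by (simp add: L2_inner_def)
next
  case (insert i I)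
  then have "L2_inner (\<lambda>x. f i x + (\<Sum>i\<in>I. f i x)) h = L2_inner (f i) h + L2_inner (\<lambda>x. \<Sum>i\<in>I. f i x) h"
    using assms(3) by (intro L2_inner_add_left L2_sum) auto
  then show ?case using insert by simp
qed

lemma L2_inner_AE_cong_left:
  assumes "AE x in lborel. f x = f' x" "f \<in> L2" "f' \<in> L2" "g \<in> L2"
  shows "L2_inner f g = L2_inner f' g"
  unfolding L2_inner_def
proof (rule integral_cong_AE)
  note [measurable] = assms(2-4)[THEN L2_measurable]
  show "(\<lambda>x. f x * cnj (g x)) \<in> borel_measurable lborel" "(\<lambda>x. f' x * cnj (g x)) \<in> borel_measurable lborel"
    by measurable
  show "AE x in lborel. f x * cnj (g x) = f' x * cnj (g x)" using assms(1) by eventually_elim simp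
qed

lemma L2_inner_self: "L2_inner f f = complex_of_real (LINT x|lborel. (cmod (f x))\<^sup>2)"
  unfolding L2_inner_def by (simp only: complex_norm_square[symmetric] integral_complex_of_real)

lemma L2_inner_self_eq_0_iff:
  assumes "f \<in> L2"
  shows "L2_inner f f = 0 \<longleftrightarrow> (AE x in lborel. f x = 0)"
proof -
  have "L2_inner f f = 0 \<longleftrightarrow> (LINT x|lborel. (cmod (f x))\<^sup>2) = 0" by (simp add: L2_inner_self)
  also have "\<dots> \<longleftrightarrow> (AE x in lborel. (cmod (f x))\<^sup>2 = 0)"
    by (rule integral_nonneg_eq_0_iff_AE[OF L2_sq_integrable[OF assms]]) simp
  finally show ?thesis by simp
qed

lemma L2_inner_0_left:
  assumes "AE x in lborel. f x = 0" "f \<in> L2" "g \<in> L2"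
  shows "L2_inner f g = 0"
  using L2_inner_AE_cong_left[OF assms(1,2) L2_zero assms(3)] by (simp add: L2_inner_def)

lemma L2_inner_0_right:
  assumes "AE x in lborel. g x = 0" "f \<in> L2" "g \<in> L2"
  shows "L2_inner f g = 0"
  using L2_inner_0_left[OF assms(1,3,2)] L2_inner_cnj[of g f] by simp

context
  fixes T :: "'a::euclidean_space operator"
  assumes T: "bounded_operator T" and sa: "self_adjoint T"
begin

lemma op_L2: "f \<in> L2 \<Longrightarrow> T f \<in> L2"
  using T by (simp add: bounded_operator_def)

text \<open>Operators act on representatives and are linear only almost everywhere, a difference
  that the inner product does not see. Operator algebra is therefore carried out inside the
  form.\<close>

lemma form_add_left:
  assumes "f \<in> L2" "g \<in> L2" "h \<in> L2"
  shows "L2_inner (T (\<lambda>x. f x + g x)) h = L2_inner (T f) h + L2_inner (T g) h"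
proof -
  have "AE x in lborel. T (\<lambda>y. f y + g y) x = T f x + T g x"
    using T assms by (simp add: bounded_operator_def)
  then have "L2_inner (T (\<lambda>x. f x + g x)) h = L2_inner (\<lambda>x. T f x + T g x) h"
    by (rule L2_inner_AE_cong_left) (intro op_L2 L2_add assms)+
  also have "\<dots> = L2_inner (T f) h + L2_inner (T g) h"
    by (intro L2_inner_add_left op_L2 assms)
  finally show ?thesis .
qed

lemma form_cmult_left:
  assumes "f \<in> L2" "h \<in> L2"
  shows "L2_inner (T (\<lambda>x. c * f x)) h = c * L2_inner (T f) h"
proof -
  have "AE x in lborel. T (\<lambda>y. c * f y) x = c * T f x"
    using T assms by (simp add: bounded_operator_def)
  then have "L2_inner (T (\<lambda>x. c * f x)) h = L2_inner (\<lambda>x. c * T f x) h"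
    by (rule L2_inner_AE_cong_left) (intro op_L2 L2_cmult assms)+
  then show ?thesis by (simp add: L2_inner_cmult_left)
qed

lemma form_diff_left:
  assumes "f \<in> L2" "g \<in> L2" "h \<in> L2"
  shows "L2_inner (T (\<lambda>x. f x - g x)) h = L2_inner (T f) h - L2_inner (T g) h"
  using form_add_left[OF assms(1) L2_cmult[OF assms(2), of "-1"] assms(3)] form_cmult_left[OF assms(2,3), of "-1"]
  by simp

lemma form_sum_left:
  assumes "finite I" "\<And>i. i \<in> I \<Longrightarrow> f i \<in> L2" "h \<in> L2"
  shows "L2_inner (T (\<lambda>x. \<Sum>i\<in>I. f i x)) h = (\<Sum>i\<in>I. L2_inner (T (f i)) h)"
  using assms(1,2)
proof (induction I rule: finite_induct)
  case empty
  then show ?case using form_cmult_left[OF L2_zero assms(3), of 0] by simp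
next
  case (insert i I)
  then have "L2_inner (T (\<lambda>x. f i x + (\<Sum>i\<in>I. f i x))) h = L2_inner (T (f i)) h + L2_inner (T (\<lambda>x. \<Sum>i\<in>I. f i x)) h"
    using assms(3) by (intro form_add_left L2_sum) auto
  then show ?case using insert by simp
qed

lemma form_hermitian:
  assumes "f \<in> L2" "g \<in> L2"
  shows "L2_inner (T g) f = cnj (L2_inner (T f) g)"
  using sa assms by (simp add: self_adjoint_def L2_inner_cnj)

lemma form_self_real:
  assumes "f \<in> L2" shows "L2_inner (T f) f = complex_of_real (Re (L2_inner (T f) f))"
  using form_hermitian[OF assms assms] by (simp add: complex_eq_iff)

lemma form_sum_right:
  assumes "finite I" "\<And>i. i \<in> I \<Longrightarrow> f i \<in> L2" "h \<in> L2"
  shows "L2_inner (T h) (\<lambda>x. \<Sum>i\<in>I. f i x) = (\<Sum>i\<in>I. L2_inner (T h) (f i))"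
  using arg_cong[OF L2_inner_sum_left[OF assms(1,2) op_L2[OF assms(3)]], where f=cnj]
  by (simp add: L2_inner_cnj)

lemma form_cauchy_schwarz:
  assumes pos: "nonneg_operator T" and f: "f \<in> L2" and g: "g \<in> L2"
  shows "(cmod (L2_inner (T f) g))\<^sup>2 \<le> Re (L2_inner (T f) f) * Re (L2_inner (T g) g)"
proof (rule sesqui_cauchy_schwarz)
  fix s t :: complex
  let ?h = "\<lambda>x. s * f x + t * g x"
  define a where "a = Re (L2_inner (T f) f)"
  define b where "b = Re (L2_inner (T g) g)"
  have fa: "L2_inner (T f) f = complex_of_real a" and gb: "L2_inner (T g) g = complex_of_real b"
    unfolding a_def b_def by (rule form_self_real[OF f], rule form_self_real[OF g])
  have h: "?h \<in> L2" by (intro L2_add L2_cmult f g)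
  have *: "L2_inner (T ?h) k = s * L2_inner (T f) k + t * L2_inner (T g) k" if "k \<in> L2" for k
    by (subst form_add_left[OF L2_cmult[OF f] L2_cmult[OF g] that]) (simp add: form_cmult_left f g that)
  have "L2_inner (T ?h) ?h = cnj s * L2_inner (T ?h) f + cnj t * L2_inner (T ?h) g"
    by (subst L2_inner_add_right[OF L2_cmult[OF f] L2_cmult[OF g] op_L2[OF h]]) (simp add: L2_inner_cmult_right)
  also have "\<dots> = cnj s * (s * L2_inner (T f) f + t * cnj (L2_inner (T f) g)) + cnj t * (s * L2_inner (T f) g + t * L2_inner (T g) g)"
    by (simp only: *[OF f] *[OF g] form_hermitian[OF f g])
  also have "\<dots> = complex_of_real ((cmod s)\<^sup>2 * a) + complex_of_real ((cmod t)\<^sup>2 * b)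
     + (s * cnj t * L2_inner (T f) g + cnj (s * cnj t * L2_inner (T f) g))"
    unfolding fa gb by (simp add: complex_norm_square algebra_simps del: of_real_power)
  finally have "Re (L2_inner (T ?h) ?h) = (cmod s)\<^sup>2 * a + (cmod t)\<^sup>2 * b + 2 * Re (s * cnj t * L2_inner (T f) g)"
    by (simp only: complex_add_cnj plus_complex.sel Re_complex_of_real)
  moreover have "0 \<le> Re (L2_inner (T ?h) ?h)" using pos h by (simp add: nonneg_operator_def)
  ultimately show "0 \<le> (cmod s)\<^sup>2 * Re (L2_inner (T f) f) + (cmod t)\<^sup>2 * Re (L2_inner (T g) g)
     + 2 * Re (s * cnj t * L2_inner (T f) g)" by (simp only: fa gb Re_complex_of_real)
qed

end

section \<open>Orthonormal bases\<close>

lemma L2_integrable_on_dcube: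
  assumes f: "f \<in> L2"
  shows "integrable lborel (\<lambda>x. indicator (dcube R) x *\<^sub>R f x)"
proof (rule Bochner_Integration.integrable_bound)
  note [measurable] = L2_measurable[OF f]
  show "integrable lborel (\<lambda>x. indicator (dcube R) x + (cmod (f x))\<^sup>2)"
    using L2_sq_integrable[OF f] emeasure_dcube_finite[where 'a='a, of R] by simp
  show "(\<lambda>x. indicator (dcube R) x *\<^sub>R f x) \<in> borel_measurable lborel" by measurable
  show "AE x in lborel. norm (indicator (dcube R) x *\<^sub>R f x) \<le> norm (indicator (dcube R) x + (cmod (f x))\<^sup>2)"
  proof (rule AE_I2)
    fix x :: 'a
    have "cmod (f x) \<le> 1 + (cmod (f x))\<^sup>2"
      using sum_squares_bound[of 1 "cmod (f x)"] norm_ge_zero[of "f x"] by (simp del: norm_ge_zero)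
    then show "norm (indicator (dcube R) x *\<^sub>R f x) \<le> norm (indicator (dcube R) x + (cmod (f x))\<^sup>2)"
      by (auto simp: indicator_def)
  qed
qed

text \<open>All averages over cells inside a cube vanish, so the deviation on the cube equals the
  L^1 norm of \<open>f\<close> there at every level; as the deviation tends to 0, that norm is
  0.\<close>

lemma dcells_total:
  fixes f :: "'a::euclidean_space \<Rightarrow> complex"
  assumes f: "f \<in> L2" and orth: "\<And>N x. L2_inner f (indicator (dcell N x)) = 0"
  shows "AE x in lborel. f x = 0"
proof -
  have "AE x in lborel. x \<in> dcube R \<longrightarrow> f x = 0" for R
  proof -
    define h where "h = (\<lambda>x. indicator (dcube R) x *\<^sub>R f x)"
    have h: "integrable lborel h" unfolding h_def by (rule L2_integrable_on_dcube[OF f])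
    have "cell_avg N h x = 0" if "x \<in> dcube R" for N x
    proof -
      have "(LINT y|lborel. indicator (dcell N x) y *\<^sub>R h y) = L2_inner f (indicator (dcell N x))"
        unfolding L2_inner_def h_def
        by (rule Bochner_Integration.integral_cong) (use dcell_subset_dcube[OF that, of N] in \<open>auto simp: indicator_def\<close>)
      then show ?thesis by (simp add: cell_avg_def orth)
    qed
    then have "cell_dev R N h = (LINT x|lborel. norm (h x))" for N
      unfolding cell_dev_def by (intro Bochner_Integration.integral_cong refl) (auto simp: indicator_def h_def)
    then have "(LINT x|lborel. norm (h x)) = 0"
      using cell_avg_tendsto_L1[OF h, of R] LIMSEQ_unique[OF tendsto_const] by auto
    then have "AE x in lborel. norm (h x) = 0"
      using integral_nonneg_eq_0_iff_AE[of lborel "\<lambda>x. norm (h x)"] h by simp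
    then show ?thesis by eventually_elim (auto simp: h_def indicator_def split: if_splits)
  qed
  then have "AE x in lborel. \<forall>R. x \<in> dcube R \<longrightarrow> f x = 0" unfolding AE_all_countable by blast
  then show ?thesis
  proof eventually_elim
    case (elim x)
    obtain R where "{x} \<subseteq> dcube R" using bounded_subset_dcube[of "{x}"] by auto
    then show ?case using elim by auto
  qed
qed

text \<open>Junk division: a residual of norm zero makes its coefficient \<open>0\<close>.\<close>

fun gram_schmidt :: "(nat \<Rightarrow> 'a::euclidean_space \<Rightarrow> complex) \<Rightarrow> nat \<Rightarrow> 'a \<Rightarrow> complex" where
  "gram_schmidt g m = (\<lambda>x. g m x - (\<Sum>i<m.
      L2_inner (g m) (gram_schmidt g i) / L2_inner (gram_schmidt g i) (gram_schmidt g i) * gram_schmidt g i x))"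

declare gram_schmidt.simps [simp del]

lemma gram_schmidt_L2:
  assumes g: "\<And>m. g m \<in> L2" shows "gram_schmidt g m \<in> L2"
proof (induction m rule: less_induct)
  case (less m)
  show ?case
    by (subst gram_schmidt.simps) (intro L2_diff L2_sum L2_cmult g less; simp)
qed

lemma gram_schmidt_orthogonal:
  assumes g: "\<And>m. g m \<in> L2" and "i < m"
  shows "L2_inner (gram_schmidt g m) (gram_schmidt g i) = 0"
  using \<open>i < m\<close>
proof (induction m arbitrary: i rule: less_induct)
  case (less m)
  let ?r = "gram_schmidt g"
  have r: "?r m \<in> L2" for m by (rule gram_schmidt_L2) (rule g)
  have "L2_inner (?r m) (?r i) = L2_inner (g m) (?r i) - L2_inner (\<lambda>x. \<Sum>j<m. L2_inner (g m) (?r j) / L2_inner (?r j) (?r j) * ?r j x) (?r i)"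
    by (subst gram_schmidt.simps[of g m]) (intro L2_inner_diff_left L2_sum L2_cmult g r; simp)
  also have "L2_inner (\<lambda>x. \<Sum>j<m. L2_inner (g m) (?r j) / L2_inner (?r j) (?r j) * ?r j x) (?r i)
     = (\<Sum>j<m. L2_inner (\<lambda>x. L2_inner (g m) (?r j) / L2_inner (?r j) (?r j) * ?r j x) (?r i))"
    by (intro L2_inner_sum_left L2_cmult r) simp
  also have "\<dots> = (\<Sum>j<m. L2_inner (g m) (?r j) / L2_inner (?r j) (?r j) * L2_inner (?r j) (?r i))"
    by (simp only: L2_inner_cmult_left)
  also have "\<dots> = (\<Sum>j\<in>{i}. L2_inner (g m) (?r j) / L2_inner (?r j) (?r j) * L2_inner (?r j) (?r i))"
  proof (rule sum.mono_neutral_right)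
    show "\<forall>j\<in>{..<m} - {i}. L2_inner (g m) (?r j) / L2_inner (?r j) (?r j) * L2_inner (?r j) (?r i) = 0"
    proof
      fix j assume j: "j \<in> {..<m} - {i}"
      have "L2_inner (?r j) (?r i) = 0"
      proof (cases "i < j")
        case True
        then show ?thesis using less.IH[of j i] j by simp
      next
        case False
        then have "L2_inner (?r i) (?r j) = 0" using less.IH[of i j] j less.prems by simp
        then show ?thesis using L2_inner_cnj[of "?r i" "?r j"] by simp
      qed
      then show "L2_inner (g m) (?r j) / L2_inner (?r j) (?r j) * L2_inner (?r j) (?r i) = 0" by simp
    qed
  qed (use less.prems in auto)
  \<comment> \<open>A residual of norm zero is orthogonal to everything, so the junk coefficient 0
    is the correct one.\<close>
  also have "\<dots> = L2_inner (g m) (?r i)"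
  proof (cases "L2_inner (?r i) (?r i) = 0")
    case True
    then have "AE x in lborel. ?r i x = 0" using L2_inner_self_eq_0_iff[OF r] by blast
    then show ?thesis using L2_inner_0_right[OF _ g r] True by simp
  qed simp
  finally show ?case by simp
qed

text \<open>Each \<open>g m\<close> is its residual plus a combination of earlier residuals, so
  orthogonality to the residuals passes to the original family.\<close>

lemma gram_schmidt_total:
  assumes g: "\<And>m. g m \<in> L2" and f: "f \<in> L2" and orth: "\<And>m. L2_inner f (gram_schmidt g m) = 0"
  shows "L2_inner f (g m) = 0"
proof -
  let ?r = "gram_schmidt g"
  have r: "?r m \<in> L2" for m by (rule gram_schmidt_L2) (rule g)
  have orth': "L2_inner (?r m) f = 0" for m using L2_inner_cnj[of f "?r m"] orth[of m] by simp
  have "0 = L2_inner (?r m) f" by (simp add: orth')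
  also have "\<dots> = L2_inner (g m) f - L2_inner (\<lambda>x. \<Sum>j<m. L2_inner (g m) (?r j) / L2_inner (?r j) (?r j) * ?r j x) f"
    by (subst gram_schmidt.simps[of g m]) (intro L2_inner_diff_left L2_sum L2_cmult g r f; simp)
  also have "L2_inner (\<lambda>x. \<Sum>j<m. L2_inner (g m) (?r j) / L2_inner (?r j) (?r j) * ?r j x) f
     = (\<Sum>j<m. L2_inner (\<lambda>x. L2_inner (g m) (?r j) / L2_inner (?r j) (?r j) * ?r j x) f)"
    by (intro L2_inner_sum_left L2_cmult r f) simp
  also have "\<dots> = 0" by (simp only: L2_inner_cmult_left orth') simp
  finally show ?thesis using L2_inner_cnj[of "g m" f] by simp
qed

text \<open>\<open>has_op_trace\<close> quantifies over all orthonormal bases; if there were none,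
  every number would be a trace and the definite description \<open>op_trace\<close> would be void.
  The existence of a basis is what gives content to the hypothesis on traces. It comes from
  orthogonalising the indicators of all cells.\<close>

theorem orthonormal_basis_exists: "\<exists>e :: nat \<Rightarrow> 'a::euclidean_space \<Rightarrow> complex. orthonormal_basis e"
proof -
  define S where "S = (\<Union>N. range (dcell N :: 'a \<Rightarrow> _))"
  have S: "countable S" "S \<noteq> {}" by (auto simp: S_def countable_dcells)
  define Q where "Q = from_nat_into S"
  have QS: "Q m \<in> S" for m unfolding Q_def by (rule from_nat_into[OF S(2)])
  have ex: "\<exists>m. Q m = dcell N x" for N x
    unfolding Q_def by (rule from_nat_into_surj[OF S(1)]) (auto simp: S_def)
  define g :: "nat \<Rightarrow> 'a \<Rightarrow> complex" where "g m = indicator (Q m)" for m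
  let ?r = "gram_schmidt g"
  have g: "g m \<in> L2" for m
    using QS[of m] unfolding g_def S_def by (auto intro!: L2_indicator simp: emeasure_dcell)
  have r: "?r m \<in> L2" for m by (rule gram_schmidt_L2) (rule g)
  define Z where "Z = {m. L2_inner (?r m) (?r m) \<noteq> 0}"
  \<comment> \<open>A basis is indexed by all natural numbers, so infinitely many residuals must
    survive. Otherwise let \<open>m\<close> bound \<open>Z\<close> and take a unit cell outside a
    cube that contains the cells of index below \<open>m\<close>: residuals of index below
    \<open>m\<close> vanish on it, those of index at least \<open>m\<close> have coefficient 0, so
    its own residual equals 1 there.\<close>
  have "infinite Z"
  proof
    assume "finite Z"
    then obtain m where m: "\<And>l. l \<in> Z \<Longrightarrow> l < m" using finite_nat_bounded[of Z] by blast
    have "bounded (\<Union>i<m. Q i)"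
    proof (rule bounded_UN, simp, rule ballI)
      fix i
      obtain N x where "Q i = dcell N x" using QS[of i] by (auto simp: S_def)
      moreover obtain R where "{x} \<subseteq> dcube R" using bounded_subset_dcube[of "{x}"] by auto
      ultimately show "bounded (Q i)"
        using dcell_subset_dcube[of x R N] bounded_subset[OF bounded_dcube] by auto
    qed
    then obtain R where R: "(\<Union>i<m. Q i) \<subseteq> dcube R" using bounded_subset_dcube by blast
    have "\<exists>x :: 'a. x \<notin> dcube R"
    proof -
      obtain b :: 'a where b: "b \<in> Basis" using nonempty_Basis by blast
      then have "real R *\<^sub>R b \<notin> dcube R" by (auto simp: dcube_def intro!: bexI[of _ b])
      then show ?thesis by blast
    qed
    then obtain x :: 'a where x: "x \<notin> dcube R" by blast
    obtain l where l: "Q l = dcell 0 x" using ex by blast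
    have disj: "y \<notin> dcube R" if "y \<in> Q l" for y
      using dcell_dcube_iff[of y 0 x R] that x l by simp
    have zero: "?r i y = 0" if "i < m" "y \<notin> dcube R" for i y
      using that(1)
    proof (induction i rule: less_induct)
      case (less i)
      have "g i y = 0" using R less.prems that(2) by (auto simp: g_def indicator_def)
      then show ?case using less by (subst gram_schmidt.simps) simp
    qed
    have "x \<in> Q l" using l by simp
    then have "m \<le> l" using R disj[of x] not_le by blast
    then have "l \<notin> Z" using m by force
    then have "AE y in lborel. ?r l y = 0" using L2_inner_self_eq_0_iff[OF r] by (simp add: Z_def)
    moreover have "?r l y = 1" if "y \<in> Q l" for y
    proof -
      have "L2_inner (g l) (?r i) / L2_inner (?r i) (?r i) * ?r i y = 0" for i
        using zero[OF _ disj[OF that], of i] m[of i] by (cases "i < m") (auto simp: Z_def)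
      then have "?r l y = g l y" by (subst gram_schmidt.simps) (simp only: sum.neutral_const diff_zero)
      then show ?thesis using that by (simp add: g_def)
    qed
    ultimately have "AE y in lborel. y \<notin> dcell 0 x" unfolding l[symmetric] by (auto elim!: eventually_mono)
    then have "emeasure lborel (dcell 0 x) = 0"
      by (subst (asm) AE_iff_measurable[of "dcell 0 x"]) auto
    then show False using cvol_pos[where ?'a='a, of 0] by (simp add: emeasure_dcell)
  qed
  define z where "z = enumerate Z"
  have z: "bij_betw z UNIV Z" unfolding z_def by (rule bij_enumerate[OF \<open>infinite Z\<close>])
  define c where "c n = 1 / complex_of_real (sqrt (Re (L2_inner (?r (z n)) (?r (z n)))))" for n
  define e where "e n = (\<lambda>x. c n * ?r (z n) x)" for n
  have zZ: "L2_inner (?r (z n)) (?r (z n)) \<noteq> 0" for n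
    using bij_betwE[OF z] by (auto simp: Z_def)
  have c0: "c n \<noteq> 0" for n using zZ[of n] by (auto simp: c_def L2_inner_self)
  have "orthonormal_basis e"
    unfolding orthonormal_basis_def
  proof (intro conjI allI ballI impI)
    show "e i \<in> L2" for i unfolding e_def by (intro L2_cmult r)
  next
    fix i j
    have eq: "L2_inner (e i) (e j) = c i * cnj (c j) * L2_inner (?r (z i)) (?r (z j))"
      by (simp only: e_def L2_inner_cmult_left L2_inner_cmult_right mult_ac)
    show "L2_inner (e i) (e j) = (if i = j then 1 else 0)"
    proof (cases "i = j")
      case True
      define s where "s = (LINT x|lborel. (cmod (?r (z i) x))\<^sup>2)"
      have "s \<noteq> 0" "0 \<le> s" using zZ[of i] by (auto simp: L2_inner_self s_def)
      then have "complex_of_real (sqrt s) * complex_of_real (sqrt s) = complex_of_real s"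
        by (simp flip: of_real_mult)
      then have sq: "complex_of_real s / (complex_of_real (sqrt s) * complex_of_real (sqrt s)) = 1"
        using \<open>s \<noteq> 0\<close> by simp
      have rr: "L2_inner (?r (z i)) (?r (z i)) = complex_of_real s" by (simp add: L2_inner_self s_def)
      have "L2_inner (e i) (e j) = c i * cnj (c i) * complex_of_real s" using eq True rr by simp
      also have "\<dots> = complex_of_real s / (complex_of_real (sqrt s) * complex_of_real (sqrt s))"
        unfolding c_def rr by simp
      finally show ?thesis using True sq by simp
    next
      case False
      then have "z i \<noteq> z j" using z by (auto simp: bij_betw_def inj_on_def)
      then consider "z j < z i" | "z i < z j" by linarith
      then have "L2_inner (?r (z i)) (?r (z j)) = 0"
        by cases (use gram_schmidt_orthogonal[OF g] L2_inner_cnj[of "?r (z j)" "?r (z i)"] in auto)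
      then show ?thesis using False by (simp add: eq)
    qed
  next
    fix f assume f: "f \<in> L2" and orth: "\<forall>i. L2_inner f (e i) = 0"
    have orth_r: "L2_inner f (?r m) = 0" for m
    proof (cases "m \<in> Z")
      case True
      then obtain i where "m = z i" using z by (auto simp: bij_betw_def)
      then show ?thesis using orth[rule_format, of i] c0[of i] by (simp add: e_def L2_inner_cmult_right)
    next
      case False
      then have "AE x in lborel. ?r m x = 0" using L2_inner_self_eq_0_iff[OF r] by (simp add: Z_def)
      then show ?thesis by (rule L2_inner_0_right[OF _ f r])
    qed
    show "AE x in lborel. f x = 0"
    proof (rule dcells_total[OF f])
      fix N :: nat and x :: 'a
      obtain m where "Q m = dcell N x" using ex by blast
      then show "L2_inner f (indicator (dcell N x)) = 0"
        using gram_schmidt_total[OF g f orth_r, of m] by (simp add: g_def)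
    qed
  qed
  then show ?thesis by blast
qed

lemma op_trace_eqI:
  assumes "has_op_trace T t" shows "op_trace T = t"
proof -
  obtain e :: "nat \<Rightarrow> 'a \<Rightarrow> complex" where "orthonormal_basis e" using orthonormal_basis_exists by blast
  then have "s = t" if "has_op_trace T s" for s
    using that assms sums_unique2 unfolding has_op_trace_def by blast
  then show ?thesis unfolding op_trace_def using assms by blast
qed

section \<open>Cell averages of a determinantal kernel\<close>

lemma nn_integral_shift:
  fixes f :: "'a::euclidean_space \<Rightarrow> ennreal"
  assumes [measurable]: "f \<in> borel_measurable borel"
  shows "(\<integral>\<^sup>+y. f y \<partial>lborel) = (\<integral>\<^sup>+w. f (x + w) \<partial>lborel)"
  by (subst lborel_distr_plus[of x, symmetric]) (simp add: nn_integral_distr)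

text \<open>Substituting \<open>v = u + w\<close> turns the double integral into one over parallels
  to the diagonal, the form in which the L^1 continuity of the kernel is given.\<close>

lemma nn_integral_diagonal_shift:
  fixes G :: "'a::euclidean_space \<Rightarrow> 'a \<Rightarrow> ennreal"
  assumes G: "case_prod G \<in> borel_measurable (borel \<Otimes>\<^sub>M borel)"
  shows "(\<integral>\<^sup>+u. (\<integral>\<^sup>+v. G u v \<partial>lborel) \<partial>lborel) = (\<integral>\<^sup>+w. (\<integral>\<^sup>+u. G u (u + w) \<partial>lborel) \<partial>lborel)"
proof -
  have mG: "(\<lambda>z. G (f z) (g z)) \<in> borel_measurable M" if "f \<in> M \<rightarrow>\<^sub>M borel" "g \<in> M \<rightarrow>\<^sub>M borel" for f g and M :: "'z measure"
    using measurable_compose[OF measurable_Pair[OF that] G] by simp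
  have "(\<integral>\<^sup>+u. (\<integral>\<^sup>+v. G u v \<partial>lborel) \<partial>lborel) = (\<integral>\<^sup>+u. (\<integral>\<^sup>+w. G u (u + w) \<partial>lborel) \<partial>lborel)"
    by (intro nn_integral_cong nn_integral_shift mG) simp_all
  also have "\<dots> = (\<integral>\<^sup>+w. (\<integral>\<^sup>+u. G u (u + w) \<partial>lborel) \<partial>lborel)"
    by (rule lborel_pair.Fubini') (unfold case_prod_beta', intro mG; measurable)
  finally show ?thesis .
qed

text \<open>The cube is a parameter, so that \<open>K\<close> and every \<open>Kn n\<close> can be
  treated on the same one.\<close>

locale det_kernel =
  fixes K :: "'a::euclidean_space operator" and k :: "'a \<Rightarrow> 'a \<Rightarrow> complex" and R :: nat
  assumes dk: "determinantal_kernel K k"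
begin

abbreviation C :: "'a set" where "C \<equiv> dcube R"

lemma operator_props: "bounded_operator K" "self_adjoint K" "nonneg_operator K"
  using dk by (simp_all add: determinantal_kernel_def)

lemma k_measurable: "case_prod k \<in> borel_measurable (borel \<Otimes>\<^sub>M borel)"
proof -
  have "case_prod k \<in> borel_measurable (lborel \<Otimes>\<^sub>M lborel)"
    using dk unfolding determinantal_kernel_def integral_kernel_def by blast
  then show ?thesis by (simp cong: measurable_cong_sets)
qed

lemma k_measurable': "f \<in> M \<rightarrow>\<^sub>M borel \<Longrightarrow> g \<in> M \<rightarrow>\<^sub>M borel \<Longrightarrow> (\<lambda>z. k (f z) (g z)) \<in> borel_measurable M"
  using measurable_compose[OF measurable_Pair k_measurable] by simp

definition shifted :: "'a \<Rightarrow> 'a \<Rightarrow> complex" where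
  "shifted w x = k x (x + w) * indicator C (x + w)"

lemma shifted_integrable: "integrable lborel (\<lambda>x. indicator C x *\<^sub>R shifted w x)"
  and shifted_continuous: "((\<lambda>z. LINT x|lborel. indicator C x * cmod (shifted z x - shifted w x)) \<longlongrightarrow> 0) (at w)"
  using dk bounded_borel_dcube[of R]
  unfolding determinantal_kernel_def L1_continuous_kernel_def Let_def shifted_def set_integrable_def set_lebesgue_integral_def
  by auto

lemma diag_integrable: "integrable lborel (\<lambda>x. indicator C x * k x x)"
proof -
  have "indicator C x *\<^sub>R shifted 0 x = indicator C x * k x x" for x
    by (simp add: shifted_def indicator_def)
  then show ?thesis using shifted_integrable[of 0] by simp
qed

lemma shifted_norm_continuous: "isCont (\<lambda>w. LINT x|lborel. indicator C x * cmod (shifted w x)) w"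
proof -
  have i: "integrable lborel (\<lambda>x. indicator C x * cmod (shifted z x))" for z
    using integrable_norm[OF shifted_integrable[of z]] by simp
  have d: "integrable lborel (\<lambda>x. indicator C x * cmod (shifted z x - shifted w x))" for z
  proof -
    have "integrable lborel (\<lambda>x. norm (indicator C x *\<^sub>R shifted z x - indicator C x *\<^sub>R shifted w x))"
      using shifted_integrable by simp
    then show ?thesis by (simp flip: scaleR_diff_right)
  qed
  have "((\<lambda>z. (LINT x|lborel. indicator C x * cmod (shifted z x)) - (LINT x|lborel. indicator C x * cmod (shifted w x))) \<longlongrightarrow> 0) (at w)"
  proof (rule Lim_null_comparison[OF _ shifted_continuous], rule always_eventually, rule allI)
    fix z
    have "norm ((LINT x|lborel. indicator C x * cmod (shifted z x)) - (LINT x|lborel. indicator C x * cmod (shifted w x)))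
      = norm (LINT x|lborel. indicator C x * cmod (shifted z x) - indicator C x * cmod (shifted w x))"
      using i by simp
    also have "\<dots> \<le> (LINT x|lborel. norm (indicator C x * cmod (shifted z x) - indicator C x * cmod (shifted w x)))"
      by (rule integral_norm_bound)
    also have "\<dots> \<le> (LINT x|lborel. indicator C x * cmod (shifted z x - shifted w x))"
    proof (rule integral_mono)
      fix x
      show "norm (indicator C x * cmod (shifted z x) - indicator C x * cmod (shifted w x)) \<le> indicator C x * cmod (shifted z x - shifted w x)"
        by (simp add: indicator_def norm_triangle_ineq3)
    qed (use i d in auto)
    finally show "norm ((LINT x|lborel. indicator C x * cmod (shifted z x)) - (LINT x|lborel. indicator C x * cmod (shifted w x)))
      \<le> (LINT x|lborel. indicator C x * cmod (shifted z x - shifted w x))" .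
  qed
  then show ?thesis unfolding isCont_def by (rule LIM_zero_cancel)
qed

text \<open>A function on the product space, so that \<open>cell_avg\<close> applies to it
  directly.\<close>

definition h :: "'a \<times> 'a \<Rightarrow> complex" where
  "h z = cut_kernel C k (fst z) (snd z)"

lemma h_measurable: "h \<in> borel_measurable (borel \<Otimes>\<^sub>M borel)"
  using cut_kernel_measurable[OF k_measurable, of C] by (simp add: h_def[abs_def] case_prod_beta')

text \<open>The L^1 norm along a parallel to the diagonal depends continuously on the shift, so it
  is bounded on the ball of radius \<open>2 * r\<close>; outside this ball no two points of the cube
  differ by the shift.\<close>

lemma h_integrable: "integrable (lborel \<Otimes>\<^sub>M lborel) h"
proof (rule integrableI_bounded)
  show mh: "h \<in> borel_measurable (lborel \<Otimes>\<^sub>M lborel)" using h_measurable by (simp cong: measurable_cong_sets)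
  obtain r where r: "\<And>x. x \<in> C \<Longrightarrow> norm x \<le> r" using bounded_dcube[where ?'a='a, of R] by (auto simp: bounded_iff)
  define \<psi> where "\<psi> w = (LINT x|lborel. indicator C x * cmod (shifted w x))" for w
  have "continuous_on (cball 0 (2 * r)) \<psi>"
    using shifted_norm_continuous unfolding \<psi>_def[abs_def] by (simp add: continuous_at_imp_continuous_on)
  then have "bounded (\<psi> ` cball 0 (2 * r))"
    by (intro compact_imp_bounded compact_continuous_image compact_cball)
  then obtain B where B0: "\<forall>y\<in>\<psi> ` cball 0 (2 * r). norm y \<le> B"
    unfolding bounded_iff by blast
  have B: "\<psi> w \<le> B" if "w \<in> cball 0 (2 * r)" for w
    using B0[rule_format, OF imageI[OF that]] by simp
  have "(\<integral>\<^sup>+z. norm (h z) \<partial>(lborel \<Otimes>\<^sub>M lborel)) = (\<integral>\<^sup>+u. (\<integral>\<^sup>+v. norm (cut_kernel C k u v) \<partial>lborel) \<partial>lborel)"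
  proof -
    have "(\<lambda>z. ennreal (norm (h z))) \<in> borel_measurable (lborel \<Otimes>\<^sub>M lborel)" using mh by measurable
    from lborel.nn_integral_fst[OF this] show ?thesis by (simp add: h_def)
  qed
  also have "\<dots> = (\<integral>\<^sup>+w. (\<integral>\<^sup>+u. norm (cut_kernel C k u (u + w)) \<partial>lborel) \<partial>lborel)"
    by (rule nn_integral_diagonal_shift)
       (use cut_kernel_measurable[OF k_measurable, of C] in \<open>simp add: case_prod_beta'\<close>)
  also have "\<dots> \<le> (\<integral>\<^sup>+w. ennreal B * indicator (cball (0 :: 'a) (2 * r)) w \<partial>lborel)"
  proof (rule nn_integral_mono)
    fix w :: 'a
    show "(\<integral>\<^sup>+u. norm (cut_kernel C k u (u + w)) \<partial>lborel) \<le> ennreal B * indicator (cball 0 (2 * r)) w"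
    proof (cases "w \<in> cball 0 (2 * r)")
      case True
      have "(\<integral>\<^sup>+u. norm (cut_kernel C k u (u + w)) \<partial>lborel) = (\<integral>\<^sup>+u. ennreal (indicator C u * cmod (shifted w u)) \<partial>lborel)"
        by (rule nn_integral_cong) (simp add: cut_kernel_def shifted_def norm_mult indicator_def)
      also have "\<dots> = ennreal (\<psi> w)"
        unfolding \<psi>_def
        by (rule nn_integral_eq_integral) (use integrable_norm[OF shifted_integrable[of w]] in simp_all)
      also have "\<dots> \<le> ennreal B" by (rule ennreal_leI[OF B[OF True]])
      finally show ?thesis using True by simp
    next
      case False
      have "cut_kernel C k u (u + w) = 0" for u
      proof (rule ccontr)
        assume "cut_kernel C k u (u + w) \<noteq> 0"
        then have "u \<in> C" "u + w \<in> C" by (auto simp: cut_kernel_def indicator_def split: if_splits)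
        then have "norm w \<le> 2 * r" using r[of u] r[of "u + w"] norm_triangle_ineq4[of "u + w" u] by simp
        then show False using False by simp
      qed
      then show ?thesis by simp
    qed
  qed
  also have "\<dots> = ennreal B * emeasure lborel (cball (0::'a) (2 * r))"
    by (rule nn_integral_cmult_indicator) simp
  also have "\<dots> < \<infinity>"
    using emeasure_bounded_finite[OF bounded_cball, of "0::'a" "2 * r"] by (simp add: ennreal_mult_less_top)
  finally show "(\<integral>\<^sup>+z. norm (h z) \<partial>(lborel \<Otimes>\<^sub>M lborel)) < \<infinity>" .
qed

text \<open>Normalised to integral 1, not to norm 1: the form at two such functions is then an
  average of the kernel.\<close>

definition cell_fun :: "nat \<Rightarrow> 'a \<Rightarrow> 'a \<Rightarrow> complex" where
  "cell_fun N x y = complex_of_real (1 / cvol TYPE('a) N) * indicator (dcell N x) y"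

lemma cell_fun_L2: "cell_fun N x \<in> L2"
proof -
  have "indicator (dcell N x) \<in> L2" by (rule L2_indicator) (simp_all add: emeasure_dcell)
  then show ?thesis unfolding cell_fun_def[abs_def] by (rule L2_cmult)
qed

lemma cnj_cell_fun: "cnj (cell_fun N x y) = cell_fun N x y"
  by (simp add: cell_fun_def indicator_def)

text \<open>The kernel represents \<open>K\<close> only on functions cut to a bounded set, and only
  almost everywhere there. Cell functions based at points of the cube are supported in it, so
  \<open>mult_indicator\<close> leaves them unchanged.\<close>

lemma form_cell_fun:
  assumes x: "x \<in> C" and y: "y \<in> C"
  shows "L2_inner (K (cell_fun N y)) (cell_fun M x) =
    (LINT u|lborel. cell_fun M x u * (LINT v|lborel. cell_fun N y v * cut_kernel C k u v))"
proof -
  have eq: "mult_indicator C (cell_fun N y) = cell_fun N y"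
    using dcell_subset_dcube[OF y, of N] by (auto simp: mult_indicator_def cell_fun_def indicator_def fun_eq_iff)
  have "AE u in lborel. u \<in> C \<longrightarrow> K (cell_fun N y) u = (LINT v:C|lborel. k u v * cell_fun N y v)"
  proof -
    have "integral_kernel K k" using dk by (simp add: determinantal_kernel_def)
    then have "AE u in lborel. u \<in> C \<longrightarrow> set_integrable lborel C (\<lambda>v. k u v * cell_fun N y v) \<and>
        K (mult_indicator C (cell_fun N y)) u = (LINT v:C|lborel. k u v * cell_fun N y v)"
      using bounded_borel_dcube[of R] cell_fun_L2[of N y] unfolding integral_kernel_def by blast
    then show ?thesis unfolding eq by eventually_elim blast
  qed
  then have ae: "AE u in lborel. K (cell_fun N y) u * cnj (cell_fun M x u) =
     cell_fun M x u * (LINT v|lborel. cell_fun N y v * cut_kernel C k u v)"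
  proof eventually_elim
    case (elim u)
    show ?case
    proof (cases "u \<in> dcell M x")
      case True
      then have "u \<in> C" using dcell_subset_dcube[OF x] by blast
      then have "K (cell_fun N y) u = (LINT v:C|lborel. k u v * cell_fun N y v)" using elim by blast
      also have "\<dots> = (LINT v|lborel. cell_fun N y v * cut_kernel C k u v)"
        unfolding set_lebesgue_integral_def
        by (rule Bochner_Integration.integral_cong) (use \<open>u \<in> C\<close> in \<open>auto simp: cut_kernel_def indicator_def\<close>)
      finally show ?thesis by (simp add: cnj_cell_fun mult.commute)
    qed (simp add: cell_fun_def)
  qed
  have m: "(\<lambda>u. LINT v|lborel. cell_fun N y v * cut_kernel C k u v) \<in> borel_measurable lborel"
    by (rule lborel.borel_measurable_lebesgue_integral)
       (use cut_kernel_measurable[OF k_measurable, of C] in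
         \<open>simp add: case_prod_beta' cell_fun_def cong: measurable_cong_sets\<close>)
  have mf: "cell_fun M x \<in> borel_measurable lborel" for M x using L2_measurable[OF cell_fun_L2] by simp
  have mK: "K (cell_fun N y) \<in> borel_measurable lborel"
    using L2_measurable[OF op_L2[OF operator_props(1,2) cell_fun_L2]] by simp
  show ?thesis
    unfolding L2_inner_def
    by (rule integral_cong_AE[OF _ _ ae])
       (intro borel_measurable_times borel_measurable_cnj mK mf m)+
qed

text \<open>The row of the kernel at \<open>u\<close>, averaged over the cell of \<open>u\<close>: a
  substitute for \<open>k u u\<close> that does not depend on the kernel at the single point
  \<open>v = u\<close>.\<close>

definition cell_row :: "nat \<Rightarrow> 'a \<Rightarrow> complex" where
  "cell_row N u = (LINT v|lborel. cell_fun N u v * h (u, v))"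

lemma cell_fun_h_integrable: "integrable (lborel \<Otimes>\<^sub>M lborel) (\<lambda>z. cell_fun N (fst z) (snd z) * h z)"
proof (rule Bochner_Integration.integrable_bound)
  show "integrable (lborel \<Otimes>\<^sub>M lborel) (\<lambda>z. (1 / cvol TYPE('a) N) *\<^sub>R h z)"
    using h_integrable by simp
  show "(\<lambda>z. cell_fun N (fst z) (snd z) * h z) \<in> borel_measurable (lborel \<Otimes>\<^sub>M lborel)"
    using borel_measurable_integrable[OF h_integrable] unfolding cell_fun_def by measurable
  show "AE z in lborel \<Otimes>\<^sub>M lborel. norm (cell_fun N (fst z) (snd z) * h z) \<le> norm ((1 / cvol TYPE('a) N) *\<^sub>R h z)"
    by (rule AE_I2) (auto simp: cell_fun_def norm_mult norm_divide indicator_def)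
qed

lemma cell_row_integrable: "integrable lborel (cell_row N)"
proof -
  have "integrable (lborel \<Otimes>\<^sub>M lborel) (\<lambda>(u, v). cell_fun N u v * h (u, v))"
    using cell_fun_h_integrable by (simp add: case_prod_beta')
  from lborel_pair.integrable_fst[OF this] show ?thesis
    unfolding cell_row_def[abs_def] .
qed

lemma cell_row_outside: "u \<notin> C \<Longrightarrow> cell_row N u = 0"
  by (simp add: cell_row_def h_def cut_kernel_def)

text \<open>A level-\<open>M\<close> cell lies in a single level-\<open>N\<close> cell, so
  \<open>cell_fun N\<close> is the same at all its points and one of the two averages is
  \<open>cell_row N\<close>. This covers the diagonal of the averaged kernel (\<open>M = N\<close>)
  as well as the mixed term of two levels; the integral of the right-hand side over \<open>x\<close>
  does not depend on \<open>M\<close>.\<close>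

lemma form_cell_fun_diag:
  assumes x: "x \<in> C" and NM: "N \<le> M"
  shows "L2_inner (K (cell_fun N x)) (cell_fun M x) = cell_avg M (cell_row N) x"
proof -
  have "L2_inner (K (cell_fun N x)) (cell_fun M x) =
    (LINT u|lborel. (1 / cvol TYPE('a) M) *\<^sub>R (indicator (dcell M x) u *\<^sub>R cell_row N u))"
    unfolding form_cell_fun[OF x x]
  proof (rule Bochner_Integration.integral_cong[OF refl])
    fix u
    show "cell_fun M x u * (LINT v|lborel. cell_fun N x v * cut_kernel C k u v)
      = (1 / cvol TYPE('a) M) *\<^sub>R (indicator (dcell M x) u *\<^sub>R cell_row N u)"
    proof (cases "u \<in> dcell M x")
      case True
      then have "dcell N u = dcell N x" using dcell_antimono[OF NM] dcell_eq by blast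
      then have "cell_fun N u = cell_fun N x" by (simp add: cell_fun_def fun_eq_iff)
      then show ?thesis using True by (simp add: cell_row_def h_def cell_fun_def scaleR_conv_of_real)
    qed (simp add: cell_fun_def)
  qed
  then show ?thesis by (simp only: cell_avg_def Bochner_Integration.integral_scaleR_right)
qed

definition g :: "nat \<Rightarrow> 'a \<Rightarrow> 'a \<Rightarrow> complex" where
  "g N x y = cell_avg N h (x, y)"

lemma h_integrable': "integrable lborel h"
  using h_integrable by (simp add: lborel_prod)

lemma g_measurable: "case_prod (g N) \<in> borel_measurable (borel \<Otimes>\<^sub>M borel)"
proof -
  have "h \<in> borel_measurable borel" using h_measurable by (simp add: borel_prod)
  then have "cell_avg N h \<in> borel_measurable (borel \<Otimes>\<^sub>M borel)"
    by (simp add: borel_prod cell_avg_measurable)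
  then show ?thesis by (simp add: g_def case_prod_beta')
qed

text \<open>Fubini splits the average over a product cell into two normalised cell functions. The
  second kernel variable is the one integrated by \<open>K\<close>, whence the order of
  \<open>y\<close> and \<open>x\<close>.\<close>

lemma g_eq_form:
  assumes x: "x \<in> C" and y: "y \<in> C"
  shows "g N x y = L2_inner (K (cell_fun N y)) (cell_fun N x)"
proof -
  let ?v = "cvol TYPE('a) N"
  have "integrable (lborel \<Otimes>\<^sub>M lborel) (\<lambda>z. indicator (dcell N (x, y)) z *\<^sub>R h z)"
    using integrable_on_dcell[OF h_integrable', of N "(x, y)"] by (simp add: lborel_prod)
  then have i: "integrable (lborel \<Otimes>\<^sub>M lborel) (\<lambda>(u, v). indicator (dcell N (x, y)) (u, v) *\<^sub>R h (u, v))"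
    by (simp add: case_prod_beta')
  have "g N x y = (1 / ?v\<^sup>2) *\<^sub>R (LINT z|(lborel \<Otimes>\<^sub>M lborel). (case z of (u, v) \<Rightarrow> indicator (dcell N (x, y)) (u, v) *\<^sub>R h (u, v)))"
    by (simp add: g_def cell_avg_def lborel_prod cvol_prod case_prod_beta')
  also have "(LINT z|(lborel \<Otimes>\<^sub>M lborel). (case z of (u, v) \<Rightarrow> indicator (dcell N (x, y)) (u, v) *\<^sub>R h (u, v)))
    = (LINT u|lborel. LINT v|lborel. indicator (dcell N (x, y)) (u, v) *\<^sub>R h (u, v))"
    by (rule lborel_pair.integral_fst[OF i, symmetric])
  also have "(1 / ?v\<^sup>2) *\<^sub>R \<dots> = (LINT u|lborel. LINT v|lborel. (1 / ?v\<^sup>2) *\<^sub>R indicator (dcell N (x, y)) (u, v) *\<^sub>R h (u, v))"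
    by (simp only: Bochner_Integration.integral_scaleR_right)
  also have "\<dots> = (LINT u|lborel. LINT v|lborel. cell_fun N x u * (cell_fun N y v * cut_kernel C k u v))"
    by (intro Bochner_Integration.integral_cong refl)
       (auto simp: dcell_Pair cell_fun_def h_def indicator_def scaleR_conv_of_real power2_eq_square)
  also have "\<dots> = L2_inner (K (cell_fun N y)) (cell_fun N x)"
    unfolding form_cell_fun[OF x y] by simp
  finally show ?thesis .
qed

lemma g_outside: "x \<notin> C \<or> y \<notin> C \<Longrightarrow> g N x y = 0"
proof -
  assume "x \<notin> C \<or> y \<notin> C"
  then have "indicator (dcell N (x, y)) z *\<^sub>R h z = 0" for z
    using dcell_dcube_iff[of "fst z" N x R] dcell_dcube_iff[of "snd z" N y R]
    by (cases z) (auto simp: dcell_Pair h_def cut_kernel_def indicator_def)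
  then show ?thesis by (simp only: g_def cell_avg_def) simp
qed

lemma g_diag: "g N x x = cell_avg N (cell_row N) x"
proof (cases "x \<in> C")
  case True
  then show ?thesis by (simp add: g_eq_form form_cell_fun_diag)
next
  case False
  then have "indicator (dcell N x) y *\<^sub>R cell_row N y = 0" for y
    using dcell_dcube_iff[of y N x R] cell_row_outside[of y N] by (auto simp: indicator_def)
  then have "cell_avg N (cell_row N) x = 0" by (simp only: cell_avg_def) simp
  then show ?thesis using False by (simp add: g_outside)
qed

text \<open>By \<open>determinantal_kernel\<close>, the number \<open>t\<close> below is the trace
  of the compression of \<open>K\<close> to the cube; \<open>tN\<close> is its counterpart for the
  averaged kernel.\<close>

definition tN :: "nat \<Rightarrow> complex" where "tN N = (LINT u|lborel. cell_row N u)"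
definition t :: complex where "t = (LINT x|lborel. indicator C x * k x x)"

lemma g_diag_integrable: "integrable lborel (\<lambda>x. g N x x)"
  and g_diag_integral: "(LINT x|lborel. g N x x) = tN N"
  by (simp_all add: g_diag integrable_cell_avg cell_row_integrable cell_avg_integral tN_def)

end

text \<open>The set contains all differences of two points of a level-\<open>N\<close> cell and is
  twice as wide as a cell, whence the factor \<open>2 ^ DIM('a)\<close>.\<close>

lemma cube_shift_measure:
  "emeasure lborel {w :: 'a::euclidean_space. \<forall>b\<in>Basis. \<bar>w \<bullet> b\<bar> < 1 / 2 ^ N} \<le> ennreal (2 ^ DIM('a) * cvol TYPE('a) N)"
proof -
  let ?c = "(1 / 2 ^ N :: real) *\<^sub>R (One :: 'a)"
  have "{w :: 'a. \<forall>b\<in>Basis. \<bar>w \<bullet> b\<bar> < 1 / 2 ^ N} \<subseteq> cbox (- ?c) ?c"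
  proof
    fix w :: 'a assume w: "w \<in> {w. \<forall>b\<in>Basis. \<bar>w \<bullet> b\<bar> < 1 / 2 ^ N}"
    show "w \<in> cbox (- ?c) ?c"
      unfolding mem_box
    proof
      fix b :: 'a assume b: "b \<in> Basis"
      then have "\<bar>w \<bullet> b\<bar> < 1 / 2 ^ N" using w by blast
      moreover have "?c \<bullet> b = 1 / 2 ^ N" using b by simp
      ultimately show "(- ?c) \<bullet> b \<le> w \<bullet> b \<and> w \<bullet> b \<le> ?c \<bullet> b"
        unfolding inner_minus_left by linarith
    qed
  qed
  then have "emeasure lborel {w :: 'a. \<forall>b\<in>Basis. \<bar>w \<bullet> b\<bar> < 1 / 2 ^ N} \<le> emeasure lborel (cbox (- ?c) ?c)"
    by (rule emeasure_mono) simp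
  also have "\<dots> = ennreal (\<Prod>b\<in>Basis. (?c - - ?c) \<bullet> b)"
    by (subst emeasure_lborel_cbox) simp_all
  also have "(\<Prod>b\<in>Basis. (?c - - ?c) \<bullet> b) = (\<Prod>b\<in>(Basis :: 'a set). 2 * (1 / 2 ^ N))"
    by (rule prod.cong) (simp_all add: inner_add_left)
  also have "\<dots> = 2 ^ DIM('a) * cvol TYPE('a) N"
    by (simp add: cvol_def power_divide)
  finally show ?thesis .
qed

section \<open>Averages near the diagonal and convergence of the traces\<close>

context det_kernel
begin

lemma integral_cell_fun: "(LINT v|lborel. cell_fun N u v * c) = c" "integrable lborel (\<lambda>v. cell_fun N u v * c)"
proof -
  have "integrable lborel (\<lambda>v. indicator (dcell N u) v *\<^sub>R (complex_of_real (1 / cvol TYPE('a) N) * c))"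
    by (simp add: emeasure_dcell)
  moreover have eq: "indicator (dcell N u) v *\<^sub>R (complex_of_real (1 / cvol TYPE('a) N) * c) = cell_fun N u v * c" for v
    by (simp add: cell_fun_def indicator_def)
  ultimately show "integrable lborel (\<lambda>v. cell_fun N u v * c)" by simp
  have "(LINT v|lborel. indicator (dcell N u) v *\<^sub>R (complex_of_real (1 / cvol TYPE('a) N) * c)) = c"
    using cvol_pos[where ?'a='a, of N]
    by (subst Bochner_Integration.integral_scaleR_left) (simp_all add: emeasure_dcell measure_dcell scaleR_conv_of_real)
  then show "(LINT v|lborel. cell_fun N u v * c) = c" unfolding eq .
qed

definition modulus :: "'a \<Rightarrow> real" where
  "modulus w = (LINT x|lborel. indicator C x * cmod (shifted w x - shifted 0 x))"

text \<open>A cell function has integral 1, so \<open>k u u\<close> may be subtracted inside the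
  average over the cell of \<open>u\<close>. Along the parallel to the diagonal at shift
  \<open>w\<close> the error is at most \<open>modulus w\<close> divided by the cell volume, while
  the shifts that occur fill at most \<open>2 ^ DIM('a)\<close> cell volumes; the volume
  cancels.\<close>

lemma cell_trace_error:
  assumes \<epsilon>: "\<And>w. norm w < \<delta> \<Longrightarrow> modulus w \<le> \<epsilon>" and \<delta>: "DIM('a) / 2 ^ N < \<delta>" and \<epsilon>0: "0 \<le> \<epsilon>"
  shows "cmod (tN N - t) \<le> \<epsilon> * 2 ^ DIM('a)"
proof -
  let ?v = "cvol TYPE('a) N"
  let ?D = "{w :: 'a. \<forall>b\<in>Basis. \<bar>w \<bullet> b\<bar> < 1 / 2 ^ N}"
  have [measurable]: "?D \<in> sets borel"
  proof -
    have "?D = {w \<in> space borel. \<forall>b\<in>Basis. \<bar>w \<bullet> b\<bar> < 1 / 2 ^ N}" by simp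
    also have "\<dots> \<in> sets borel" by measurable
    finally show ?thesis .
  qed
  define err where "err u v = cell_fun N u v * (h (u, v) - indicator C u * k u u)" for u v
  have mh: "(\<lambda>z. h (f z, g z)) \<in> borel_measurable M" if "f \<in> M \<rightarrow>\<^sub>M borel" "g \<in> M \<rightarrow>\<^sub>M borel" for f g and M :: "'z measure"
    using measurable_compose[OF measurable_Pair[OF that] h_measurable] .
  have merr: "case_prod err \<in> borel_measurable (borel \<Otimes>\<^sub>M borel)"
    unfolding case_prod_beta' err_def cell_fun_def
    by (intro borel_measurable_times borel_measurable_diff mh k_measurable'; measurable)
  from lborel_pair.AE_integrable_fst'[OF cell_fun_h_integrable]
  have row: "AE u in lborel. integrable lborel (\<lambda>v. cell_fun N u v * h (u, v))" by simp
  have "ennreal (cmod (tN N - t)) = ennreal (cmod (LINT u|lborel. cell_row N u - indicator C u * k u u))"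
    using cell_row_integrable[of N] diag_integrable by (simp add: tN_def t_def)
  also have "\<dots> \<le> (\<integral>\<^sup>+u. cmod (cell_row N u - indicator C u * k u u) \<partial>lborel)"
    by (rule integral_norm_bound_ennreal) (use cell_row_integrable[of N] diag_integrable in simp)
  also have "\<dots> \<le> (\<integral>\<^sup>+u. (\<integral>\<^sup>+v. cmod (err u v) \<partial>lborel) \<partial>lborel)"
  proof (rule nn_integral_mono_AE, use row in eventually_elim)
    fix u assume row: "integrable lborel (\<lambda>v. cell_fun N u v * h (u, v))"
    have i: "integrable lborel (err u)"
      unfolding err_def using row integral_cell_fun(2)[of N u "indicator C u * k u u"]
      by (simp add: right_diff_distrib)
    have "cell_row N u - indicator C u * k u u = (LINT v|lborel. err u v)"
      unfolding err_def cell_row_def using row integral_cell_fun[of N u "indicator C u * k u u"]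
      by (simp add: right_diff_distrib)
    then show "ennreal (cmod (cell_row N u - indicator C u * k u u)) \<le> (\<integral>\<^sup>+v. cmod (err u v) \<partial>lborel)"
      using integral_norm_bound_ennreal[OF i] by simp
  qed
  also have "\<dots> = (\<integral>\<^sup>+w. (\<integral>\<^sup>+u. cmod (err u (u + w)) \<partial>lborel) \<partial>lborel)"
    by (rule nn_integral_diagonal_shift) (use merr in \<open>simp add: case_prod_beta'\<close>)
  also have "\<dots> \<le> (\<integral>\<^sup>+w. ennreal (\<epsilon> / ?v) * indicator ?D w \<partial>lborel)"
  proof (rule nn_integral_mono)
    fix w :: 'a
    show "(\<integral>\<^sup>+u. cmod (err u (u + w)) \<partial>lborel) \<le> ennreal (\<epsilon> / ?v) * indicator ?D w"
    proof (cases "w \<in> ?D")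
      case False
      have "err u (u + w) = 0" for u
      proof -
        have "u + w \<notin> dcell N u"
          using dcell_coord[of "u + w" N u] False by auto
        then show ?thesis by (simp add: err_def cell_fun_def)
      qed
      then show ?thesis by simp
    next
      case True
      have "norm w \<le> (\<Sum>b\<in>Basis. \<bar>w \<bullet> b\<bar>)" by (rule norm_le_l1)
      also have "\<dots> \<le> (\<Sum>b\<in>(Basis::'a set). 1 / 2 ^ N)"
        by (rule sum_mono) (use True in \<open>auto intro: less_imp_le\<close>)
      finally have "norm w < \<delta>" using \<delta> by simp
      have i: "integrable lborel (\<lambda>x. indicator C x * cmod (shifted w x - shifted 0 x))"
      proof -
        have "integrable lborel (\<lambda>x. norm (indicator C x *\<^sub>R shifted w x - indicator C x *\<^sub>R shifted 0 x))"
          using shifted_integrable by simp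
        then show ?thesis by (simp flip: scaleR_diff_right)
      qed
      have "(\<integral>\<^sup>+u. cmod (err u (u + w)) \<partial>lborel) \<le> (\<integral>\<^sup>+u. ennreal (1 / ?v) * ennreal (indicator C u * cmod (shifted w u - shifted 0 u)) \<partial>lborel)"
      proof (rule nn_integral_mono)
        fix u
        have "cmod (err u (u + w)) \<le> 1 / ?v * (indicator C u * cmod (shifted w u - shifted 0 u))"
        proof (cases "u \<in> C \<and> u + w \<in> dcell N u")
          case True
          then have "u + w \<in> C" using dcell_subset_dcube by blast
          then show ?thesis
            using True cvol_pos[where ?'a='a, of N]
            by (simp add: err_def h_def cut_kernel_def shifted_def cell_fun_def norm_mult norm_divide)
        next
          case False
          then have "err u (u + w) = 0" by (auto simp: err_def h_def cut_kernel_def cell_fun_def)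
          then show ?thesis using cvol_pos[where ?'a='a, of N] by simp
        qed
        then show "ennreal (cmod (err u (u + w))) \<le> ennreal (1 / ?v) * ennreal (indicator C u * cmod (shifted w u - shifted 0 u))"
          using cvol_pos[where ?'a='a, of N] by (simp flip: ennreal_mult)
      qed
      also have "\<dots> = ennreal (1 / ?v) * (\<integral>\<^sup>+u. ennreal (indicator C u * cmod (shifted w u - shifted 0 u)) \<partial>lborel)"
        using borel_measurable_integrable[OF i] by (intro nn_integral_cmult) simp
      also have "(\<integral>\<^sup>+u. ennreal (indicator C u * cmod (shifted w u - shifted 0 u)) \<partial>lborel) = ennreal (modulus w)"
        unfolding modulus_def by (rule nn_integral_eq_integral[OF i]) simp
      also have "ennreal (1 / ?v) * ennreal (modulus w) \<le> ennreal (1 / ?v) * ennreal \<epsilon>"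
        by (intro mult_left_mono ennreal_leI \<epsilon> \<open>norm w < \<delta>\<close>) simp
      also have "\<dots> = ennreal (\<epsilon> / ?v)"
        using cvol_pos[where ?'a='a, of N] \<epsilon>0 by (simp flip: ennreal_mult)
      finally show ?thesis using True by simp
    qed
  qed
  also have "\<dots> = ennreal (\<epsilon> / ?v) * emeasure lborel ?D"
    by (rule nn_integral_cmult_indicator) simp
  also have "\<dots> \<le> ennreal (\<epsilon> / ?v) * ennreal (2 ^ DIM('a) * ?v)"
    by (intro mult_left_mono cube_shift_measure) simp
  also have "\<dots> = ennreal (\<epsilon> * 2 ^ DIM('a))"
    using cvol_pos[where ?'a='a, of N] \<epsilon>0 by (simp flip: ennreal_mult)
  finally show ?thesis using \<epsilon>0 by (simp add: ennreal_le_iff)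
qed

lemma tN_tendsto: "tN \<longlonglongrightarrow> t"
proof (rule LIMSEQ_I)
  fix e :: real assume "0 < e"
  define \<epsilon> where "\<epsilon> = e / (2 * 2 ^ DIM('a))"
  have \<epsilon>: "0 < \<epsilon>" using \<open>0 < e\<close> by (simp add: \<epsilon>_def)
  obtain \<delta> where \<delta>: "0 < \<delta>" "\<And>w. w \<noteq> 0 \<Longrightarrow> norm w < \<delta> \<Longrightarrow> norm (modulus w) < \<epsilon>"
    using LIM_D[OF shifted_continuous[of 0] \<epsilon>] unfolding modulus_def by auto
  have mod: "modulus w \<le> \<epsilon>" if "norm w < \<delta>" for w
  \<comment> \<open>A limit at 0 says nothing about the shift 0 itself, where the modulus
    vanishes.\<close>
  proof (cases "w = 0")
    case True
    then show ?thesis using \<epsilon> by (simp add: modulus_def)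
  next
    case False
    then show ?thesis using \<delta>(2)[of w] that by simp
  qed
  have "(\<lambda>N. real DIM('a) / 2 ^ N) \<longlonglongrightarrow> 0"
    by (rule cell_diameter_tendsto_0)
  then have "eventually (\<lambda>N. real DIM('a) / 2 ^ N < \<delta>) sequentially"
    using \<delta>(1) by (rule order_tendstoD(2))
  then obtain N0 where N0: "\<And>N. N \<ge> N0 \<Longrightarrow> real DIM('a) / 2 ^ N < \<delta>"
    unfolding eventually_sequentially by blast
  have "norm (tN N - t) < e" if "N \<ge> N0" for N
  proof -
    have "cmod (tN N - t) \<le> \<epsilon> * 2 ^ DIM('a)"
      by (rule cell_trace_error[OF mod N0[OF that]]) (use \<epsilon> in simp_all)
    also have "\<dots> < e" using \<open>0 < e\<close> by (simp add: \<epsilon>_def)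
    finally show ?thesis .
  qed
  then show "\<exists>no. \<forall>n\<ge>no. norm (tN n - t) < e" by blast
qed

section \<open>Hilbert-Schmidt distance between the averages of two levels\<close>

definition G :: "nat \<Rightarrow> 'a \<Rightarrow> real" where "G N x = Re (g N x x)"
definition TN :: "nat \<Rightarrow> real" where "TN N = Re (tN N)"

lemma G_nonneg: "0 \<le> G N x"
proof (cases "x \<in> C")
  case True
  then show ?thesis using operator_props(3) cell_fun_L2 by (simp add: G_def g_eq_form nonneg_operator_def)
qed (simp add: G_def g_outside)

lemma G_integrable: "integrable lborel (G N)"
  unfolding G_def[abs_def] using g_diag_integrable[of N] by simp

lemma G_integral: "(LINT x|lborel. G N x) = TN N"
  unfolding G_def[abs_def] TN_def using g_diag_integrable[of N] by (simp flip: g_diag_integral)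

lemma TN_nonneg: "0 \<le> TN N"
  unfolding G_integral[symmetric] by (rule Bochner_Integration.integral_nonneg) (rule G_nonneg)

lemma TN_tendsto: "TN \<longlonglongrightarrow> Re t"
  unfolding TN_def[abs_def] by (rule tendsto_Re[OF tN_tendsto])

text \<open>For points of the cube and \<open>N \<le> M\<close> this is the form of \<open>K\<close>
  at the difference of the cell functions of the two levels. Written through averages of integrable
  functions, it has an explicit integral: the mixed average integrates to \<open>TN N\<close>, hence
  the whole to \<open>TN M - TN N\<close>.\<close>

definition defect :: "nat \<Rightarrow> nat \<Rightarrow> 'a \<Rightarrow> real" where
  "defect N M x = G M x + G N x - 2 * Re (cell_avg M (cell_row N) x)"

lemma defect_eq_form:
  assumes "x \<in> C" "N \<le> M"
  shows "defect N M x = Re (L2_inner (K (\<lambda>y. cell_fun M x y - cell_fun N x y)) (\<lambda>y. cell_fun M x y - cell_fun N x y))"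
proof -
  let ?p = "cell_fun M x" and ?q = "cell_fun N x"
  note L = cell_fun_L2[of M x] cell_fun_L2[of N x]
  have d: "(\<lambda>y. ?p y - ?q y) \<in> L2" by (rule L2_diff[OF L])
  have "L2_inner (K (\<lambda>y. ?p y - ?q y)) (\<lambda>y. ?p y - ?q y) = L2_inner (K ?p) (\<lambda>y. ?p y - ?q y) - L2_inner (K ?q) (\<lambda>y. ?p y - ?q y)"
    by (rule form_diff_left[OF operator_props(1,2) L d])
  also have "L2_inner (K ?p) (\<lambda>y. ?p y - ?q y) = cnj (L2_inner (K ?p) ?p - L2_inner (K ?q) ?p)"
    by (subst form_hermitian[OF operator_props(1,2) d L(1)]) (simp add: form_diff_left[OF operator_props(1,2) L L(1)])
  also have "L2_inner (K ?q) (\<lambda>y. ?p y - ?q y) = cnj (L2_inner (K ?p) ?q - L2_inner (K ?q) ?q)"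
    by (subst form_hermitian[OF operator_props(1,2) d L(2)]) (simp add: form_diff_left[OF operator_props(1,2) L L(2)])
  also have "L2_inner (K ?p) ?q = cnj (L2_inner (K ?q) ?p)" by (rule form_hermitian[OF operator_props(1,2) L(2,1)])
  finally have "Re (L2_inner (K (\<lambda>y. ?p y - ?q y)) (\<lambda>y. ?p y - ?q y))
    = Re (L2_inner (K ?p) ?p) + Re (L2_inner (K ?q) ?q) - 2 * Re (L2_inner (K ?q) ?p)"
    by simp
  then show ?thesis
    using assms by (simp add: defect_def G_def g_eq_form form_cell_fun_diag)
qed

lemma defect_nonneg: "N \<le> M \<Longrightarrow> 0 \<le> defect N M x"
proof (cases "x \<in> C")
  case True
  assume "N \<le> M"
  have "(\<lambda>y. cell_fun M x y - cell_fun N x y) \<in> L2" by (rule L2_diff) (rule cell_fun_L2)+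
  then show ?thesis
    unfolding defect_eq_form[OF True \<open>N \<le> M\<close>] using operator_props(3) by (simp add: nonneg_operator_def)
next
  case False
  then have "indicator (dcell M x) y *\<^sub>R cell_row N y = 0" for y
    using dcell_dcube_iff[of y M x R] cell_row_outside[of y N] by (auto simp: indicator_def)
  then have "cell_avg M (cell_row N) x = 0" by (simp only: cell_avg_def) simp
  then show ?thesis using False by (simp add: defect_def G_def g_outside)
qed

lemma defect_integrable: "integrable lborel (defect N M)"
  and defect_integral: "(LINT x|lborel. defect N M x) = TN M - TN N"
proof -
  have i: "integrable lborel (cell_avg M (cell_row N))"
    by (rule integrable_cell_avg[OF cell_row_integrable])
  then have i': "integrable lborel (\<lambda>x. Re (cell_avg M (cell_row N) x))" by simp
  show "integrable lborel (defect N M)"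
    unfolding defect_def[abs_def] using G_integrable i' by simp
  have "(LINT x|lborel. Re (cell_avg M (cell_row N) x)) = TN N"
    using i cell_avg_integral[OF cell_row_integrable, of M N] by (simp add: TN_def tN_def)
  then show "(LINT x|lborel. defect N M x) = TN M - TN N"
    unfolding defect_def[abs_def] using G_integrable i' by (simp add: G_integral)
qed

lemma TN_mono: "N \<le> M \<Longrightarrow> TN N \<le> TN M"
  using Bochner_Integration.integral_nonneg[of lborel "defect N M"] defect_nonneg[of N M] defect_integral[of N M] by simp

lemma TN_le: "TN N \<le> Re t"
  by (rule LIMSEQ_le_const[OF TN_tendsto]) (use TN_mono in blast)

text \<open>The arguments of the form are changed from level \<open>N\<close> to level
  \<open>M\<close> one at a time. Cauchy-Schwarz bounds each change by a defect in one variable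
  times a diagonal value in the other, a product that integrates separately.\<close>

lemma g_diff_pointwise:
  assumes NM: "N \<le> M"
  shows "(cmod (g M x y - g N x y))\<^sup>2 \<le> 2 * (defect N M y * G M x) + 2 * (G N y * defect N M x)"
proof (cases "x \<in> C \<and> y \<in> C")
  case False
  then have "g M x y - g N x y = 0" by (auto simp: g_outside)
  then show ?thesis using defect_nonneg[OF NM] G_nonneg by simp
next
  case True
  let ?d = "\<lambda>x y. cell_fun M x y - cell_fun N x y"
  have d: "?d x \<in> L2" for x by (rule L2_diff) (rule cell_fun_L2)+
  let ?a = "L2_inner (K (?d y)) (cell_fun M x)" and ?b = "L2_inner (K (cell_fun N y)) (?d x)"
  have "?b = cnj (L2_inner (K (cell_fun M x)) (cell_fun N y) - L2_inner (K (cell_fun N x)) (cell_fun N y))"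
    by (subst form_hermitian[OF operator_props(1,2) d cell_fun_L2]) (simp add: form_diff_left[OF operator_props(1,2)] cell_fun_L2)
  also have "\<dots> = L2_inner (K (cell_fun N y)) (cell_fun M x) - L2_inner (K (cell_fun N y)) (cell_fun N x)"
    using form_hermitian[OF operator_props(1,2) cell_fun_L2[of M x] cell_fun_L2[of N y]] form_hermitian[OF operator_props(1,2) cell_fun_L2[of N x] cell_fun_L2[of N y]]
    by simp
  finally have b: "?b = L2_inner (K (cell_fun N y)) (cell_fun M x) - L2_inner (K (cell_fun N y)) (cell_fun N x)" .
  have "?a = L2_inner (K (cell_fun M y)) (cell_fun M x) - L2_inner (K (cell_fun N y)) (cell_fun M x)"
    by (rule form_diff_left[OF operator_props(1,2)]) (rule cell_fun_L2)+
  then have "g M x y - g N x y = ?a + ?b"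
    using True b by (simp add: g_eq_form)
  then have "(cmod (g M x y - g N x y))\<^sup>2 \<le> (cmod ?a + cmod ?b)\<^sup>2"
    by (simp add: norm_triangle_ineq power_mono)
  also have "\<dots> \<le> 2 * (cmod ?a)\<^sup>2 + 2 * (cmod ?b)\<^sup>2"
    using sum_squares_bound[of "cmod ?a" "cmod ?b"] by (simp add: power2_sum)
  also have "(cmod ?a)\<^sup>2 \<le> defect N M y * G M x"
    using form_cauchy_schwarz[OF operator_props d cell_fun_L2] True by (simp add: defect_eq_form NM G_def g_eq_form)
  also have "(cmod ?b)\<^sup>2 \<le> G N y * defect N M x"
    using form_cauchy_schwarz[OF operator_props cell_fun_L2 d] True by (simp add: defect_eq_form NM G_def g_eq_form)
  finally show ?thesis by simp
qed

lemma g_diff_hs: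
  assumes NM: "N \<le> M"
  shows "hs_sq (\<lambda>x y. g M x y - g N x y) \<le> ennreal (2 * (TN M - TN N) * (TN M + TN N))"
proof -
  have "hs_sq (\<lambda>x y. g M x y - g N x y) \<le> (\<integral>\<^sup>+x. (\<integral>\<^sup>+y. ennreal (2 * (defect N M y * G M x) + 2 * (G N y * defect N M x)) \<partial>lborel) \<partial>lborel)"
    unfolding hs_sq_def by (intro nn_integral_mono ennreal_leI g_diff_pointwise[OF NM])
  also have "\<dots> = (\<integral>\<^sup>+x. ennreal (2 * ((TN M - TN N) * G M x) + 2 * (TN N * defect N M x)) \<partial>lborel)"
  proof (rule nn_integral_cong)
    fix x
    have "(\<integral>\<^sup>+y. ennreal (2 * (defect N M y * G M x) + 2 * (G N y * defect N M x)) \<partial>lborel)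
      = ennreal (LINT y|lborel. 2 * (defect N M y * G M x) + 2 * (G N y * defect N M x))"
      by (rule nn_integral_eq_integral) (use defect_integrable G_integrable defect_nonneg[OF NM] G_nonneg in auto)
    also have "(LINT y|lborel. 2 * (defect N M y * G M x) + 2 * (G N y * defect N M x)) = 2 * ((TN M - TN N) * G M x) + 2 * (TN N * defect N M x)"
      using defect_integrable G_integrable by (simp add: defect_integral G_integral)
    finally show "(\<integral>\<^sup>+y. ennreal (2 * (defect N M y * G M x) + 2 * (G N y * defect N M x)) \<partial>lborel)
      = ennreal (2 * ((TN M - TN N) * G M x) + 2 * (TN N * defect N M x))" .
  qed
  also have "\<dots> = ennreal (LINT x|lborel. 2 * ((TN M - TN N) * G M x) + 2 * (TN N * defect N M x))"
    by (rule nn_integral_eq_integral)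
       (use defect_integrable G_integrable defect_nonneg[OF NM] G_nonneg TN_mono[OF NM] TN_nonneg in auto)
  also have "(LINT x|lborel. 2 * ((TN M - TN N) * G M x) + 2 * (TN N * defect N M x)) = 2 * ((TN M - TN N) * TN M) + 2 * (TN N * (TN M - TN N))"
    using defect_integrable G_integrable by (simp add: defect_integral G_integral)
  also have "\<dots> = 2 * (TN M - TN N) * (TN M + TN N)" by (simp add: algebra_simps)
  finally show ?thesis .
qed

lemma hs_sq_eq_pair:
  assumes "case_prod u \<in> borel_measurable (borel \<Otimes>\<^sub>M borel)"
  shows "hs_sq u = (\<integral>\<^sup>+z. ennreal ((cmod (u (fst z) (snd z)))\<^sup>2) \<partial>(lborel :: ('a \<times> 'a) measure))"
proof -
  have "(\<lambda>z. ennreal ((cmod (u (fst z) (snd z)))\<^sup>2)) \<in> borel_measurable (lborel \<Otimes>\<^sub>M lborel)"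
    using assms by (simp add: case_prod_beta' cong: measurable_cong_sets)
  from lborel.nn_integral_fst[OF this] show ?thesis by (simp add: hs_sq_def lborel_prod)
qed

lemma cut_k_eq_h: "cut_kernel C k x y = h (x, y)"
  by (simp add: h_def)

theorem kernel_minus_g_hs:
  "hs_sq (\<lambda>x y. cut_kernel C k x y - g N x y) \<le> ennreal (2 * (Re t - TN N) * (Re t + TN N))"
proof -
  define avg where "avg M = cell_avg M h" for M
  have i: "integrable lborel (\<lambda>z. avg M z - h z)" for M
    unfolding avg_def by (intro Bochner_Integration.integrable_diff integrable_cell_avg h_integrable')
  have out: "z \<notin> dcube R \<Longrightarrow> avg M z - h z = 0" for M z
  proof -
    assume "z \<notin> dcube R"
    then have "fst z \<notin> C \<or> snd z \<notin> C" by (cases z) (simp add: dcube_Pair[where 'a='a])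
    then show ?thesis using g_outside[of "fst z" "snd z" M]
      by (auto simp: avg_def g_def h_def cut_kernel_def)
  qed
  \<comment> \<open>Both functions vanish off the cube of \<open>E x E\<close>, so convergence on
    that cube is L^1 convergence on the whole space, which yields a subsequence converging almost
    everywhere.\<close>
  have "(LINT z|lborel. norm (avg M z - h z)) = cell_dev R M h" for M
    unfolding cell_dev_def avg_def[symmetric]
    by (rule Bochner_Integration.integral_cong) (use out in \<open>auto simp: indicator_def\<close>)
  then have "(\<lambda>M. LINT z|lborel. norm (avg M z - h z)) \<longlonglongrightarrow> 0"
    using cell_avg_tendsto_L1[OF h_integrable', of R] by simp
  then obtain r where r: "strict_mono r" "AE z in lborel. (\<lambda>M. avg (r M) z - h z) \<longlonglongrightarrow> 0"
    using tendsto_L1_AE_subseq[of lborel "\<lambda>M z. avg M z - h z"] i by auto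
  have mg: "case_prod (\<lambda>x y. g M x y - g N x y) \<in> borel_measurable (borel \<Otimes>\<^sub>M borel)" for M
    using g_measurable[of M] g_measurable[of N] by (simp add: case_prod_beta')
  have mk: "case_prod (\<lambda>x y. cut_kernel C k x y - g N x y) \<in> borel_measurable (borel \<Otimes>\<^sub>M borel)"
    using cut_kernel_measurable[OF k_measurable, of C] g_measurable[of N] by (simp add: case_prod_beta')
  have mF: "(\<lambda>z. ennreal ((cmod (avg M z - avg N z))\<^sup>2)) \<in> borel_measurable lborel" for M
    using borel_measurable_integrable[OF integrable_cell_avg[OF h_integrable']] by (simp add: avg_def)
  have "hs_sq (\<lambda>x y. cut_kernel C k x y - g N x y) = (\<integral>\<^sup>+z. ennreal ((cmod (h z - avg N z))\<^sup>2) \<partial>lborel)"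
    unfolding hs_sq_eq_pair[OF mk] by (simp add: cut_k_eq_h avg_def g_def)
  also have "\<dots> = (\<integral>\<^sup>+z. liminf (\<lambda>M. ennreal ((cmod (avg (r M) z - avg N z))\<^sup>2)) \<partial>lborel)"
  proof (rule nn_integral_cong_AE, use r(2) in eventually_elim)
    fix z assume "(\<lambda>M. avg (r M) z - h z) \<longlonglongrightarrow> 0"
    then have "(\<lambda>M. avg (r M) z) \<longlonglongrightarrow> h z" by (rule LIM_zero_cancel)
    then have "(\<lambda>M. ennreal ((cmod (avg (r M) z - avg N z))\<^sup>2)) \<longlonglongrightarrow> ennreal ((cmod (h z - avg N z))\<^sup>2)"
      by (intro tendsto_ennrealI tendsto_power tendsto_norm tendsto_diff tendsto_const)
    then show "ennreal ((cmod (h z - avg N z))\<^sup>2) = liminf (\<lambda>M. ennreal ((cmod (avg (r M) z - avg N z))\<^sup>2))"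
      using lim_imp_Liminf[OF sequentially_bot] by metis
  qed
  also have "\<dots> \<le> liminf (\<lambda>M. (\<integral>\<^sup>+z. ennreal ((cmod (avg (r M) z - avg N z))\<^sup>2) \<partial>lborel))"
    by (rule nn_integral_liminf) (rule mF)
  also have "\<dots> = liminf (\<lambda>M. hs_sq (\<lambda>x y. g (r M) x y - g N x y))"
    unfolding hs_sq_eq_pair[OF mg] by (simp add: avg_def g_def)
  also have "\<dots> \<le> liminf (\<lambda>M. ennreal (2 * (TN (r M) - TN N) * (TN (r M) + TN N)))"
  proof (rule Liminf_mono)
    have "eventually (\<lambda>M. N \<le> M) sequentially" by (rule eventually_ge_at_top)
    then show "\<forall>\<^sub>F M in sequentially. hs_sq (\<lambda>x y. g (r M) x y - g N x y) \<le> ennreal (2 * (TN (r M) - TN N) * (TN (r M) + TN N))"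
    proof eventually_elim
      case (elim M)
      then have "N \<le> r M" using seq_suble[OF r(1), of M] by simp
      then show ?case by (rule g_diff_hs)
    qed
  qed
  also have "\<dots> = ennreal (2 * (Re t - TN N) * (Re t + TN N))"
  proof (rule lim_imp_Liminf)
    have "(\<lambda>M. TN (r M)) \<longlonglongrightarrow> Re t"
      using LIMSEQ_subseq_LIMSEQ[OF TN_tendsto r(1)] by (simp add: comp_def)
    then show "(\<lambda>M. ennreal (2 * (TN (r M) - TN N) * (TN (r M) + TN N))) \<longlonglongrightarrow> ennreal (2 * (Re t - TN N) * (Re t + TN N))"
      by (intro tendsto_ennrealI tendsto_intros)
  qed simp
  finally show ?thesis .
qed

text \<open>A Gram matrix of the form of \<open>K\<close>: its quadratic form at \<open>c\<close> is
  the form of \<open>K\<close> at the combination of the functions \<open>cell_fun N (x j)\<close>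
  with coefficients \<open>c j\<close>. The points may share cells or coincide.\<close>

lemma g_hermitian_psd:
  assumes x: "\<And>i. i < m \<Longrightarrow> x i \<in> C"
  shows "hermitian_psd m (\<lambda>i j. g N (x i) (x j))"
  unfolding hermitian_psd_def
proof (intro conjI allI impI)
  fix i j assume ij: "i < m" "j < m"
  show "g N (x j) (x i) = cnj (g N (x i) (x j))"
    unfolding g_eq_form[OF x[OF ij(1)] x[OF ij(2)]] g_eq_form[OF x[OF ij(2)] x[OF ij(1)]]
    by (rule form_hermitian[OF operator_props(1,2) cell_fun_L2 cell_fun_L2])
next
  fix c :: "nat \<Rightarrow> complex"
  let ?f = "\<lambda>y. \<Sum>j<m. c j * cell_fun N (x j) y"
  have L: "(\<lambda>y. c j * cell_fun N (x j) y) \<in> L2" for j by (rule L2_cmult[OF cell_fun_L2])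
  have f: "?f \<in> L2" by (rule L2_sum) (simp_all add: L)
  have "L2_inner (K ?f) ?f = (\<Sum>i<m. L2_inner (K ?f) (\<lambda>y. c i * cell_fun N (x i) y))"
    by (rule form_sum_right[OF operator_props(1,2)]) (simp_all add: L f)
  also have "\<dots> = (\<Sum>i<m. \<Sum>j<m. cnj (c i) * g N (x i) (x j) * c j)"
  proof (rule sum.cong[OF refl])
    fix i assume i: "i \<in> {..<m}"
    have "L2_inner (K ?f) (\<lambda>y. c i * cell_fun N (x i) y) = cnj (c i) * L2_inner (K ?f) (cell_fun N (x i))"
      by (rule L2_inner_cmult_right)
    also have "L2_inner (K ?f) (cell_fun N (x i)) = (\<Sum>j<m. L2_inner (K (\<lambda>y. c j * cell_fun N (x j) y)) (cell_fun N (x i)))"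
      by (rule form_sum_left[OF operator_props(1,2)]) (simp_all add: L cell_fun_L2)
    also have "\<dots> = (\<Sum>j<m. c j * g N (x i) (x j))"
      by (rule sum.cong[OF refl]) (use x i in \<open>simp add: form_cmult_left[OF operator_props(1,2) cell_fun_L2 cell_fun_L2] g_eq_form\<close>)
    finally show "L2_inner (K ?f) (\<lambda>y. c i * cell_fun N (x i) y) = (\<Sum>j<m. cnj (c i) * g N (x i) (x j) * c j)"
      by (simp add: sum_distrib_left mult_ac)
  qed
  finally have "L2_inner (K ?f) ?f = (\<Sum>i<m. \<Sum>j<m. cnj (c i) * g N (x i) (x j) * c j)" .
  moreover have "0 \<le> Re (L2_inner (K ?f) ?f)" using operator_props(3) f by (simp add: nonneg_operator_def)
  ultimately show "0 \<le> Re (\<Sum>i<m. \<Sum>j<m. cnj (c i) * g N (x i) (x j) * c j)" by (simp only:)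
qed

end

section \<open>Finiteness of the norms and the bound on moments\<close>

lemma norm_integral_le:
  fixes f :: "'a \<Rightarrow> 'b::{banach, second_countable_topology}"
  assumes "integrable M f" "integrable M g" "\<And>x. norm (f x) \<le> g x"
  shows "norm (integral\<^sup>L M f) \<le> integral\<^sup>L M g"
  by (rule order_trans[OF integral_norm_bound integral_mono]) (use assms in auto)

context det_kernel
begin

lemma g_hs_finite: "hs_sq (g N) < \<infinity>"
proof -
  have "hs_sq (g N) \<le> (\<integral>\<^sup>+x. (\<integral>\<^sup>+y. ennreal (G N y * G N x) \<partial>lborel) \<partial>lborel)"
    unfolding hs_sq_def
  proof (intro nn_integral_mono ennreal_leI)
    fix x y
    show "(cmod (g N x y))\<^sup>2 \<le> G N y * G N x"
    proof (cases "x \<in> C \<and> y \<in> C")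
      case True
      then show ?thesis using form_cauchy_schwarz[OF operator_props cell_fun_L2[of N y] cell_fun_L2[of N x]] by (simp add: G_def g_eq_form)
    next
      case False
      then have "g N x y = 0" by (auto simp: g_outside)
      then show ?thesis using G_nonneg by simp
    qed
  qed
  also have "\<dots> = (\<integral>\<^sup>+x. (\<integral>\<^sup>+y. ennreal (G N y) \<partial>lborel) * ennreal (G N x) \<partial>lborel)"
    using borel_measurable_integrable[OF G_integrable] G_nonneg
    by (intro nn_integral_cong) (simp add: ennreal_mult nn_integral_multc)
  also have "\<dots> = ennreal (TN N) * ennreal (TN N)"
    using borel_measurable_integrable[OF G_integrable] G_nonneg nn_integral_eq_integral[OF G_integrable, of N]
    by (simp add: nn_integral_cmult G_integral)
  finally show ?thesis by (auto intro: le_less_trans simp: ennreal_mult_less_top)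
qed

text \<open>Comparison with an averaged kernel of one level, whose norm and whose distance from the
  kernel are both finite.\<close>

lemma cut_kernel_hs_finite: "hs_sq (cut_kernel C k) < \<infinity>"
proof -
  have m: "case_prod (\<lambda>x y. cut_kernel C k x y - g 0 x y) \<in> borel_measurable (borel \<Otimes>\<^sub>M borel)"
    using cut_kernel_measurable[OF k_measurable, of C] g_measurable[of 0] by (simp add: case_prod_beta')
  have "hs_sq (cut_kernel C k) \<le> 2 * hs_sq (\<lambda>x y. cut_kernel C k x y - g 0 x y) + 2 * hs_sq (g 0)"
    using hs_sq_add_le[OF m g_measurable[of 0]] by simp
  also have "\<dots> < \<infinity>"
    using g_hs_finite[of 0] le_less_trans[OF kernel_minus_g_hs[of 0] ennreal_less_top] by (simp add: ennreal_mult_less_top)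
  finally show ?thesis .
qed

lemma cut_kernel_g: "cut_kernel C (g N) = g N"
  by (intro ext) (auto simp: cut_kernel_def indicator_def g_outside)

lemma hs_sq_minus_commute: "hs_sq (\<lambda>x y. u x y - w x y) = hs_sq (\<lambda>x y. w x y - u x y)"
  by (simp add: hs_sq_def norm_minus_commute)

lemma g_tendsto_hs: "(\<lambda>N. hs_sq (\<lambda>x y. cut_kernel C (g N) x y - cut_kernel C k x y)) \<longlonglongrightarrow> 0"
proof (rule tendsto_sandwich[OF _ _ tendsto_const])
  have "(\<lambda>N. ennreal (2 * (Re t - TN N) * (Re t + TN N))) \<longlonglongrightarrow> ennreal (2 * (Re t - Re t) * (Re t + Re t))"
    by (intro tendsto_ennrealI tendsto_intros TN_tendsto)
  then show "(\<lambda>N. ennreal (2 * (Re t - TN N) * (Re t + TN N))) \<longlonglongrightarrow> 0" by simp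
  show "\<forall>\<^sub>F N in sequentially. hs_sq (\<lambda>x y. cut_kernel C (g N) x y - cut_kernel C k x y) \<le> ennreal (2 * (Re t - TN N) * (Re t + TN N))"
    by (rule always_eventually, rule allI, subst hs_sq_minus_commute) (simp only: cut_kernel_g kernel_minus_g_hs)
qed simp

lemma g_diag_cut: "indicator C x * g N x x = g N x x"
  using g_outside[of x x N] by (auto simp: indicator_def)

text \<open>Hadamard's inequality holds for the averages at every point of the box and gives the
  bound \<open>TN N ^ m\<close>; both sides converge as \<open>N\<close> grows, which transfers it
  to the kernel.\<close>

theorem det_moment_bound:
  "cmod (LINT x|lborel_pow m. indicator (PiE {..<m} (\<lambda>_. C)) x * Determinant.det (mat m m (\<lambda>(i, j). k (x i) (x j)))) \<le> Re t ^ m"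
proof -
  let ?box = "PiE {..<m} (\<lambda>_. C)"
  have "(\<lambda>N. LINT x|lborel_pow m. indicator ?box x * Determinant.det (mat m m (\<lambda>(i, j). g N (x i) (x j))))
    \<longlonglongrightarrow> (LINT x|lborel_pow m. indicator ?box x * Determinant.det (mat m m (\<lambda>(i, j). k (x i) (x j))))"
  proof (rule box_det_tendsto[where C=C])
    show "case_prod (g N) \<in> borel_measurable (borel \<Otimes>\<^sub>M borel)" for N by (rule g_measurable)
    show "case_prod k \<in> borel_measurable (borel \<Otimes>\<^sub>M borel)" by (rule k_measurable)
    show "integrable lborel (\<lambda>x. indicator C x * g N x x)" for N by (simp add: g_diag_cut g_diag_integrable)
    show "integrable lborel (\<lambda>x. indicator C x * k x x)" by (rule diag_integrable)
    show "hs_sq (cut_kernel C (g N)) < \<infinity>" for N by (simp add: cut_kernel_g g_hs_finite del: infinity_ennreal_def)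
    show "hs_sq (cut_kernel C k) < \<infinity>" by (rule cut_kernel_hs_finite)
    show "(\<lambda>N. hs_sq (\<lambda>x y. cut_kernel C (g N) x y - cut_kernel C k x y)) \<longlonglongrightarrow> 0" by (rule g_tendsto_hs)
    show "(\<lambda>N. LINT x|lborel. indicator C x * g N x x) \<longlonglongrightarrow> (LINT x|lborel. indicator C x * k x x)"
      using tN_tendsto by (simp add: g_diag_cut g_diag_integral t_def)
  qed simp_all
  then have lim: "(\<lambda>N. cmod (LINT x|lborel_pow m. indicator ?box x * Determinant.det (mat m m (\<lambda>(i, j). g N (x i) (x j)))))
    \<longlonglongrightarrow> cmod (LINT x|lborel_pow m. indicator ?box x * Determinant.det (mat m m (\<lambda>(i, j). k (x i) (x j))))"
    by (rule tendsto_norm)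
  have le: "cmod (LINT x|lborel_pow m. indicator ?box x * Determinant.det (mat m m (\<lambda>(i, j). g N (x i) (x j)))) \<le> TN N ^ m" for N
  proof -
    have int: "integrable (lborel_pow m) (\<lambda>x. \<Prod>i<m. G N (x i))"
      by (rule lborel_prod.product_integrable_prod) (simp_all add: G_integrable)
    have "cmod (LINT x|lborel_pow m. indicator ?box x * Determinant.det (mat m m (\<lambda>(i, j). g N (x i) (x j))))
       \<le> (LINT x|lborel_pow m. (\<Prod>i<m. G N (x i)))"
    proof (rule norm_integral_le[OF _ int])
      show "integrable (lborel_pow m) (\<lambda>x. indicator ?box x * Determinant.det (mat m m (\<lambda>(i, j). g N (x i) (x j))))"
        by (rule box_det_integrable(1)[where C=C])
           (simp_all add: g_measurable g_diag_cut g_diag_integrable cut_kernel_g g_hs_finite[simplified])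
      fix x
      show "cmod (indicator ?box x * Determinant.det (mat m m (\<lambda>(i, j). g N (x i) (x j)))) \<le> (\<Prod>i<m. G N (x i))"
      proof (cases "x \<in> ?box")
        case True
        then have "hermitian_psd m (\<lambda>i j. g N (x i) (x j))" by (intro g_hermitian_psd) (auto simp: PiE_iff)
        from hadamard_inequality[OF this] show ?thesis using True by (simp add: G_def)
      next
        case False
        then show ?thesis by (simp add: prod_nonneg G_nonneg)
      qed
    qed
    also have "\<dots> = (\<Prod>i<m. TN N)"
      by (subst lborel_prod.product_integral_prod) (simp_all add: G_integrable G_integral)
    finally show ?thesis by simp
  qed
  show ?thesis
    by (rule LIMSEQ_le[OF lim tendsto_power[OF TN_tendsto]]) (use le in blast)
qed

end

section \<open>Convergence of the kernels in Hilbert-Schmidt norm\<close>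

lemma op_trace_compress:
  assumes "determinantal_kernel K k" "bounded_borel B"
  shows "op_trace (compress B K) = (LINT x|lborel. indicator B x * k x x)"
proof -
  have "has_op_trace (compress B K) (LINT x:B|lborel. k x x)"
    using assms by (simp add: determinantal_kernel_def)
  then have "op_trace (compress B K) = (LINT x:B|lborel. k x x)" by (rule op_trace_eqI)
  also have "\<dots> = (LINT x|lborel. indicator B x * k x x)"
    unfolding set_lebesgue_integral_def by (rule Bochner_Integration.integral_cong) (simp_all add: indicator_def)
  finally show ?thesis .
qed

text \<open>The limit in \<open>n\<close> is taken for fixed \<open>N\<close>, and only then
  \<open>N\<close> grows, so no uniformity enters. \<open>N\<close> is the level of averaging in one
  application and the order of truncation in the other.\<close>

lemma ennreal_iterated_limit:
  fixes X :: "nat \<Rightarrow> ennreal" and b :: "nat \<Rightarrow> nat \<Rightarrow> real"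
  assumes le: "\<And>n N. X n \<le> ennreal (b n N)"
    and b: "\<And>N. (\<lambda>n. b n N) \<longlonglongrightarrow> B N" and B: "B \<longlonglongrightarrow> 0"
  shows "X \<longlonglongrightarrow> 0"
proof (rule order_tendstoI)
  fix a :: ennreal assume "0 < a"
  then obtain z where z: "0 < z" "z < a" using dense by blast
  then obtain e where e: "z = ennreal e" "0 < e"
    by (cases z) (auto simp: ennreal_less_zero_iff)
  have "eventually (\<lambda>N. B N < e) sequentially" by (rule order_tendstoD(2)[OF B e(2)])
  then obtain N where "B N < e" by (auto simp: eventually_sequentially)
  then have "eventually (\<lambda>n. b n N < e) sequentially" by (rule order_tendstoD(2)[OF b])
  then show "eventually (\<lambda>n. X n < a) sequentially"
  proof eventually_elim
    case (elim n)
    have "X n \<le> ennreal (b n N)" by (rule le)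
    also have "\<dots> \<le> ennreal e" using elim by (intro ennreal_leI) simp
    finally show ?case using z e by simp
  qed
qed simp

text \<open>Indexed by the cell and not by a point of it, so that finite sums over the cells of a
  cube can be formed.\<close>

definition cell_function :: "nat \<Rightarrow> 'a::euclidean_space set \<Rightarrow> 'a \<Rightarrow> complex" where
  "cell_function N Q y = complex_of_real (1 / cvol TYPE('a) N) * indicator Q y"

text \<open>The difference is split in three through the averages of both kernels. For fixed
  \<open>N\<close> the bound on the first part, formed with the trace of \<open>Kn n\<close>,
  converges to its analogue for \<open>K\<close>: this is where convergence of the traces
  enters.\<close>

theorem kernel_hs_tendsto:
  fixes K :: "'a::euclidean_space operator"
  assumes dk: "determinantal_kernel K k" and dkn: "\<And>n. determinantal_kernel (Kn n) (kn n)"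
    and weak: "weak_operator_lim Kn K"
    and tr: "(\<lambda>n. LINT x|lborel. indicator (dcube R) x * kn n x x) \<longlonglongrightarrow> (LINT x|lborel. indicator (dcube R) x * k x x)"
  shows "(\<lambda>n. hs_sq (\<lambda>x y. cut_kernel (dcube R) (kn n) x y - cut_kernel (dcube R) k x y)) \<longlonglongrightarrow> 0"
proof -
  interpret A: det_kernel K k R by unfold_locales (rule dk)
  interpret B: det_kernel "Kn n" "kn n" R for n by unfold_locales (rule dkn)
  let ?C = "dcube R :: 'a set"
  define c where "c = measure lborel ?C"
  have c: "emeasure lborel ?C = ennreal c" "0 \<le> c"
    using emeasure_dcube_finite[where ?'a='a, of R] by (simp_all add: c_def emeasure_eq_ennreal_measure)
  \<comment> \<open>On the cube the averages take one value per pair of cells, so this finite sum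
    dominates their difference at all points at once.\<close>
  define \<mu> where "\<mu> N n = (\<Sum>P\<in>dcell N ` ?C. \<Sum>Q\<in>dcell N ` ?C.
     cmod (L2_inner (Kn n (cell_function N P)) (cell_function N Q) - L2_inner (K (cell_function N P)) (cell_function N Q)))" for N n
  have \<mu>0: "0 \<le> \<mu> N n" for N n unfolding \<mu>_def by (intro sum_nonneg) simp
  have cf: "cell_function N (dcell N x) = A.cell_fun N x" for N x
    by (simp add: cell_function_def A.cell_fun_def fun_eq_iff)
  have \<mu>: "(\<lambda>n. \<mu> N n) \<longlonglongrightarrow> 0" for N
  proof -
    have "(\<lambda>n. \<mu> N n) \<longlonglongrightarrow> (\<Sum>P\<in>dcell N ` ?C. \<Sum>Q\<in>dcell N ` ?C. 0)"
      unfolding \<mu>_def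
    proof (intro tendsto_sum)
      fix P Q assume "P \<in> dcell N ` ?C" "Q \<in> dcell N ` ?C"
      then have "cell_function N P \<in> L2" "cell_function N Q \<in> L2"
        using cf A.cell_fun_L2 by auto
      then have "(\<lambda>n. L2_inner (Kn n (cell_function N P)) (cell_function N Q)) \<longlonglongrightarrow> L2_inner (K (cell_function N P)) (cell_function N Q)"
        using weak by (simp add: weak_operator_lim_def)
      then show "(\<lambda>n. cmod (L2_inner (Kn n (cell_function N P)) (cell_function N Q) - L2_inner (K (cell_function N P)) (cell_function N Q))) \<longlonglongrightarrow> 0"
        by (intro tendsto_norm_zero LIM_zero)
    qed
    then show ?thesis by simp
  qed
  have gdiff: "cmod (B.g n N x y - A.g N x y) \<le> indicator ?C x * (indicator ?C y * \<mu> N n)" for n N x y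
  proof (cases "x \<in> ?C \<and> y \<in> ?C")
    case True
    let ?term = "\<lambda>P Q. cmod (L2_inner (Kn n (cell_function N P)) (cell_function N Q) - L2_inner (K (cell_function N P)) (cell_function N Q))"
    have "cmod (B.g n N x y - A.g N x y) = ?term (dcell N y) (dcell N x)"
      using True by (simp add: A.g_eq_form B.g_eq_form cf)
    also have "\<dots> \<le> (\<Sum>Q\<in>dcell N ` ?C. ?term (dcell N y) Q)"
      using True by (intro member_le_sum[of "dcell N x"] finite_dcells_dcube) auto
    also have "\<dots> \<le> \<mu> N n"
      unfolding \<mu>_def using True
      by (intro member_le_sum[of "dcell N y" _ "\<lambda>P. \<Sum>Q\<in>dcell N ` ?C. ?term P Q"] finite_dcells_dcube) (auto intro: sum_nonneg)
    finally show ?thesis using True by simp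
  next
    case False
    then have "B.g n N x y = 0" "A.g N x y = 0" by (auto simp: A.g_outside B.g_outside)
    then show ?thesis using \<mu>0[of N n] by simp
  qed
  have g_hs: "hs_sq (\<lambda>x y. B.g n N x y - A.g N x y) \<le> ennreal ((\<mu> N n)\<^sup>2 * c\<^sup>2)" for n N
  proof -
    have "hs_sq (\<lambda>x y. B.g n N x y - A.g N x y) \<le> (\<integral>\<^sup>+x. (\<integral>\<^sup>+y. ennreal ((\<mu> N n)\<^sup>2) * indicator ?C x * indicator ?C y \<partial>lborel) \<partial>lborel)"
      unfolding hs_sq_def
    proof (intro nn_integral_mono)
      fix x y
      have "(cmod (B.g n N x y - A.g N x y))\<^sup>2 \<le> (indicator ?C x * (indicator ?C y * \<mu> N n))\<^sup>2"
        by (rule power_mono[OF gdiff]) simp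
      then have "ennreal ((cmod (B.g n N x y - A.g N x y))\<^sup>2) \<le> ennreal ((indicator ?C x * (indicator ?C y * \<mu> N n))\<^sup>2)"
        by (rule ennreal_leI)
      also have "\<dots> = ennreal ((\<mu> N n)\<^sup>2) * indicator ?C x * indicator ?C y"
        by (simp add: indicator_def)
      finally show "ennreal ((cmod (B.g n N x y - A.g N x y))\<^sup>2) \<le> ennreal ((\<mu> N n)\<^sup>2) * indicator ?C x * indicator ?C y" .
    qed
    also have "\<dots> = (\<integral>\<^sup>+x. (ennreal ((\<mu> N n)\<^sup>2) * ennreal c) * indicator ?C x \<partial>lborel)"
      by (intro nn_integral_cong, subst nn_integral_cmult_indicator) (simp_all add: c mult_ac)
    also have "\<dots> = ennreal ((\<mu> N n)\<^sup>2) * ennreal c * ennreal c"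
      by (subst nn_integral_cmult_indicator) (simp_all add: c)
    also have "\<dots> = ennreal ((\<mu> N n)\<^sup>2 * c\<^sup>2)"
      using c(2) \<mu>0[of N n] by (simp add: power2_eq_square ennreal_mult mult.assoc)
    finally show ?thesis .
  qed
  have TN_lim: "(\<lambda>n. B.TN n N) \<longlonglongrightarrow> A.TN N" for N
  proof (rule LIM_zero_cancel, rule Lim_null_comparison)
    show "(\<lambda>n. c * \<mu> N n) \<longlonglongrightarrow> 0" using tendsto_mult_left[OF \<mu>[of N], of c] by simp
    show "\<forall>\<^sub>F n in sequentially. norm (B.TN n N - A.TN N) \<le> c * \<mu> N n"
    proof (rule always_eventually, rule allI)
      fix n
      have "norm (B.TN n N - A.TN N) = norm (LINT x|lborel. B.G n N x - A.G N x)"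
        using A.G_integrable B.G_integrable by (simp add: A.G_integral B.G_integral)
      also have "\<dots> \<le> (LINT x|lborel. indicator ?C x * \<mu> N n)"
      proof (rule norm_integral_le)
        show "integrable lborel (\<lambda>x. B.G n N x - A.G N x)" using A.G_integrable B.G_integrable by simp
        show "integrable lborel (\<lambda>x. indicator ?C x * \<mu> N n)" by (simp add: c)
        fix x
        have "norm (B.G n N x - A.G N x) \<le> cmod (B.g n N x x - A.g N x x)"
          using abs_Re_le_cmod[of "B.g n N x x - A.g N x x"] by (simp add: A.G_def B.G_def)
        also have "\<dots> \<le> indicator ?C x * \<mu> N n"
          using gdiff[of n N x x] by (cases "x \<in> ?C") simp_all
        finally show "norm (B.G n N x - A.G N x) \<le> indicator ?C x * \<mu> N n" .
      qed
      also have "\<dots> = c * \<mu> N n" by (simp add: c_def)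
      finally show "norm (B.TN n N - A.TN N) \<le> c * \<mu> N n" .
    qed
  qed
  have t_lim: "(\<lambda>n. Re (B.t n)) \<longlonglongrightarrow> Re A.t"
    unfolding A.t_def B.t_def by (rule tendsto_Re[OF tr])
  \<comment> \<open>Two uses of \<open>hs_sq_add_le\<close> give the three parts the weights 2, 4
    and 4; the bounds on the first and the last carry a further factor 2.\<close>
  define b where "b n N = 4 * (Re (B.t n) - B.TN n N) * (Re (B.t n) + B.TN n N) + 4 * ((\<mu> N n)\<^sup>2 * c\<^sup>2) + 8 * (Re A.t - A.TN N) * (Re A.t + A.TN N)" for n N
  have bound: "hs_sq (\<lambda>x y. cut_kernel ?C (kn n) x y - cut_kernel ?C k x y) \<le> ennreal (b n N)" for n N
  proof -
    have m: "(\<lambda>z. cut_kernel ?C (kn n) (fst z) (snd z)) \<in> borel_measurable (borel \<Otimes>\<^sub>M borel)"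
      "(\<lambda>z. cut_kernel ?C k (fst z) (snd z)) \<in> borel_measurable (borel \<Otimes>\<^sub>M borel)"
      "(\<lambda>z. B.g n N (fst z) (snd z)) \<in> borel_measurable (borel \<Otimes>\<^sub>M borel)"
      "(\<lambda>z. A.g N (fst z) (snd z)) \<in> borel_measurable (borel \<Otimes>\<^sub>M borel)"
      using cut_kernel_measurable[OF A.k_measurable, of ?C] cut_kernel_measurable[OF B.k_measurable, of ?C n] A.g_measurable[of N] B.g_measurable[of n N]
      by (simp_all add: case_prod_beta')
    let ?X = "\<lambda>x y. cut_kernel ?C (kn n) x y - B.g n N x y"
    let ?Y = "\<lambda>x y. B.g n N x y - A.g N x y"
    let ?Z = "\<lambda>x y. A.g N x y - cut_kernel ?C k x y"
    have mX: "case_prod ?X \<in> borel_measurable (borel \<Otimes>\<^sub>M borel)" and mY: "case_prod ?Y \<in> borel_measurable (borel \<Otimes>\<^sub>M borel)"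
      and mZ: "case_prod ?Z \<in> borel_measurable (borel \<Otimes>\<^sub>M borel)"
      unfolding case_prod_beta' using m by (auto intro!: borel_measurable_diff)
    have mYZ: "case_prod (\<lambda>x y. ?Y x y + ?Z x y) \<in> borel_measurable (borel \<Otimes>\<^sub>M borel)"
      unfolding case_prod_beta' using m by (auto intro!: borel_measurable_diff)
    have T: "0 \<le> Re (B.t n) - B.TN n N" "0 \<le> Re (B.t n) + B.TN n N" "0 \<le> Re A.t - A.TN N" "0 \<le> Re A.t + A.TN N"
      using A.TN_le[of N] B.TN_le[of n N] A.TN_nonneg[of N] B.TN_nonneg[of n N] by simp_all
    have "hs_sq (\<lambda>x y. ?X x y + (?Y x y + ?Z x y)) \<le> 2 * hs_sq ?X + 2 * hs_sq (\<lambda>x y. ?Y x y + ?Z x y)"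
      by (rule hs_sq_add_le[OF mX mYZ])
    also have "\<dots> \<le> 2 * hs_sq ?X + 2 * (2 * hs_sq ?Y + 2 * hs_sq ?Z)"
      by (intro add_left_mono mult_left_mono hs_sq_add_le[OF mY mZ]) simp
    also have "\<dots> \<le> 2 * ennreal (2 * (Re (B.t n) - B.TN n N) * (Re (B.t n) + B.TN n N))
        + 2 * (2 * ennreal ((\<mu> N n)\<^sup>2 * c\<^sup>2) + 2 * ennreal (2 * (Re A.t - A.TN N) * (Re A.t + A.TN N)))"
      using A.kernel_minus_g_hs[of N] A.hs_sq_minus_commute[of "A.g N" "cut_kernel ?C k"]
      by (intro add_mono mult_left_mono B.kernel_minus_g_hs g_hs) simp_all
    also have "\<dots> = ennreal 2 * ennreal (2 * (Re (B.t n) - B.TN n N) * (Re (B.t n) + B.TN n N))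
        + ennreal 2 * (ennreal 2 * ennreal ((\<mu> N n)\<^sup>2 * c\<^sup>2) + ennreal 2 * ennreal (2 * (Re A.t - A.TN N) * (Re A.t + A.TN N)))"
      by simp
    also have "\<dots> = ennreal (2 * (2 * (Re (B.t n) - B.TN n N) * (Re (B.t n) + B.TN n N))
        + 2 * (2 * ((\<mu> N n)\<^sup>2 * c\<^sup>2) + 2 * (2 * (Re A.t - A.TN N) * (Re A.t + A.TN N))))"
      using T by (simp only: ennreal_mult[symmetric] ennreal_plus[symmetric] mult_nonneg_nonneg add_nonneg_nonneg zero_le_numeral zero_le_power2)
    also have "2 * (2 * (Re (B.t n) - B.TN n N) * (Re (B.t n) + B.TN n N))
        + 2 * (2 * ((\<mu> N n)\<^sup>2 * c\<^sup>2) + 2 * (2 * (Re A.t - A.TN N) * (Re A.t + A.TN N))) = b n N"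
      by (simp add: b_def algebra_simps)
    finally show ?thesis by simp
  qed
  show ?thesis
  proof (rule ennreal_iterated_limit[OF bound])
    show "(\<lambda>n. b n N) \<longlonglongrightarrow> 4 * (Re A.t - A.TN N) * (Re A.t + A.TN N) + 4 * (0\<^sup>2 * c\<^sup>2) + 8 * (Re A.t - A.TN N) * (Re A.t + A.TN N)" for N
      unfolding b_def by (intro tendsto_intros t_lim TN_lim \<mu>)
    have "(\<lambda>N. 4 * (Re A.t - A.TN N) * (Re A.t + A.TN N) + 4 * (0\<^sup>2 * c\<^sup>2) + 8 * (Re A.t - A.TN N) * (Re A.t + A.TN N))
       \<longlonglongrightarrow> 4 * (Re A.t - Re A.t) * (Re A.t + Re A.t) + 4 * (0\<^sup>2 * c\<^sup>2) + 8 * (Re A.t - Re A.t) * (Re A.t + Re A.t)"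
      by (intro tendsto_intros A.TN_tendsto)
    then show "(\<lambda>N. 4 * (Re A.t - A.TN N) * (Re A.t + A.TN N) + 4 * (0\<^sup>2 * c\<^sup>2) + 8 * (Re A.t - A.TN N) * (Re A.t + A.TN N)) \<longlonglongrightarrow> 0"
      by simp
  qed
qed

section \<open>Factorial moments determine the limit law\<close>

lemma falling_fact_binomial: "falling_fact N k = fact k * (N choose k)"
proof (induction k)
  case 0
  then show ?case by (simp add: falling_fact_def)
next
  case (Suc k)
  have eq: "Suc k * (N choose Suc k) = (N - k) * (N choose k)"
    by (simp only: binomial_absorption binomial_absorb_comp)
  have "falling_fact N (Suc k) = (N - k) * falling_fact N k"
    by (simp add: falling_fact_def lessThan_Suc)
  also have "\<dots> = fact k * ((N - k) * (N choose k))"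
    by (simp only: Suc mult_ac)
  also have "\<dots> = fact (Suc k) * (N choose Suc k)"
    unfolding eq[symmetric] by (simp only: fact_Suc of_nat_id mult_ac)
  finally show ?case .
qed

text \<open>Newton coefficients: the polynomial \<open>\<Sum>\<^sub>l newton_coeff j l * (x choose l)\<close> is the
  indicator of \<open>x = j\<close>, and truncating it at \<open>l \<le> L\<close> changes nothing for \<open>x \<le> L\<close>.\<close>

definition newton_coeff :: "nat \<Rightarrow> nat \<Rightarrow> real" where
  "newton_coeff j l = (-1) ^ (l - j) * real (l choose j)"

text \<open>By \<open>choose_mult\<close> the sum becomes \<open>x choose j\<close> times the
  alternating sum of the binomials of \<open>x - j\<close>, which vanishes unless
  \<open>x = j\<close>; \<open>x \<le> L\<close> ensures that no nonzero term is cut off.\<close>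

lemma newton_delta:
  assumes "x \<le> L"
  shows "(\<Sum>l\<le>L. newton_coeff j l * real (x choose l)) = (if x = j then 1 else 0)"
proof (cases "j \<le> x")
  case False
  then have "newton_coeff j l * real (x choose l) = 0" for l
    by (cases "l \<le> x") (simp_all add: newton_coeff_def)
  then have "(\<Sum>l\<le>L. newton_coeff j l * real (x choose l)) = 0" by (intro sum.neutral) blast
  then show ?thesis using False by simp
next
  case True
  have "(\<Sum>l\<le>L. newton_coeff j l * real (x choose l)) = (\<Sum>l\<in>{j..x}. newton_coeff j l * real (x choose l))"
    by (rule sum.mono_neutral_right) (use assms in \<open>auto simp: newton_coeff_def not_le\<close>)
  also have "\<dots> = (\<Sum>l\<in>{j..x}. real (x choose j) * ((-1) ^ (l - j) * real ((x - j) choose (l - j))))"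
  proof (rule sum.cong[OF refl])
    fix l assume "l \<in> {j..x}"
    then have "(x choose l) * (l choose j) = (x choose j) * ((x - j) choose (l - j))"
      by (intro choose_mult) auto
    then have "real (x choose l) * real (l choose j) = real (x choose j) * real ((x - j) choose (l - j))"
      by (metis of_nat_mult)
    then show "newton_coeff j l * real (x choose l) = real (x choose j) * ((-1) ^ (l - j) * real ((x - j) choose (l - j)))"
      by (simp add: newton_coeff_def mult_ac)
  qed
  also have "\<dots> = (\<Sum>i\<le>x - j. real (x choose j) * ((-1) ^ i * real ((x - j) choose i)))"
    by (rule sum.reindex_bij_witness[of _ "\<lambda>i. i + j" "\<lambda>l. l - j"]) (use True in auto)
  also have "\<dots> = real (x choose j) * (\<Sum>i\<le>x - j. (-1) ^ i * real ((x - j) choose i))"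
    by (simp add: sum_distrib_left)
  also have "\<dots> = (if x = j then 1 else 0)"
    using True choose_alternating_sum[of "x - j", where 'a=real] by (cases "x = j") auto
  finally show ?thesis .
qed

text \<open>Summing absolute values over \<open>j\<close> first gives at most the row sum
  \<open>2 ^ l\<close>, and the binomial theorem then gives \<open>(2 + 1) ^ x\<close>. The bound is
  independent of \<open>L\<close>, which is what keeps the truncation error small.\<close>

lemma newton_abs_sum:
  "(\<Sum>j\<le>L. \<bar>\<Sum>l\<le>L. newton_coeff j l * real (x choose l)\<bar>) \<le> 3 ^ x"
proof -
  have "(\<Sum>j\<le>L. \<bar>\<Sum>l\<le>L. newton_coeff j l * real (x choose l)\<bar>) \<le> (\<Sum>j\<le>L. \<Sum>l\<le>L. real (l choose j) * real (x choose l))"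
    by (intro sum_mono order_trans[OF sum_abs]) (simp add: newton_coeff_def abs_mult)
  also have "\<dots> = (\<Sum>l\<le>L. real (x choose l) * (\<Sum>j\<le>L. real (l choose j)))"
    by (subst sum.swap) (simp add: sum_distrib_left mult.commute)
  also have "\<dots> \<le> (\<Sum>l\<le>L. real (x choose l) * 2 ^ l)"
  proof (intro sum_mono mult_left_mono)
    fix l assume "l \<in> {..L}"
    then have "(\<Sum>j\<le>L. l choose j) = (\<Sum>j\<le>l. l choose j)"
      by (intro sum.mono_neutral_right) auto
    then have "real (\<Sum>j\<le>L. l choose j) = 2 ^ l" by (simp only: choose_row_sum) simp
    then show "(\<Sum>j\<le>L. real (l choose j)) \<le> 2 ^ l" by simp
  qed simp
  also have "\<dots> \<le> (\<Sum>l\<le>max L x. real (x choose l) * 2 ^ l)"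
    by (rule sum_mono2) auto
  also have "\<dots> = (\<Sum>l\<le>x. real (x choose l) * 2 ^ l)"
    by (rule sum.mono_neutral_right) auto
  also have "\<dots> = 3 ^ x" using binomial_ring[of "2::real" 1 x] by simp
  finally show ?thesis .
qed

text \<open>Interpolation of \<open>f\<close> at the points with coordinates at most
  \<open>L\<close>, as a product of one-variable interpolations. The sum is ordered by products of
  binomials, because their expectations are the known moments; \<open>newton_poly_altdef\<close>
  reorders it by nodes.\<close>

definition newton_poly :: "nat set \<Rightarrow> nat \<Rightarrow> ((nat \<Rightarrow> nat) \<Rightarrow> real) \<Rightarrow> (nat \<Rightarrow> nat) \<Rightarrow> real" where
  "newton_poly I L f x = (\<Sum>\<kappa>\<in>PiE I (\<lambda>_. {..L}).
     (\<Sum>j\<in>PiE I (\<lambda>_. {..L}). f j * (\<Prod>i\<in>I. newton_coeff (j i) (\<kappa> i))) * (\<Prod>i\<in>I. real (x i choose \<kappa> i)))"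

lemma newton_poly_altdef:
  assumes "finite I"
  shows "newton_poly I L f x = (\<Sum>j\<in>PiE I (\<lambda>_. {..L}). f j * (\<Prod>i\<in>I. \<Sum>l\<le>L. newton_coeff (j i) l * real (x i choose l)))"
proof -
  have "newton_poly I L f x = (\<Sum>\<kappa>\<in>PiE I (\<lambda>_. {..L}). \<Sum>j\<in>PiE I (\<lambda>_. {..L}). f j * (\<Prod>i\<in>I. newton_coeff (j i) (\<kappa> i) * real (x i choose \<kappa> i)))"
    unfolding newton_poly_def by (simp add: sum_distrib_right prod.distrib mult.assoc)
  also have "\<dots> = (\<Sum>j\<in>PiE I (\<lambda>_. {..L}). \<Sum>\<kappa>\<in>PiE I (\<lambda>_. {..L}). f j * (\<Prod>i\<in>I. newton_coeff (j i) (\<kappa> i) * real (x i choose \<kappa> i)))"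
    by (rule sum.swap)
  also have "\<dots> = (\<Sum>j\<in>PiE I (\<lambda>_. {..L}). f j * (\<Prod>i\<in>I. \<Sum>l\<le>L. newton_coeff (j i) l * real (x i choose l)))"
    using assms by (simp add: prod_sum_PiE sum_distrib_left)
  finally show ?thesis .
qed

lemma newton_poly_eq:
  assumes I: "finite I" and x: "\<And>i. i \<in> I \<Longrightarrow> x i \<le> L"
  shows "newton_poly I L f x = f (restrict x I)"
proof -
  have "newton_poly I L f x = (\<Sum>j\<in>PiE I (\<lambda>_. {..L}). if j = restrict x I then f j else 0)"
    unfolding newton_poly_altdef[OF I]
  proof (rule sum.cong[OF refl])
    fix j assume j: "j \<in> PiE I (\<lambda>_. {..L})"
    have "(\<Prod>i\<in>I. \<Sum>l\<le>L. newton_coeff (j i) l * real (x i choose l)) = (\<Prod>i\<in>I. if x i = j i then 1 else 0)"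
      by (rule prod.cong[OF refl]) (rule newton_delta[OF x])
    also have "\<dots> = (if j = restrict x I then 1 else 0)"
    proof (cases "j = restrict x I")
      case True
      then show ?thesis by simp
    next
      case False
      have "\<exists>i\<in>I. x i \<noteq> j i"
      proof (rule ccontr)
        assume "\<not> (\<exists>i\<in>I. x i \<noteq> j i)"
        then have "j = restrict x I"
          using j by (intro extensionalityI[of j I]) (auto simp: PiE_iff)
        then show False using False by simp
      qed
      then have "(\<Prod>i\<in>I. if x i = j i then 1 else 0 :: real) = 0"
        by (intro prod_zero[OF I]) auto
      then show ?thesis using False by simp
    qed
    finally show "f j * (\<Prod>i\<in>I. \<Sum>l\<le>L. newton_coeff (j i) l * real (x i choose l)) = (if j = restrict x I then f j else 0)"
      by simp
  qed
  also have "\<dots> = f (restrict x I)"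
    using x by (subst sum.delta) (auto intro!: finite_PiE I)
  finally show ?thesis .
qed

lemma newton_poly_abs:
  assumes I: "finite I" and f: "\<And>j. \<bar>f j\<bar> \<le> b"
  shows "\<bar>newton_poly I L f x\<bar> \<le> b * 3 ^ (\<Sum>i\<in>I. x i)"
proof -
  have b: "0 \<le> b" using f[of undefined] by linarith
  have "\<bar>newton_poly I L f x\<bar> \<le> (\<Sum>j\<in>PiE I (\<lambda>_. {..L}). \<bar>f j * (\<Prod>i\<in>I. \<Sum>l\<le>L. newton_coeff (j i) l * real (x i choose l))\<bar>)"
    unfolding newton_poly_altdef[OF I] by (rule sum_abs)
  also have "\<dots> \<le> (\<Sum>j\<in>PiE I (\<lambda>_. {..L}). b * (\<Prod>i\<in>I. \<bar>\<Sum>l\<le>L. newton_coeff (j i) l * real (x i choose l)\<bar>))"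
    unfolding abs_mult abs_prod by (intro sum_mono mult_right_mono f prod_nonneg) simp
  also have "\<dots> = b * (\<Prod>i\<in>I. \<Sum>j\<le>L. \<bar>\<Sum>l\<le>L. newton_coeff j l * real (x i choose l)\<bar>)"
    using I by (simp add: prod_sum_PiE sum_distrib_left)
  also have "\<dots> \<le> b * (\<Prod>i\<in>I. 3 ^ x i)"
    by (intro mult_left_mono prod_mono conjI newton_abs_sum sum_nonneg b) simp
  also have "\<dots> = b * 3 ^ (\<Sum>i\<in>I. x i)" by (simp add: power_sum)
  finally show ?thesis .
qed

text \<open>The number \<open>\<tau> ^ m / fact m\<close> is the m-th binomial moment of a Poisson
  variable of mean \<open>\<tau>\<close>. \<open>S\<close> dominates the sum of the
  \<open>X i\<close>, so that a single variable controls all of them.\<close>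

locale factorial_moments = prob_space P for P :: "'w measure" +
  fixes I :: "nat set" and X :: "nat \<Rightarrow> 'w \<Rightarrow> nat" and S :: "'w \<Rightarrow> nat" and \<tau> :: real
  assumes fin: "finite I"
    and X [measurable]: "\<And>i. i \<in> I \<Longrightarrow> X i \<in> P \<rightarrow>\<^sub>M count_space UNIV"
    and S [measurable]: "S \<in> P \<rightarrow>\<^sub>M count_space UNIV"
    and XS: "\<And>\<omega>. \<omega> \<in> space P \<Longrightarrow> (\<Sum>i\<in>I. X i \<omega>) \<le> S \<omega>"
    and \<tau>: "0 \<le> \<tau>"
    and moment: "\<And>m. (\<integral>\<^sup>+\<omega>. ennreal (real (S \<omega> choose m)) \<partial>P) \<le> ennreal (\<tau> ^ m / fact m)"
begin

lemma S_real: "(\<lambda>\<omega>. g (S \<omega>)) \<in> borel_measurable P" for g :: "nat \<Rightarrow> real"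
  by (rule measurable_compose[OF S]) simp

text \<open>By the binomial theorem \<open>6 ^ S\<close> is the sum of
  \<open>5 ^ m * (S choose m)\<close>, and the moment bounds add up to an exponential series. The
  base is \<open>3 * 2\<close>: the 3 absorbs the growth of the interpolating polynomial, the 2 pays
  for the factor \<open>2 ^ -L\<close>.\<close>

lemma exp_moment: "(\<integral>\<^sup>+\<omega>. ennreal (6 ^ S \<omega>) \<partial>P) \<le> ennreal (exp (5 * \<tau>))"
proof -
  have "(\<integral>\<^sup>+\<omega>. ennreal (6 ^ S \<omega>) \<partial>P) = (\<integral>\<^sup>+\<omega>. (\<Sum>m. ennreal (5 ^ m) * ennreal (real (S \<omega> choose m))) \<partial>P)"
  proof (rule nn_integral_cong)
    fix \<omega>
    have "(\<Sum>m. ennreal (5 ^ m) * ennreal (real (S \<omega> choose m))) = (\<Sum>m\<le>S \<omega>. ennreal (5 ^ m) * ennreal (real (S \<omega> choose m)))"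
      by (rule suminf_finite) auto
    also have "\<dots> = ennreal (\<Sum>m\<le>S \<omega>. real (S \<omega> choose m) * 5 ^ m)"
      by (subst sum_ennreal[symmetric]) (simp_all add: mult.commute flip: ennreal_mult)
    also have "(\<Sum>m\<le>S \<omega>. real (S \<omega> choose m) * 5 ^ m) = 6 ^ S \<omega>"
      using binomial_ring[of "5::real" 1 "S \<omega>"] by simp
    finally show "ennreal (6 ^ S \<omega>) = (\<Sum>m. ennreal (5 ^ m) * ennreal (real (S \<omega> choose m)))" ..
  qed
  also have "\<dots> = (\<Sum>m. (\<integral>\<^sup>+\<omega>. ennreal (5 ^ m) * ennreal (real (S \<omega> choose m)) \<partial>P))"
    using S_real by (intro nn_integral_suminf) simp
  also have "\<dots> = (\<Sum>m. ennreal (5 ^ m) * (\<integral>\<^sup>+\<omega>. ennreal (real (S \<omega> choose m)) \<partial>P))"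
    using S_real by (simp add: nn_integral_cmult)
  also have "\<dots> \<le> (\<Sum>m. ennreal ((5 * \<tau>) ^ m /\<^sub>R fact m))"
  proof (intro suminf_le allI)
    fix m
    have "ennreal (5 ^ m) * (\<integral>\<^sup>+\<omega>. ennreal (real (S \<omega> choose m)) \<partial>P) \<le> ennreal (5 ^ m) * ennreal (\<tau> ^ m / fact m)"
      by (intro mult_left_mono moment) simp
    also have "\<dots> = ennreal ((5 * \<tau>) ^ m /\<^sub>R fact m)"
      using \<tau> by (simp add: power_mult_distrib divide_inverse mult_ac flip: ennreal_mult)
    finally show "ennreal (5 ^ m) * (\<integral>\<^sup>+\<omega>. ennreal (real (S \<omega> choose m)) \<partial>P) \<le> ennreal ((5 * \<tau>) ^ m /\<^sub>R fact m)" .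
  qed simp_all
  also have "\<dots> = ennreal (exp (5 * \<tau>))"
    using \<tau> exp_converges[of "5 * \<tau>"] by (intro suminf_ennreal_eq) simp_all
  finally show ?thesis .
qed

lemma exp_moment_integrable: "integrable P (\<lambda>\<omega>. 6 ^ S \<omega> :: real)"
  using exp_moment S_real by (intro integrableI_bounded) (auto intro: le_less_trans)

lemma exp_moment_integral: "(LINT \<omega>|P. 6 ^ S \<omega>) \<le> exp (5 * \<tau>)"
  using exp_moment nn_integral_eq_integral[OF exp_moment_integrable] by (simp add: ennreal_le_iff)

lemma binomial_prod_integrable: "integrable P (\<lambda>\<omega>. \<Prod>i\<in>I. real (X i \<omega> choose \<kappa> i))"
proof (rule Bochner_Integration.integrable_bound[OF exp_moment_integrable])
  show "(\<lambda>\<omega>. \<Prod>i\<in>I. real (X i \<omega> choose \<kappa> i)) \<in> borel_measurable P"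
    by (intro borel_measurable_prod measurable_compose[OF X, of _ "\<lambda>x. real (x choose \<kappa> _)"]) simp_all
  show "AE \<omega> in P. norm (\<Prod>i\<in>I. real (X i \<omega> choose \<kappa> i)) \<le> norm (6 ^ S \<omega> :: real)"
  proof (rule AE_I2)
    fix \<omega> assume \<omega>: "\<omega> \<in> space P"
    have "(\<Prod>i\<in>I. real (X i \<omega> choose \<kappa> i)) \<le> (\<Prod>i\<in>I. 2 ^ X i \<omega>)"
    proof (intro prod_mono conjI)
      fix i
      have "(X i \<omega> choose \<kappa> i) \<le> 2 ^ X i \<omega>" by (rule binomial_le_pow2)
      then show "real (X i \<omega> choose \<kappa> i) \<le> 2 ^ X i \<omega>" by (metis of_nat_le_iff of_nat_numeral of_nat_power)
    qed simp
    also have "\<dots> = 2 ^ (\<Sum>i\<in>I. X i \<omega>)" by (simp add: power_sum)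
    also have "\<dots> \<le> 2 ^ S \<omega>" using XS[OF \<omega>] by (intro power_increasing) simp_all
    also have "\<dots> \<le> (6 ^ S \<omega> :: real)" by (intro power_mono) simp_all
    finally show "norm (\<Prod>i\<in>I. real (X i \<omega> choose \<kappa> i)) \<le> norm (6 ^ S \<omega> :: real)"
      by (simp add: prod_nonneg)
  qed
qed

lemma newton_poly_integrable: "integrable P (\<lambda>\<omega>. newton_poly I L f (\<lambda>i. X i \<omega>))"
  and newton_poly_integral: "(LINT \<omega>|P. newton_poly I L f (\<lambda>i. X i \<omega>)) =
    (\<Sum>\<kappa>\<in>PiE I (\<lambda>_. {..L}). (\<Sum>j\<in>PiE I (\<lambda>_. {..L}). f j * (\<Prod>i\<in>I. newton_coeff (j i) (\<kappa> i)))
        * (LINT \<omega>|P. (\<Prod>i\<in>I. real (X i \<omega> choose \<kappa> i))))"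
  unfolding newton_poly_def using binomial_prod_integrable by simp_all

text \<open>The polynomial agrees with \<open>f\<close> unless some count exceeds \<open>L\<close>.
  In that case both are at most \<open>b * 3 ^ S\<close>, and \<open>L \<le> S\<close> permits the
  extra factor \<open>2 ^ S / 2 ^ L\<close>.\<close>

lemma newton_poly_error:
  assumes mf: "(\<lambda>\<omega>. f (restrict (\<lambda>i. X i \<omega>) I)) \<in> borel_measurable P" and f: "\<And>j. \<bar>f j\<bar> \<le> b"
  shows "\<bar>(LINT \<omega>|P. f (restrict (\<lambda>i. X i \<omega>) I)) - (LINT \<omega>|P. newton_poly I L f (\<lambda>i. X i \<omega>))\<bar> \<le> 2 * b * exp (5 * \<tau>) / 2 ^ L"
proof -
  have b: "0 \<le> b" using f[of undefined] by linarith
  have i: "integrable P (\<lambda>\<omega>. f (restrict (\<lambda>i. X i \<omega>) I))"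
    using f by (intro integrable_const_bound[of _ b]) (simp_all add: mf)
  have "\<bar>(LINT \<omega>|P. f (restrict (\<lambda>i. X i \<omega>) I)) - (LINT \<omega>|P. newton_poly I L f (\<lambda>i. X i \<omega>))\<bar>
      = norm (LINT \<omega>|P. f (restrict (\<lambda>i. X i \<omega>) I) - newton_poly I L f (\<lambda>i. X i \<omega>))"
    using i newton_poly_integrable by simp
  also have "\<dots> \<le> (LINT \<omega>|P. norm (f (restrict (\<lambda>i. X i \<omega>) I) - newton_poly I L f (\<lambda>i. X i \<omega>)))"
    by (rule integral_norm_bound)
  also have "\<dots> \<le> (LINT \<omega>|P. 2 * b / 2 ^ L * 6 ^ S \<omega>)"
  proof (rule integral_mono)
    fix \<omega> assume \<omega>: "\<omega> \<in> space P"
    show "norm (f (restrict (\<lambda>i. X i \<omega>) I) - newton_poly I L f (\<lambda>i. X i \<omega>)) \<le> 2 * b / 2 ^ L * 6 ^ S \<omega>"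
    proof (cases "\<forall>i\<in>I. X i \<omega> \<le> L")
      case True
      then show ?thesis using newton_poly_eq[OF fin, of "\<lambda>i. X i \<omega>" L f] b by simp
    next
      case False
      then obtain i where i: "i \<in> I" "L < X i \<omega>" by (auto simp: not_le)
      have "X i \<omega> \<le> (\<Sum>i\<in>I. X i \<omega>)" using i(1) fin by (intro member_le_sum) auto
      then have "L \<le> S \<omega>" using i(2) XS[OF \<omega>] by simp
      then have "(2::real) ^ L \<le> 2 ^ S \<omega>" by (intro power_increasing) simp_all
      then have "(1::real) \<le> 2 ^ S \<omega> / 2 ^ L" by simp
      then have "2 * b * 3 ^ S \<omega> * 1 \<le> 2 * b * 3 ^ S \<omega> * (2 ^ S \<omega> / 2 ^ L)"
        using b by (intro mult_left_mono) simp_all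
      also have "\<dots> = 2 * b / 2 ^ L * (3 ^ S \<omega> * 2 ^ S \<omega>)" by simp
      also have "(3::real) ^ S \<omega> * 2 ^ S \<omega> = 6 ^ S \<omega>" by (simp flip: power_mult_distrib)
      finally have 1: "2 * b * 3 ^ S \<omega> \<le> 2 * b / 2 ^ L * 6 ^ S \<omega>" by simp
      have "(3::real) ^ (\<Sum>i\<in>I. X i \<omega>) \<le> 3 ^ S \<omega>" using XS[OF \<omega>] by (intro power_increasing) simp_all
      then have "b * 3 ^ (\<Sum>i\<in>I. X i \<omega>) \<le> b * 3 ^ S \<omega>" using b by (rule mult_left_mono)
      then have 2: "\<bar>newton_poly I L f (\<lambda>i. X i \<omega>)\<bar> \<le> b * 3 ^ S \<omega>"
        using newton_poly_abs[where f=f and L=L and x="\<lambda>i. X i \<omega>", OF fin f] by linarith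
      have "b * 1 \<le> b * 3 ^ S \<omega>" using b by (intro mult_left_mono) simp_all
      then have 3: "\<bar>f (restrict (\<lambda>i. X i \<omega>) I)\<bar> \<le> b * 3 ^ S \<omega>"
        using f[of "restrict (\<lambda>i. X i \<omega>) I"] by linarith
      show ?thesis using 1 2 3 by simp
    qed
  qed (use i newton_poly_integrable exp_moment_integrable in simp_all)
  also have "\<dots> = 2 * b / 2 ^ L * (LINT \<omega>|P. 6 ^ S \<omega>)" by simp
  also have "\<dots> \<le> 2 * b / 2 ^ L * exp (5 * \<tau>)"
    using exp_moment_integral b by (intro mult_left_mono) simp_all
  finally show ?thesis by simp
qed

end

text \<open>All laws share one \<open>\<tau>\<close>, so the bound on the truncation error is the
  same for every \<open>n\<close>; for fixed \<open>L\<close> the expectation of the polynomial is a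
  finite combination of convergent moments.\<close>

theorem factorial_moments_tendsto:
  fixes Pn :: "nat \<Rightarrow> 'w measure" and f :: "(nat \<Rightarrow> nat) \<Rightarrow> real"
  assumes P: "factorial_moments P I X S \<tau>" and Pn: "\<And>n. factorial_moments (Pn n) I X S \<tau>"
    and lim: "\<And>\<kappa>. (\<lambda>n. LINT \<omega>|Pn n. (\<Prod>i\<in>I. real (X i \<omega> choose \<kappa> i))) \<longlonglongrightarrow> (LINT \<omega>|P. (\<Prod>i\<in>I. real (X i \<omega> choose \<kappa> i)))"
    and f: "\<And>j. \<bar>f j\<bar> \<le> b"
    and mf: "(\<lambda>\<omega>. f (restrict (\<lambda>i. X i \<omega>) I)) \<in> borel_measurable P"
       "\<And>n. (\<lambda>\<omega>. f (restrict (\<lambda>i. X i \<omega>) I)) \<in> borel_measurable (Pn n)"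
  shows "(\<lambda>n. LINT \<omega>|Pn n. f (restrict (\<lambda>i. X i \<omega>) I)) \<longlonglongrightarrow> (LINT \<omega>|P. f (restrict (\<lambda>i. X i \<omega>) I))"
proof -
  interpret A: factorial_moments P I X S \<tau> by fact
  interpret B: factorial_moments "Pn n" I X S \<tau> for n by fact
  let ?q = "\<lambda>Q L. LINT \<omega>|Q. newton_poly I L f (\<lambda>i. X i \<omega>)"
  let ?f = "\<lambda>Q. LINT \<omega>|Q. f (restrict (\<lambda>i. X i \<omega>) I)"
  define e where "e L = 2 * b * exp (5 * \<tau>) / 2 ^ L" for L :: nat
  have q: "(\<lambda>n. ?q (Pn n) L) \<longlonglongrightarrow> ?q P L" for L
    unfolding A.newton_poly_integral B.newton_poly_integral by (intro tendsto_sum tendsto_mult_left lim)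
  have "(\<lambda>n. ennreal \<bar>?f (Pn n) - ?f P\<bar>) \<longlonglongrightarrow> 0"
  proof (rule ennreal_iterated_limit)
    show "ennreal \<bar>?f (Pn n) - ?f P\<bar> \<le> ennreal (\<bar>?q (Pn n) L - ?q P L\<bar> + 2 * e L)" for n L
      using A.newton_poly_error[where f=f, OF mf(1) f, of L] B.newton_poly_error[where f=f, OF mf(2) f, of n L]
      by (intro ennreal_leI) (fold e_def, linarith)
    show "(\<lambda>n. \<bar>?q (Pn n) L - ?q P L\<bar> + 2 * e L) \<longlonglongrightarrow> 0 + 2 * e L" for L
      by (intro tendsto_add tendsto_const tendsto_rabs_zero LIM_zero q)
    have "(\<lambda>L. 2 * (2 * b * exp (5 * \<tau>)) * (1 / 2) ^ L) \<longlonglongrightarrow> 2 * (2 * b * exp (5 * \<tau>)) * 0"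
      by (intro tendsto_mult_left LIMSEQ_power_zero) simp
    then show "(\<lambda>L. 0 + 2 * e L) \<longlonglongrightarrow> 0" by (simp add: e_def power_divide)
  qed
  then have "(\<lambda>n. \<bar>?f (Pn n) - ?f P\<bar>) \<longlonglongrightarrow> 0"
    by (simp add: tendsto_ennreal_iff flip: ennreal_0)
  then show ?thesis by (rule LIM_zero_cancel[OF tendsto_rabs_zero_cancel])
qed

section \<open>Particle counts of determinantal fields\<close>

lemma configurations_finite:
  assumes "\<xi> \<in> configurations" "bounded B"
  shows "finite {x \<in> B. \<xi> x \<noteq> 0}"
proof (rule finite_subset)
  show "finite {x \<in> closure B. \<xi> x \<noteq> 0}"
    using assms by (simp add: configurations_def compact_closure)
qed (use closure_subset in auto)

text \<open>\<open>particles_in\<close> is a \<open>sum\<close> and would be 0 over an infinite set;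
  on bounded sets a configuration has finitely many occupied points, which makes the counts
  additive.\<close>

lemma particles_in_UN:
  assumes \<xi>: "\<xi> \<in> configurations" and I: "finite I" and disj: "disjoint_family_on A I"
    and bd: "\<And>i. i \<in> I \<Longrightarrow> bounded (A i)"
  shows "particles_in (\<Union>i\<in>I. A i) \<xi> = (\<Sum>i\<in>I. particles_in (A i) \<xi>)"
proof -
  have eq: "{x \<in> (\<Union>i\<in>I. A i). \<xi> x \<noteq> 0} = (\<Union>i\<in>I. {x \<in> A i. \<xi> x \<noteq> 0})" by auto
  have fin: "\<forall>i\<in>I. finite {x \<in> A i. \<xi> x \<noteq> 0}" using configurations_finite[OF \<xi> bd] by blast
  have dj: "\<forall>i\<in>I. \<forall>j\<in>I. i \<noteq> j \<longrightarrow> {x \<in> A i. \<xi> x \<noteq> 0} \<inter> {x \<in> A j. \<xi> x \<noteq> 0} = {}"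
    using disj unfolding disjoint_family_on_def by blast
  show ?thesis
    unfolding particles_in_def eq by (rule sum.UNION_disjoint[OF I fin dj])
qed

lemma particles_in_mono:
  assumes "\<xi> \<in> configurations" "bounded B" "A \<subseteq> B"
  shows "particles_in A \<xi> \<le> particles_in B \<xi>"
  unfolding particles_in_def
  by (rule sum_mono2[OF configurations_finite[OF assms(1,2)]]) (use assms(3) in auto)

lemma space_random_point_field:
  assumes "random_point_field P" shows "space P = configurations"
proof -
  have "space P = space config_algebra"
    using assms by (intro sets_eq_imp_space_eq) (simp add: random_point_field_def)
  also have "\<dots> = configurations"
    unfolding config_algebra_def by (rule space_measure_of) auto
  finally show ?thesis .
qed

lemma particles_in_measurable:
  assumes P: "random_point_field P" and B: "bounded_borel B"
  shows "particles_in B \<in> P \<rightarrow>\<^sub>M count_space UNIV"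
  unfolding measurable_count_space_eq_countable[OF countableI_type]
proof (intro conjI ballI)
  fix n :: nat
  have "{\<xi> \<in> configurations. particles_in B \<xi> = n} \<in> sets config_algebra"
    unfolding config_algebra_def using B by (intro in_measure_of) auto
  moreover have "particles_in B -` {n} \<inter> space P = {\<xi> \<in> configurations. particles_in B \<xi> = n}"
    by (auto simp: space_random_point_field[OF P])
  ultimately show "particles_in B -` {n} \<inter> space P \<in> sets P"
    using P by (simp add: random_point_field_def)
qed simp

section \<open>Moments of counts as integrals of determinants\<close>

definition box_factors :: "nat \<Rightarrow> (nat \<Rightarrow> 'a set) \<Rightarrow> (nat \<Rightarrow> nat) \<Rightarrow> 'a set list" where
  "box_factors m A \<kappa> = concat (map (\<lambda>i. replicate (\<kappa> i) (A i)) [0..<m])"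

lemma length_box_factors: "length (box_factors m A \<kappa>) = (\<Sum>i<m. \<kappa> i)"
  by (simp add: box_factors_def length_concat comp_def interv_sum_list_conv_sum_set_nat atLeast0LessThan)

lemma box_factors_nth:
  assumes "j < length (box_factors m A \<kappa>)"
  shows "\<exists>i<m. box_factors m A \<kappa> ! j = A i"
proof -
  have "box_factors m A \<kappa> ! j \<in> set (box_factors m A \<kappa>)" using assms by (rule nth_mem)
  then show ?thesis by (auto simp: box_factors_def)
qed

definition box_det_integral :: "nat \<Rightarrow> (nat \<Rightarrow> 'a::euclidean_space set) \<Rightarrow> ('a \<Rightarrow> 'a \<Rightarrow> complex) \<Rightarrow> complex" where
  "box_det_integral n F k = (LINT x|lborel_pow n. indicator (PiE {..<n} F) x * Determinant.det (mat n n (\<lambda>(i, j). k (x i) (x j))))"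

text \<open>The correlation function is the determinant only almost everywhere; its sign makes the
  real part of the determinant nonnegative on the box, and integrability of the latter turns the
  nonnegative integral into a finite number. \<open>determinantal_field\<close> prescribes
  correlation functions from order 1 on, whence \<open>1 \<le> n\<close>.\<close>

lemma determinantal_field_moment:
  fixes A :: "nat \<Rightarrow> 'a::euclidean_space set"
  assumes P: "determinantal_field P K k"
    and A: "\<And>i. i < m \<Longrightarrow> bounded_borel (A i)" "\<And>i. i < m \<Longrightarrow> A i \<subseteq> dcube R"
    and disj: "disjoint_family_on A {..<m}" and n: "(\<Sum>i<m. \<kappa> i) = n" "1 \<le> n"
  shows "(\<integral>\<^sup>+ \<xi>. of_nat (\<Prod>i<m. falling_fact (particles_in (A i) \<xi>) (\<kappa> i)) \<partial>P)
     = ennreal (Re (box_det_integral n (\<lambda>j. box_factors m A \<kappa> ! j) k))"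
    and "0 \<le> Re (box_det_integral n (\<lambda>j. box_factors m A \<kappa> ! j) k)"
proof -
  interpret det_kernel K k R using P by unfold_locales (simp add: determinantal_field_def)
  let ?F = "\<lambda>j. box_factors m A \<kappa> ! j"
  let ?box = "PiE {..<n} ?F"
  let ?det = "\<lambda>x. Determinant.det (mat n n (\<lambda>(i, j). k (x i) (x j)))"
  obtain \<rho> where \<rho>: "correlation_function P n \<rho>" and ae: "AE x in lborel_pow n. complex_of_real (\<rho> x) = ?det x"
    using P n(2) unfolding determinantal_field_def by blast
  have len: "length (box_factors m A \<kappa>) = n" using n(1) by (simp add: length_box_factors)
  have F: "?F j \<in> sets borel" "?F j \<subseteq> C" if "j < n" for j
    using box_factors_nth[of j m A \<kappa>] that A len by (auto simp: bounded_borel_def)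
  have int: "integrable (lborel_pow n) (\<lambda>x. indicator ?box x * ?det x)"
    by (rule box_det_integrable(1)[where C=C]) (use F k_measurable diag_integrable cut_kernel_hs_finite in simp_all)
  have eq: "AE x in lborel_pow n. ennreal (\<rho> x) * indicator ?box x = ennreal (Re (indicator ?box x * ?det x))
     \<and> 0 \<le> Re (indicator ?box x * ?det x)"
    using ae AE_space
  proof eventually_elim
    case (elim x)
    have "0 \<le> \<rho> x" using \<rho> elim(2) by (simp add: correlation_function_def)
    then show ?case using elim(1)[symmetric] by (simp add: indicator_def)
  qed
  have "(\<integral>\<^sup>+ \<xi>. of_nat (\<Prod>i<m. falling_fact (particles_in (A i) \<xi>) (\<kappa> i)) \<partial>P)
     = (\<integral>\<^sup>+ x \<in> power_box m A \<kappa>. ennreal (\<rho> x) \<partial>lborel_pow n)"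
    using \<rho> A(1) disj n(1) unfolding correlation_function_def by blast
  also have "power_box m A \<kappa> = ?box"
    unfolding power_box_def Let_def box_factors_def[symmetric] len ..
  also have "(\<integral>\<^sup>+ x \<in> ?box. ennreal (\<rho> x) \<partial>lborel_pow n) = (\<integral>\<^sup>+ x. ennreal (Re (indicator ?box x * ?det x)) \<partial>lborel_pow n)"
    by (rule nn_integral_cong_AE) (use eq in eventually_elim, blast)
  also have "\<dots> = ennreal (LINT x|lborel_pow n. Re (indicator ?box x * ?det x))"
    by (rule nn_integral_eq_integral[OF integrable_Re[OF int]]) (use eq in eventually_elim, blast)
  also have "(LINT x|lborel_pow n. Re (indicator ?box x * ?det x)) = Re (box_det_integral n ?F k)"
    unfolding box_det_integral_def by (rule integral_Re[OF int])
  finally show "(\<integral>\<^sup>+ \<xi>. of_nat (\<Prod>i<m. falling_fact (particles_in (A i) \<xi>) (\<kappa> i)) \<partial>P) = ennreal (Re (box_det_integral n ?F k))" .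
  have "0 \<le> (LINT x|lborel_pow n. Re (indicator ?box x * ?det x))"
    by (rule integral_nonneg_AE) (use eq in eventually_elim, blast)
  then show "0 \<le> Re (box_det_integral n ?F k)"
    unfolding box_det_integral_def by (simp only: integral_Re[OF int])
qed

lemma determinantal_field_binomial_moment:
  fixes A :: "nat \<Rightarrow> 'a::euclidean_space set"
  assumes P: "determinantal_field P K k"
    and A: "\<And>i. i < m \<Longrightarrow> bounded_borel (A i)" "\<And>i. i < m \<Longrightarrow> A i \<subseteq> dcube R"
    and disj: "disjoint_family_on A {..<m}" and n: "(\<Sum>i<m. \<kappa> i) = n" "1 \<le> n"
  shows "(LINT \<xi>|P. (\<Prod>i<m. real (particles_in (A i) \<xi> choose \<kappa> i)))
     = Re (box_det_integral n (\<lambda>j. box_factors m A \<kappa> ! j) k) / (\<Prod>i<m. fact (\<kappa> i))"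
proof -
  have rp: "random_point_field P" using P by (simp add: determinantal_field_def)
  have meas: "(\<lambda>\<xi>. real (\<Prod>i<m. falling_fact (particles_in (A i) \<xi>) (\<kappa> i))) \<in> borel_measurable P"
  proof -
    have "(\<lambda>\<xi>. real (falling_fact (particles_in (A i) \<xi>) (\<kappa> i))) \<in> borel_measurable P" if "i < m" for i
      by (rule measurable_compose[OF particles_in_measurable[OF rp A(1)[OF that]]]) simp
    then show ?thesis by simp
  qed
  have "(LINT \<xi>|P. real (\<Prod>i<m. falling_fact (particles_in (A i) \<xi>) (\<kappa> i)))
    = enn2real (\<integral>\<^sup>+ \<xi>. ennreal (real (\<Prod>i<m. falling_fact (particles_in (A i) \<xi>) (\<kappa> i))) \<partial>P)"
    by (rule integral_eq_nn_integral[OF meas]) (rule AE_I2, rule of_nat_0_le_iff)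
  also have "\<dots> = Re (box_det_integral n (\<lambda>j. box_factors m A \<kappa> ! j) k)"
    using determinantal_field_moment[OF P A disj n] by (simp only: ennreal_of_nat_eq_real_of_nat enn2real_ennreal)
  finally have *: "(LINT \<xi>|P. real (\<Prod>i<m. falling_fact (particles_in (A i) \<xi>) (\<kappa> i))) = Re (box_det_integral n (\<lambda>j. box_factors m A \<kappa> ! j) k)" .
  have "(\<Prod>i<m. real (particles_in (A i) \<xi> choose \<kappa> i)) = real (\<Prod>i<m. falling_fact (particles_in (A i) \<xi>) (\<kappa> i)) / (\<Prod>i<m. fact (\<kappa> i))" for \<xi>
    by (simp add: falling_fact_binomial flip: prod_dividef)
  then show ?thesis by (simp only: integral_divide_zero *)
qed

text \<open>The dominating variable is the count in the whole cube, to which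
  \<open>det_moment_bound\<close> applies. An upper bound \<open>\<tau>\<close> in place of the
  trace lets different fields share one constant.\<close>

lemma factorial_moments_field:
  fixes A :: "nat \<Rightarrow> 'a::euclidean_space set"
  assumes P: "determinantal_field P K k"
    and A: "\<And>i. i < m \<Longrightarrow> bounded_borel (A i)" "\<And>i. i < m \<Longrightarrow> A i \<subseteq> dcube R"
    and disj: "disjoint_family_on A {..<m}"
    and \<tau>: "Re (LINT x|lborel. indicator (dcube R) x * k x x) \<le> \<tau>"
  shows "factorial_moments P {..<m} (\<lambda>i. particles_in (A i)) (particles_in (dcube R)) \<tau>"
proof -
  have rp: "random_point_field P" and dk: "determinantal_kernel K k"
    using P by (simp_all add: determinantal_field_def)
  interpret prob_space P using rp by (simp add: random_point_field_def)
  interpret D: det_kernel K k R by unfold_locales (rule dk)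
  have t: "0 \<le> Re D.t" "Re D.t \<le> \<tau>"
    using order_trans[OF D.TN_nonneg D.TN_le[of 0]] \<tau> by (simp_all add: D.t_def)
  show ?thesis
  proof unfold_locales
    fix \<xi> assume "\<xi> \<in> space P"
    then have \<xi>: "\<xi> \<in> configurations" by (simp add: space_random_point_field[OF rp])
    have "(\<Sum>i<m. particles_in (A i) \<xi>) = particles_in (\<Union>i<m. A i) \<xi>"
      by (rule particles_in_UN[OF \<xi> _ disj, symmetric]) (use A in \<open>auto simp: bounded_borel_def\<close>)
    also have "\<dots> \<le> particles_in (dcube R) \<xi>"
      by (rule particles_in_mono[OF \<xi> bounded_dcube]) (use A in auto)
    finally show "(\<Sum>i<m. particles_in (A i) \<xi>) \<le> particles_in (dcube R) \<xi>" .
  next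
    fix l :: nat
    have meas: "(\<lambda>\<xi>. ennreal (real (falling_fact (particles_in (dcube R) \<xi>) l))) \<in> borel_measurable P"
      by (rule measurable_compose[OF particles_in_measurable[OF rp bounded_borel_dcube]]) simp
    have le: "(\<integral>\<^sup>+\<xi>. ennreal (real (falling_fact (particles_in (dcube R) \<xi>) l)) \<partial>P) \<le> ennreal (\<tau> ^ l)"
    proof (cases "1 \<le> l")
      case False
      then have "l = 0" by simp
      then show ?thesis by (simp add: falling_fact_def emeasure_space_1)
    next
      case True
      \<comment> \<open>The cube alone, with multiplicity \<open>l\<close>, is a family of one
        set.\<close>
      have box: "PiE {..<l} (\<lambda>j. box_factors 1 (\<lambda>_. dcube R :: 'a set) (\<lambda>_. l) ! j) = PiE {..<l} (\<lambda>_. dcube R)"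
        by (rule PiE_cong) (simp add: box_factors_def)
      have "(\<integral>\<^sup>+\<xi>. of_nat (\<Prod>i<(1::nat). falling_fact (particles_in (dcube R) \<xi>) l) \<partial>P)
        = ennreal (Re (box_det_integral l (\<lambda>j. box_factors 1 (\<lambda>_. dcube R) (\<lambda>_. l) ! j) k))"
        by (rule determinantal_field_moment(1)[where m=1 and A="\<lambda>_. dcube R" and R=R and \<kappa>="\<lambda>_. l" and n=l, OF P])
           (use True in \<open>simp_all add: bounded_borel_dcube disjoint_family_on_def\<close>)
      also have "\<dots> \<le> ennreal (\<tau> ^ l)"
      proof (rule ennreal_leI)
        have "Re (box_det_integral l (\<lambda>j. box_factors 1 (\<lambda>_. dcube R) (\<lambda>_. l) ! j) k) \<le> Re D.t ^ l"
          unfolding box_det_integral_def box by (rule order_trans[OF complex_Re_le_cmod D.det_moment_bound])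
        also have "\<dots> \<le> \<tau> ^ l" by (rule power_mono[OF t(2,1)])
        finally show "Re (box_det_integral l (\<lambda>j. box_factors 1 (\<lambda>_. dcube R) (\<lambda>_. l) ! j) k) \<le> \<tau> ^ l" .
      qed
      finally show ?thesis by (simp add: ennreal_of_nat_eq_real_of_nat lessThan_Suc)
    qed
    have "(\<integral>\<^sup>+\<xi>. ennreal (real (particles_in (dcube R) \<xi> choose l)) \<partial>P)
      = (\<integral>\<^sup>+\<xi>. ennreal (1 / fact l) * ennreal (real (falling_fact (particles_in (dcube R) \<xi>) l)) \<partial>P)"
      by (rule nn_integral_cong) (simp add: falling_fact_binomial flip: ennreal_mult)
    also have "\<dots> = ennreal (1 / fact l) * (\<integral>\<^sup>+\<xi>. ennreal (real (falling_fact (particles_in (dcube R) \<xi>) l)) \<partial>P)"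
      by (rule nn_integral_cmult[OF meas])
    also have "\<dots> \<le> ennreal (1 / fact l) * ennreal (\<tau> ^ l)" by (rule mult_left_mono[OF le]) simp
    also have "\<dots> = ennreal (\<tau> ^ l / fact l)" using t by (simp flip: ennreal_mult)
    finally show "(\<integral>\<^sup>+\<xi>. ennreal (real (particles_in (dcube R) \<xi> choose l)) \<partial>P) \<le> ennreal (\<tau> ^ l / fact l)" .
  qed (use t particles_in_measurable[OF rp] A particles_in_measurable[OF rp bounded_borel_dcube[of R]] in auto)
qed

lemma box_det_integral_tendsto:
  fixes K :: "'a::euclidean_space operator"
  assumes dk: "determinantal_kernel K k" and dkn: "\<And>n. determinantal_kernel (Kn n) (kn n)"
    and weak: "weak_operator_lim Kn K"
    and tr: "\<And>B. bounded_borel B \<Longrightarrow> (\<lambda>n. op_trace (compress B (Kn n))) \<longlonglongrightarrow> op_trace (compress B K)"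
    and F: "\<And>j. j < l \<Longrightarrow> bounded_borel (F j)" "\<And>j. j < l \<Longrightarrow> F j \<subseteq> dcube R"
  shows "(\<lambda>n. box_det_integral l F (kn n)) \<longlonglongrightarrow> box_det_integral l F k"
proof -
  interpret A: det_kernel K k R by unfold_locales (rule dk)
  interpret B: det_kernel "Kn n" "kn n" R for n by unfold_locales (rule dkn)
  have tr': "(\<lambda>n. LINT x|lborel. indicator B x * kn n x x) \<longlonglongrightarrow> (LINT x|lborel. indicator B x * k x x)"
    if "bounded_borel B" for B
    using tr[OF that] by (simp only: op_trace_compress[OF dk that] op_trace_compress[OF dkn that])
  show ?thesis
    unfolding box_det_integral_def
    by (rule box_det_tendsto[where C="dcube R", OF _ _ _ B.k_measurable A.k_measurable B.diag_integrable A.diag_integrable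
          B.cut_kernel_hs_finite A.cut_kernel_hs_finite _ kernel_hs_tendsto[OF dk dkn weak tr'[OF bounded_borel_dcube]]])
       (use F tr' in \<open>auto simp: bounded_borel_def\<close>)
qed

section \<open>Reduction to disjoint sets\<close>

text \<open>Correlation functions describe moments for disjoint sets only. Here \<open>s\<close>
  lists all subsets of \<open>{..<m}\<close>, and atom \<open>i\<close> consists of the points of
  \<open>C\<close> that lie in exactly those \<open>B l\<close> with \<open>l \<in> s i\<close>;
  atoms may be empty.\<close>

lemma disjoint_atoms:
  fixes B :: "nat \<Rightarrow> 'a set" and m :: nat
  obtains M :: nat and A :: "nat \<Rightarrow> 'a set" and s :: "nat \<Rightarrow> nat set"
  where "disjoint_family_on A {..<M}"
    "\<forall>i<M. A i = C \<inter> (\<Inter>l<m. if l \<in> s i then B l else - B l)"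
    "\<forall>l<m. B l \<subseteq> C \<longrightarrow> B l = (\<Union>i\<in>{i\<in>{..<M}. l \<in> s i}. A i)"
proof -
  obtain s where s: "bij_betw s {0..<card (Pow {..<m})} (Pow {..<m})"
    using ex_bij_betw_nat_finite[of "Pow {..<m}"] by auto
  define M where "M = card (Pow {..<m})"
  define A where "A i = C \<inter> (\<Inter>l<m. if l \<in> s i then B l else - B l)" for i
  have mem: "x \<in> A i \<longleftrightarrow> x \<in> C \<and> (\<forall>l<m. l \<in> s i \<longleftrightarrow> x \<in> B l)" for x i
    by (auto simp: A_def split: if_splits)
  have sM: "s i \<subseteq> {..<m}" if "i < M" for i
    using bij_betwE[OF s] that by (auto simp: M_def)
  show ?thesis
  proof (rule that[of A M s])
    show "disjoint_family_on A {..<M}"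
      unfolding disjoint_family_on_def
    proof (intro ballI impI, rule ccontr)
      fix i j assume ij: "i \<in> {..<M}" "j \<in> {..<M}" "i \<noteq> j" and "A i \<inter> A j \<noteq> {}"
      then obtain x where "x \<in> A i" "x \<in> A j" by blast
      then have "\<forall>l<m. l \<in> s i \<longleftrightarrow> l \<in> s j" unfolding mem by blast
      then have "s i = s j" using sM[of i] sM[of j] ij by blast
      then show False using s ij by (auto simp: bij_betw_def inj_on_def M_def)
    qed
    show "\<forall>i<M. A i = C \<inter> (\<Inter>l<m. if l \<in> s i then B l else - B l)" by (simp add: A_def)
    show "\<forall>l<m. B l \<subseteq> C \<longrightarrow> B l = (\<Union>i\<in>{i\<in>{..<M}. l \<in> s i}. A i)"
    proof (intro allI impI equalityI)
      fix l assume l: "l < m" "B l \<subseteq> C"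
      show "B l \<subseteq> (\<Union>i\<in>{i\<in>{..<M}. l \<in> s i}. A i)"
      proof
        fix x assume x: "x \<in> B l"
        have "{l\<in>{..<m}. x \<in> B l} \<in> s ` {..<M}"
          using s unfolding bij_betw_def M_def atLeast0LessThan by auto
        then obtain i where i: "i < M" "s i = {l\<in>{..<m}. x \<in> B l}" by auto
        then have "x \<in> A i" "l \<in> s i" using x l by (auto simp: mem)
        then show "x \<in> (\<Union>i\<in>{i\<in>{..<M}. l \<in> s i}. A i)" using i(1) by blast
      qed
      show "(\<Union>i\<in>{i\<in>{..<M}. l \<in> s i}. A i) \<subseteq> B l" using l(1) by (auto simp: mem)
    qed
  qed
qed

theorem theorem5:
  fixes P :: "(real ^ 'd \<Rightarrow> nat) measure"
    and Pn :: "nat \<Rightarrow> (real ^ 'd \<Rightarrow> nat) measure"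
    and K :: "(real ^ 'd) operator"
    and Kn :: "nat \<Rightarrow> (real ^ 'd) operator"
    and k :: "real ^ 'd \<Rightarrow> real ^ 'd \<Rightarrow> complex"
    and kn :: "nat \<Rightarrow> real ^ 'd \<Rightarrow> real ^ 'd \<Rightarrow> complex"
  assumes "determinantal_field P K k"
    and "\<And>n. determinantal_field (Pn n) (Kn n) (kn n)"
    and "weak_operator_lim Kn K"
    and "\<And>B. bounded_borel B \<Longrightarrow>
           (\<lambda>n. op_trace (compress B (Kn n))) \<longlonglongrightarrow> op_trace (compress B K)"
  shows "weakly_converges_on_cylinders Pn P"
  unfolding weakly_converges_on_cylinders_def weakly_converges_def
proof (intro allI impI)
  fix m :: nat and B :: "nat \<Rightarrow> (real ^ 'd) set" and \<Phi> :: "(nat \<Rightarrow> real) \<Rightarrow> real"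
  assume B: "\<forall>i<m. bounded_borel (B i)" and cont: "continuous_on UNIV \<Phi>" and bdd: "bounded (range \<Phi>)"
  note field = assms(1) and fieldn = assms(2) and weak = assms(3) and tr = assms(4)
  have dk: "determinantal_kernel K k" and dkn: "determinantal_kernel (Kn n) (kn n)" for n
    using field fieldn[of n] by (simp_all add: determinantal_field_def)
  have rp: "random_point_field P" and rpn: "random_point_field (Pn n)" for n
    using field fieldn[of n] by (simp_all add: determinantal_field_def)
  have "bounded (\<Union>i<m. B i)" using B by (auto simp: bounded_borel_def)
  then obtain R where R: "(\<Union>i<m. B i) \<subseteq> dcube R" using bounded_subset_dcube by blast
  obtain M :: nat and A :: "nat \<Rightarrow> (real ^ 'd) set" and s :: "nat \<Rightarrow> nat set" where disj: "disjoint_family_on A {..<M}"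
    and A_all: "\<forall>i<M. A i = dcube R \<inter> (\<Inter>l<m. if l \<in> s i then B l else - B l)"
    and BA_all: "\<forall>l<m. B l \<subseteq> dcube R \<longrightarrow> B l = (\<Union>i\<in>{i\<in>{..<M}. l \<in> s i}. A i)"
    by (rule disjoint_atoms[where C="dcube R" and B=B and m=m])
  note A = A_all[rule_format] and BA = BA_all[rule_format]
  have Asub: "A i \<subseteq> dcube R" if "i < M" for i using A[OF that] by blast
  have Ab: "bounded_borel (A i)" if "i < M" for i
  proof -
    \<comment> \<open>\<open>sets.finite_INT\<close> wants a nonempty index set; for
      \<open>m = 0\<close> the atom is the cube itself.\<close>
    have "(\<Inter>l\<in>{..<m}. if l \<in> s i then B l else - B l) \<in> sets borel" if "0 < m"
      by (rule sets.finite_INT) (use B that in \<open>auto simp: bounded_borel_def\<close>)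
    then have "A i \<in> sets borel" unfolding A[OF that] by (cases "m = 0") auto
    moreover have "bounded (A i)" using Asub[OF that] bounded_dcube bounded_subset by blast
    ultimately show ?thesis by (simp add: bounded_borel_def)
  qed
  \<comment> \<open>\<open>\<Phi>\<close> in terms of the counts of the atoms, the count of
    \<open>B l\<close> being the sum over the atoms inside it. It is defined for every
    \<open>j\<close>, so the bound of \<open>\<Phi>\<close> is a bound of \<open>f\<close>
    everywhere.\<close>
  define f :: "(nat \<Rightarrow> nat) \<Rightarrow> real" where
    "f j = \<Phi> (\<lambda>l. if l < m then real (\<Sum>i\<in>{i\<in>{..<M}. l \<in> s i}. j i) else 0)" for j
  let ?X = "\<lambda>i. particles_in (A i)"
  let ?count = "\<lambda>\<xi> l. if l < m then real (particles_in (B l) \<xi>) else 0"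
  have f_eq: "f (restrict (\<lambda>i. ?X i \<xi>) {..<M}) = \<Phi> (?count \<xi>)" if \<xi>: "\<xi> \<in> configurations" for \<xi>
  proof -
    have "(\<Sum>i\<in>{i\<in>{..<M}. l \<in> s i}. restrict (\<lambda>i. ?X i \<xi>) {..<M} i) = particles_in (B l) \<xi>" if l: "l < m" for l
    proof -
      have eq: "B l = (\<Union>i\<in>{i\<in>{..<M}. l \<in> s i}. A i)" using BA[OF l] R l by blast
      have "particles_in (\<Union>i\<in>{i\<in>{..<M}. l \<in> s i}. A i) \<xi> = (\<Sum>i\<in>{i\<in>{..<M}. l \<in> s i}. particles_in (A i) \<xi>)"
        by (rule particles_in_UN[OF \<xi>]) (use disj Ab in \<open>auto simp: disjoint_family_on_def bounded_borel_def\<close>)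
      then show ?thesis unfolding eq[symmetric] by simp
    qed
    then show ?thesis unfolding f_def by (intro arg_cong[of _ _ \<Phi>] ext) auto
  qed
  have \<Phi>: "\<Phi> \<in> borel_measurable borel" using cont by (rule borel_measurable_continuous_onI)
  have count: "?count \<in> borel_measurable Q" if Q: "random_point_field Q" for Q
  proof (rule measurable_coordinatewise_then_product)
    fix l
    show "(\<lambda>\<xi>. ?count \<xi> l) \<in> borel_measurable Q"
    proof (cases "l < m")
      case True
      have "(\<lambda>\<xi>. real (particles_in (B l) \<xi>)) \<in> borel_measurable Q"
        by (rule measurable_compose[OF particles_in_measurable[OF Q]]) (use B True in simp_all)
      then show ?thesis using True by simp
    qed simp
  qed
  have joint: "(LINT x|joint_distribution Q m B. \<Phi> x) = (LINT \<xi>|Q. f (restrict (\<lambda>i. ?X i \<xi>) {..<M}))"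
    if Q: "random_point_field Q" for Q
  proof -
    have "(LINT x|joint_distribution Q m B. \<Phi> x) = (LINT \<xi>|Q. \<Phi> (?count \<xi>))"
      unfolding joint_distribution_def by (rule integral_distr[OF count[OF Q] \<Phi>])
    also have "\<dots> = (LINT \<xi>|Q. f (restrict (\<lambda>i. ?X i \<xi>) {..<M}))"
      by (rule Bochner_Integration.integral_cong) (simp_all add: f_eq space_random_point_field[OF Q])
    finally show ?thesis .
  qed
  have mf: "(\<lambda>\<xi>. f (restrict (\<lambda>i. ?X i \<xi>) {..<M})) \<in> borel_measurable Q" if Q: "random_point_field Q" for Q
  proof -
    have "(\<lambda>\<xi>. \<Phi> (?count \<xi>)) \<in> borel_measurable Q" by (rule measurable_compose[OF count[OF Q] \<Phi>])
    then show ?thesis by (rule measurable_cong[THEN iffD1, rotated]) (simp add: f_eq space_random_point_field[OF Q])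
  qed
  obtain b where b: "\<And>j. \<bar>f j\<bar> \<le> b" using bdd unfolding f_def bounded_iff by force
  define \<theta> where "\<theta> n = Re (LINT x|lborel. indicator (dcube R) x * kn n x x)" for n
  have "(\<lambda>n. LINT x|lborel. indicator (dcube R) x * kn n x x) \<longlonglongrightarrow> (LINT x|lborel. indicator (dcube R) x * k x x)"
    using tr[OF bounded_borel_dcube] by (simp only: op_trace_compress[OF dk bounded_borel_dcube] op_trace_compress[OF dkn bounded_borel_dcube])
  then have "\<theta> \<longlonglongrightarrow> Re (LINT x|lborel. indicator (dcube R) x * k x x)"
    unfolding \<theta>_def[abs_def] by (rule tendsto_Re)
  then have "Bseq \<theta>" by (intro convergent_imp_Bseq convergentI)
  then obtain T where T: "\<And>n. norm (\<theta> n) \<le> T" by (auto simp: Bseq_def)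
  \<comment> \<open>One constant for the limit and the whole sequence: convergent traces are
    bounded.\<close>
  define \<tau> where "\<tau> = max T (Re (LINT x|lborel. indicator (dcube R) x * k x x))"
  have \<tau>n: "\<theta> n \<le> \<tau>" for n using T[of n] by (simp add: \<tau>_def)
  have "(\<lambda>n. LINT \<xi>|Pn n. f (restrict (\<lambda>i. ?X i \<xi>) {..<M})) \<longlonglongrightarrow> (LINT \<xi>|P. f (restrict (\<lambda>i. ?X i \<xi>) {..<M}))"
  proof (rule factorial_moments_tendsto[OF _ _ _ b mf[OF rp] mf[OF rpn]])
    show "factorial_moments P {..<M} ?X (particles_in (dcube R)) \<tau>"
      by (rule factorial_moments_field[OF field Ab Asub disj]) (simp_all add: \<tau>_def)
    show "factorial_moments (Pn n) {..<M} ?X (particles_in (dcube R)) \<tau>" for n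
      by (rule factorial_moments_field[OF fieldn Ab Asub disj]) (use \<tau>n in \<open>simp_all add: \<theta>_def\<close>)
    fix \<kappa> :: "nat \<Rightarrow> nat"
    show "(\<lambda>n. LINT \<xi>|Pn n. (\<Prod>i<M. real (?X i \<xi> choose \<kappa> i))) \<longlonglongrightarrow> (LINT \<xi>|P. (\<Prod>i<M. real (?X i \<xi> choose \<kappa> i)))"
    proof (cases "1 \<le> (\<Sum>i<M. \<kappa> i)")
      case True
      let ?n = "\<Sum>i<M. \<kappa> i"
      have F: "bounded_borel (box_factors M A \<kappa> ! j)" "box_factors M A \<kappa> ! j \<subseteq> dcube R" if "j < ?n" for j
        using box_factors_nth[of j M A \<kappa>] that Ab Asub by (auto simp: length_box_factors)
      have moment: "(LINT \<xi>|Q. (\<Prod>i<M. real (?X i \<xi> choose \<kappa> i)))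
          = Re (box_det_integral ?n (\<lambda>j. box_factors M A \<kappa> ! j) k') / (\<Prod>i<M. fact (\<kappa> i))"
        if "determinantal_field Q K' k'" for Q K' k'
        by (rule determinantal_field_binomial_moment[where R=R, OF that Ab Asub disj refl True])
      have "(\<lambda>n. box_det_integral ?n (\<lambda>j. box_factors M A \<kappa> ! j) (kn n)) \<longlonglongrightarrow> box_det_integral ?n (\<lambda>j. box_factors M A \<kappa> ! j) k"
        by (rule box_det_integral_tendsto[OF dk dkn weak tr F])
      then show ?thesis
        unfolding moment[OF field] moment[OF fieldn] by (intro tendsto_divide tendsto_Re tendsto_const) simp_all
    next
      \<comment> \<open>Order 0 lies outside the range of the correlation functions; the product is
        1 and its integral is the total mass.\<close>
      case False
      then have "\<kappa> i = 0" if "i < M" for i using that by (simp add: not_le)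
      then have one: "(\<Prod>i<M. real (?X i \<xi> choose \<kappa> i)) = 1" for \<xi> by simp
      have "(LINT \<xi>|Q. (1::real)) = 1" if "random_point_field Q" for Q :: "(real ^ 'd \<Rightarrow> nat) measure"
        using that by (simp add: random_point_field_def prob_space.prob_space)
      then show ?thesis unfolding one using rp rpn by simp
    qed
  qed
  then show "(\<lambda>n. LINT x|joint_distribution (Pn n) m B. \<Phi> x) \<longlonglongrightarrow> (LINT x|joint_distribution P m B. \<Phi> x)"
    unfolding joint[OF rp] joint[OF rpn] .
qed

end
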